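(* Let $K$ be a finite extension of $\mathbb{Q}_p$ with ring of integers $\mathcal{O}_K$, let $n\in\{2,3,4\}$, and let $\Phi,\Phi'$ be genus one models of degree $n$ over $\mathcal{O}_K$ with $\Phi'=g\Phi$ for some $g\in\mathcal{G}_n(K)$, say $g=[\mu,r,N]$, $[\mu,N]$ or $[M,N]$ with $N=(n_{ij})$. Let $P\in\mathcal{C}_\Phi(K)$, $P=(x_1:x_2:y)$ or $(x_1:\ldots:x_n)$, and $P'\in\mathcal{C}_{\Phi'}(K)$, $P'=(x'_1:x'_2:y')$ or $(x'_1:\ldots:x'_n)$, with $x_j=\sum_i n_{ij}x'_i$ for all $j$. If either (i) $g$ is integral, or (ii) $\det g\in\mathcal{O}_K^\times$ and $g$ is diagonal, then $\max(|F'_n(\mathbf{x}')|,|G'_n(\mathbf{x}')|)=|\det N|^{-2}\max(|F_n(\mathbf{x})|,|G_n(\mathbf{x})|)$, where $F_n,G_n$ and $F'_n,G'_n$ are the forms associated to $\Phi$ and $\Phi'$ respectively.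
   Context: $|\cdot|$ is an absolute value on $K$ of the form $|x|=c^{-v(x)}$, $c>1$, $v$ the normalised valuation. Genus one models and their transformations over a ring $R$: Degree 2: $(p,q)$ with $p=lx_1^2+mx_1x_2+nx_2^2$, $q=ax_1^4+\dots+ex_2^4$ (coefficients $a,b,c,d,e$), equation $y^2+py=q$; $g=[\mu,r,N]$ with $\mu\in R^\times$, $r=(r_0,r_1,r_2)\in R^3$, $N\in\mathrm{GL}_2(R)$ acts by $y\leftarrow\mu^{-1}y+r_0x_1^2+r_1x_1x_2+r_2x_2^2$ (so writing $r(x_1,x_2)$ for this form, $(p,q)\mapsto(\mu(p+2r),\mu^2(q-pr-r^2))$), followed by $x_j\leftarrow\sum_in_{ij}x_i$; $\det g=\mu\det N$. Degree 3: ternary cubic $U=ax_1^3+bx_2^3+cx_3^3+fx_2^2x_3+gx_3^2x_1+hx_1^2x_2+ix_2x_3^2+jx_3x_1^2+kx_1x_2^2+mx_1x_2x_3$; $g=[\mu,N]$ multiplies $U$ by $\mu\in R^\times$ then substitutes $x_j\leftarrow\sum_in_{ij}x_i$, $N\in\mathrm{GL}_3(R)$; $\det g=\mu\det N$. Degree 4: $(Q_1,Q_2)$ quadrics in $x_1,\dots,x_4$; $g=[M,N]$ replaces $Q_i\leftarrow\sum_jm_{ij}Q_j$ ($M\in\mathrm{GL}_2(R)$) and substitutes $x_j\leftarrow\sum_in_{ij}x_i$ ($N\in\mathrm{GL}_4(R)$); $\det g=\det M\det N$. $g\in\mathcal{G}_n(K)$ is integral if: ($n=2$) $\mu\in\mathcal{O}_K^\times$,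 $r\in\mathcal{O}_K^3$, $N\in\mathrm{GL}_2(\mathcal{O}_K)$; ($n=3$) $\mu\in\mathcal{O}_K^\times$, $N\in\mathrm{GL}_3(\mathcal{O}_K)$; ($n=4$) $M\in\mathrm{GL}_2(\mathcal{O}_K)$, $N\in\mathrm{GL}_4(\mathcal{O}_K)$. $g$ is diagonal if: ($n=2$) $r=0$ and $N$ diagonal; ($n=3$) $N$ diagonal; ($n=4$) $M$ and $N$ diagonal. Forms $F_n,G_n$ (integer polynomials computed generically over $\mathbb{Q}$): $n=2$: $F_2=p^2+4q$, $G_2=(-l^2c+lmb-m^2a-4ac+b^2)x_1^4+(-2l^2d+2lnb-4mna-8ad)x_1^3x_2+(-4l^2e-lmd+2lnc-mnb-4n^2a-16ae-2bd)x_1^2x_2^2+(-4lme+2lnd-2n^2b-8be)x_1x_2^3+(-m^2e+mnd-n^2c-4ce+d^2)x_2^4$. $n=3$: $H=-\tfrac12\det(U_{ij})$, $\Theta=\tfrac13\det\begin{pmatrix}(U_{ij})&(H_i)\\(H_j)&0\end{pmatrix}$, $b_2=m^2-4(fj+gk+hi)$, $Z=\tfrac14(H+b_2U)$, $F_3=Z^2$, $G_3=\tfrac1{192}(\Theta-16b_2Z^2-12b_2^2ZU+b_2^3U^2)$. $n=4$: with $A,B$ the second-derivative matrices of $Q_1,Q_2$ and $a^*_{rs},b^*_{rs}$ the coefficients of the quadrics with second-derivative matrices $\operatorname{adj}A,\operatorname{adj}B$, $T_1=\sum_{i,j}\sum_{r\le s}b^*_{rs}(A_{ij}A_{rs}-A_{is}A_{jr})x_ix_j$,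 $T_2=\sum_{i,j}\sum_{r\le s}a^*_{rs}(B_{ij}B_{rs}-B_{is}B_{jr})x_ix_j$; with $\mathrm{pf}(\sum_{i\le j}c_{ij}x_ix_j)=c_{12}c_{34}+c_{13}c_{24}+c_{14}c_{23}$ and $\mathrm{rd}(\Gamma)=(\det(\partial^2\Gamma)-\mathrm{pf}(\Gamma)^2)/4$, $F_4,G_4$ are $F_2,G_2$ of the degree 2 model $(\mathrm{pf}(xQ_1+zQ_2),\mathrm{rd}(xQ_1+zQ_2))$ evaluated at $(T_1,-T_2)$. *)

theory Defs
  imports "HOL-Analysis.Analysis" "HOL-Library.Poly_Mapping" "HOL-Computational_Algebra.Primes"
begin

section \<open>Finite extensions of the p-adic numbers\<close>

text \<open>
  The field K is the whole type. The field of p-adic numbers is represented by a subfield F of K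
  with an absolute value making it a completion of the rationals for the p-adic absolute value;
  this determines F up to unique isometric isomorphism. The values of the absolute value outside
  of F are irrelevant.
\<close>

definition padic_abs :: "nat \<Rightarrow> rat \<Rightarrow> real" where
  "padic_abs p r = (if r = 0 then 0 else
     real p powi (int (multiplicity (int p) (snd (quotient_of r)))
                  - int (multiplicity (int p) (fst (quotient_of r)))))"

definition subfield_of_type :: "'a::field set \<Rightarrow> bool" where
  "subfield_of_type F \<longleftrightarrow> 0 \<in> F \<and> 1 \<in> F \<and>
     (\<forall>x\<in>F. \<forall>y\<in>F. x + y \<in> F \<and> x * y \<in> F) \<and> (\<forall>x\<in>F. - x \<in> F \<and> inverse x \<in> F)"

definition absolute_value_on :: "'a::field set \<Rightarrow> ('a \<Rightarrow> real) \<Rightarrow> bool" where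
  "absolute_value_on F w \<longleftrightarrow>
     (\<forall>x\<in>F. 0 \<le> w x \<and> (w x = 0 \<longleftrightarrow> x = 0)) \<and>
     (\<forall>x\<in>F. \<forall>y\<in>F. w (x * y) = w x * w y \<and> w (x + y) \<le> w x + w y)"

definition padic_numbers :: "nat \<Rightarrow> 'a::field_char_0 set \<Rightarrow> ('a \<Rightarrow> real) \<Rightarrow> bool" where
  "padic_numbers p F w \<longleftrightarrow>
     prime p \<and> subfield_of_type F \<and> absolute_value_on F w \<and>
     (\<forall>r. w (of_rat r) = padic_abs p r) \<and>
     (\<forall>x\<in>F. \<forall>e>0. \<exists>r. w (x - of_rat r) < e) \<and>
     (\<forall>X. (\<forall>k. X k \<in> F) \<and> (\<forall>e>0. \<exists>k0. \<forall>k\<ge>k0. \<forall>l\<ge>k0. w (X k - X l) < e) \<longrightarrow>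
          (\<exists>x\<in>F. (\<lambda>k. w (X k - x)) \<longlonglongrightarrow> 0))"

definition finite_over :: "'a::field set \<Rightarrow> bool" where
  "finite_over F \<longleftrightarrow> (\<exists>B. finite B \<and> (\<forall>x. \<exists>a. (\<forall>b\<in>B. a b \<in> F) \<and> x = (\<Sum>b\<in>B. a b * b)))"

text \<open>
  The normalised (surjective) discrete valuation of K, with e the ramification index. It is only
  meaningful on nonzero elements; the value at 0, conventionally infinite, is left unspecified.
\<close>

definition normalised_valuation ::
  "nat \<Rightarrow> 'a::field set \<Rightarrow> ('a \<Rightarrow> real) \<Rightarrow> ('a \<Rightarrow> int) \<Rightarrow> bool" where
  "normalised_valuation p F w v \<longleftrightarrow>
     (\<forall>x y. x \<noteq> 0 \<longrightarrow> y \<noteq> 0 \<longrightarrow> v (x * y) = v x + v y) \<and>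
     (\<forall>x y. x \<noteq> 0 \<longrightarrow> y \<noteq> 0 \<longrightarrow> x + y \<noteq> 0 \<longrightarrow> min (v x) (v y) \<le> v (x + y)) \<and>
     v ` (- {0}) = UNIV \<and>
     (\<exists>e::nat. e > 0 \<and> (\<forall>x\<in>F - {0}. w x = real p powr (- (real_of_int (v x) / real e))))"

definition val_ring :: "('a::field \<Rightarrow> int) \<Rightarrow> 'a set" where
  "val_ring v = {x. x = 0 \<or> 0 \<le> v x}"

definition val_abs :: "real \<Rightarrow> ('a::field \<Rightarrow> int) \<Rightarrow> 'a \<Rightarrow> real" where
  "val_abs c v x = (if x = 0 then 0 else c powi (- v x))"


section \<open>Polynomials and matrices over a subring\<close>

text \<open>
  Polynomials with variables indexed by \<open>'i\<close>. For \<open>'i\<close> one of the numeral types 2, 3, 4 the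
  variables are those numbered 1, 2, ... (the last index also being written 0).
\<close>

type_synonym ('i, 'a) mpoly = "('i \<Rightarrow>\<^sub>0 nat) \<Rightarrow>\<^sub>0 'a"

definition Const :: "'a::zero \<Rightarrow> ('i, 'a) mpoly" where
  "Const a = Poly_Mapping.single 0 a"

definition Var :: "'i \<Rightarrow> ('i, 'a::zero_neq_one) mpoly" where
  "Var i = Poly_Mapping.single (Poly_Mapping.single i 1) 1"

text \<open>A monomial is given by the list of its factors: \<open>mp_coeff f [1, 1, 2]\<close> is the coefficient of
  \<open>x\<^sub>1\<^sup>2 x\<^sub>2\<close> in \<open>f\<close>.\<close>

definition mp_coeff :: "('i, 'a::zero) mpoly \<Rightarrow> 'i list \<Rightarrow> 'a" where
  "mp_coeff f is = Poly_Mapping.lookup f (\<Sum>i\<leftarrow>is. Poly_Mapping.single i 1)"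

definition mp_insert ::
  "('a::zero \<Rightarrow> 'b::comm_ring_1) \<Rightarrow> ('i::finite \<Rightarrow> 'b) \<Rightarrow> ('i, 'a) mpoly \<Rightarrow> 'b" where
  "mp_insert h s f = (\<Sum>m\<in>Poly_Mapping.keys f.
     h (Poly_Mapping.lookup f m) * (\<Prod>i\<in>UNIV. s i ^ Poly_Mapping.lookup m i))"

definition mp_eval :: "('i::finite, 'a::comm_ring_1) mpoly \<Rightarrow> 'a^'i \<Rightarrow> 'a" where
  "mp_eval f x = mp_insert (\<lambda>a. a) (\<lambda>i. x $ i) f"

text \<open>The substitution \<open>x\<^sub>j \<leftarrow> \<Sum>\<^sub>i n\<^sub>i\<^sub>j x\<^sub>i\<close>.\<close>

definition lin_subst ::
  "'a::comm_ring_1^'i::finite^'i \<Rightarrow> ('i, 'a) mpoly \<Rightarrow> ('i, 'a) mpoly" where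
  "lin_subst N f = mp_insert Const (\<lambda>j. \<Sum>i\<in>UNIV. Const (N $ i $ j) * Var i) f"

definition mp_deriv :: "'i \<Rightarrow> ('i, 'a::comm_ring_1) mpoly \<Rightarrow> ('i, 'a) mpoly" where
  "mp_deriv i f = (\<Sum>m\<in>Poly_Mapping.keys f. Poly_Mapping.single (m - Poly_Mapping.single i 1)
     (of_nat (Poly_Mapping.lookup m i) * Poly_Mapping.lookup f m))"

definition hessian :: "('i::finite, 'a::comm_ring_1) mpoly \<Rightarrow> ('i, 'a) mpoly^'i^'i" where
  "hessian f = (\<chi> i j. mp_deriv i (mp_deriv j f))"

text \<open>The second-derivative matrix of a quadratic form, as a matrix of scalars.\<close>

definition quad_matrix :: "('i::finite, 'a::comm_ring_1) mpoly \<Rightarrow> 'a^'i^'i" where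
  "quad_matrix f = (\<chi> i j. mp_coeff (hessian f $ i $ j) [])"

definition form_over :: "nat \<Rightarrow> 'a::zero set \<Rightarrow> ('i::finite, 'a) mpoly \<Rightarrow> bool" where
  "form_over d R f \<longleftrightarrow> (\<forall>m\<in>Poly_Mapping.keys f.
     (\<Sum>i\<in>UNIV. Poly_Mapping.lookup m i) = d \<and> Poly_Mapping.lookup f m \<in> R)"

definition unit_set :: "'a::comm_ring_1 set \<Rightarrow> 'a set" where
  "unit_set R = {x\<in>R. \<exists>y\<in>R. x * y = 1}"

definition GL :: "'a::comm_ring_1 set \<Rightarrow> ('a^'n::finite^'n) set" where
  "GL R = {N. (\<forall>i j. N $ i $ j \<in> R) \<and>
     (\<exists>N'. (\<forall>i j. N' $ i $ j \<in> R) \<and> N ** N' = mat 1 \<and> N' ** N = mat 1)}"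

definition diagonal_matrix :: "'a::zero^'n^'n \<Rightarrow> bool" where
  "diagonal_matrix N \<longleftrightarrow> (\<forall>i j. i \<noteq> j \<longrightarrow> N $ i $ j = 0)"

text \<open>The entry at \<open>(i, j)\<close> is the cofactor of \<open>A\<close> at \<open>(j, i)\<close>.\<close>

definition adjugate :: "'a::comm_ring_1^'n::finite^'n \<Rightarrow> 'a^'n^'n" where
  "adjugate A = (\<chi> i j. det (\<chi> k. if k = j then axis i 1 else A $ k))"


section \<open>Degree 2\<close>

type_synonym 'a model2 = "(2, 'a) mpoly \<times> (2, 'a) mpoly"
type_synonym 'a transf2 = "'a \<times> ('a \<times> 'a \<times> 'a) \<times> ('a^2^2)"

definition model2_over :: "'a::zero set \<Rightarrow> 'a model2 \<Rightarrow> bool" where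
  "model2_over R = (\<lambda>(p, q). form_over 2 R p \<and> form_over 4 R q)"

definition G2_over :: "'a::comm_ring_1 set \<Rightarrow> 'a transf2 set" where
  "G2_over R = {(\<mu>, (r0, r1, r2), N).
     \<mu> \<in> unit_set R \<and> r0 \<in> R \<and> r1 \<in> R \<and> r2 \<in> R \<and> N \<in> GL R}"

definition act2 :: "'a::comm_ring_1 transf2 \<Rightarrow> 'a model2 \<Rightarrow> 'a model2" where
  "act2 = (\<lambda>(\<mu>, (r0, r1, r2), N) (p, q).
     let r = Const r0 * Var 1 ^ 2 + Const r1 * Var 1 * Var 2 + Const r2 * Var 2 ^ 2
     in (lin_subst N (Const \<mu> * (p + 2 * r)), lin_subst N (Const (\<mu>^2) * (q - p * r - r^2))))"

definition det2 :: "'a::comm_ring_1 transf2 \<Rightarrow> 'a" where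
  "det2 = (\<lambda>(\<mu>, r, N). \<mu> * det N)"

definition diagonal2 :: "'a::comm_ring_1 transf2 \<Rightarrow> bool" where
  "diagonal2 = (\<lambda>(\<mu>, r, N). r = (0, 0, 0) \<and> diagonal_matrix N)"

text \<open>The point \<open>(x\<^sub>1 : x\<^sub>2 : y)\<close> of the weighted projective plane lies on \<open>y\<^sup>2 + p y = q\<close>.\<close>

definition on_curve2 :: "'a::comm_ring_1 model2 \<Rightarrow> ('a^2) \<times> 'a \<Rightarrow> bool" where
  "on_curve2 = (\<lambda>(p, q) (x, y). (x, y) \<noteq> (0, 0) \<and> y^2 + mp_eval p x * y = mp_eval q x)"

definition F2 :: "'a::comm_ring_1 model2 \<Rightarrow> (2, 'a) mpoly" where
  "F2 = (\<lambda>(p, q). p^2 + 4 * q)"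

definition G2 :: "'a::comm_ring_1 model2 \<Rightarrow> (2, 'a) mpoly" where
  "G2 = (\<lambda>(p, q). let
       l = mp_coeff p [1,1]; m = mp_coeff p [1,2]; n = mp_coeff p [2,2];
       a = mp_coeff q [1,1,1,1]; b = mp_coeff q [1,1,1,2]; c = mp_coeff q [1,1,2,2];
       d = mp_coeff q [1,2,2,2]; e = mp_coeff q [2,2,2,2]
     in Const (- (l^2*c) + l*m*b - m^2*a - 4*a*c + b^2) * Var 1 ^ 4
      + Const (- 2*l^2*d + 2*l*n*b - 4*m*n*a - 8*a*d) * Var 1 ^ 3 * Var 2
      + Const (- 4*l^2*e - l*m*d + 2*l*n*c - m*n*b - 4*n^2*a - 16*a*e - 2*b*d)
          * Var 1 ^ 2 * Var 2 ^ 2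
      + Const (- 4*l*m*e + 2*l*n*d - 2*n^2*b - 8*b*e) * Var 1 * Var 2 ^ 3
      + Const (- (m^2*e) + m*n*d - n^2*c - 4*c*e + d^2) * Var 2 ^ 4)"


section \<open>Degree 3\<close>

type_synonym 'a model3 = "(3, 'a) mpoly"
type_synonym 'a transf3 = "'a \<times> ('a^3^3)"

definition model3_over :: "'a::zero set \<Rightarrow> 'a model3 \<Rightarrow> bool" where
  "model3_over R U \<longleftrightarrow> form_over 3 R U"

definition G3_over :: "'a::comm_ring_1 set \<Rightarrow> 'a transf3 set" where
  "G3_over R = {(\<mu>, N). \<mu> \<in> unit_set R \<and> N \<in> GL R}"

definition act3 :: "'a::comm_ring_1 transf3 \<Rightarrow> 'a model3 \<Rightarrow> 'a model3" where
  "act3 = (\<lambda>(\<mu>, N) U. lin_subst N (Const \<mu> * U))"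

definition det3 :: "'a::comm_ring_1 transf3 \<Rightarrow> 'a" where
  "det3 = (\<lambda>(\<mu>, N). \<mu> * det N)"

definition diagonal3 :: "'a::zero transf3 \<Rightarrow> bool" where
  "diagonal3 = (\<lambda>(\<mu>, N). diagonal_matrix N)"

definition on_curve3 :: "'a::comm_ring_1 model3 \<Rightarrow> 'a^3 \<Rightarrow> bool" where
  "on_curve3 U x \<longleftrightarrow> x \<noteq> 0 \<and> mp_eval U x = 0"

text \<open>The integer polynomials \<open>F\<^sub>3\<close>, \<open>G\<^sub>3\<close> (and later \<open>F\<^sub>4\<close>, \<open>G\<^sub>4\<close>) in the coefficients are defined by
  formulas with denominators, which make sense over any field of characteristic 0.\<close>

definition H3 :: "'a::field_char_0 model3 \<Rightarrow> (3, 'a) mpoly" where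
  "H3 U = Const (- 1 / 2) * det (hessian U)"

definition Theta3 :: "'a::field_char_0 model3 \<Rightarrow> (3, 'a) mpoly" where
  "Theta3 U = (let u = (\<lambda>i j. hessian U $ i $ j); h = (\<lambda>i. mp_deriv i (H3 U)) in
     Const (1 / 3) * det (vector
       [vector [u 1 1, u 1 2, u 1 3, h 1],
        vector [u 2 1, u 2 2, u 2 3, h 2],
        vector [u 3 1, u 3 2, u 3 3, h 3],
        vector [h 1,   h 2,   h 3,   0]] :: (3, 'a) mpoly^4^4))"

definition b2_3 :: "'a::comm_ring_1 model3 \<Rightarrow> 'a" where
  "b2_3 U = (let
       f = mp_coeff U [2,2,3]; g = mp_coeff U [3,3,1]; h = mp_coeff U [1,1,2];
       i = mp_coeff U [2,3,3]; j = mp_coeff U [3,1,1]; k = mp_coeff U [1,2,2]; m = mp_coeff U [1,2,3]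
     in m^2 - 4 * (f*j + g*k + h*i))"

definition Z3 :: "'a::field_char_0 model3 \<Rightarrow> (3, 'a) mpoly" where
  "Z3 U = Const (1 / 4) * (H3 U + Const (b2_3 U) * U)"

definition F3 :: "'a::field_char_0 model3 \<Rightarrow> (3, 'a) mpoly" where
  "F3 U = (Z3 U)^2"

definition G3 :: "'a::field_char_0 model3 \<Rightarrow> (3, 'a) mpoly" where
  "G3 U = Const (1 / 192) * (Theta3 U - 16 * Const (b2_3 U) * (Z3 U)^2
     - 12 * Const ((b2_3 U)^2) * Z3 U * U + Const ((b2_3 U)^3) * U^2)"


section \<open>Degree 4\<close>

type_synonym 'a model4 = "(4, 'a) mpoly \<times> (4, 'a) mpoly"
type_synonym 'a transf4 = "('a^2^2) \<times> ('a^4^4)"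

definition model4_over :: "'a::zero set \<Rightarrow> 'a model4 \<Rightarrow> bool" where
  "model4_over R = (\<lambda>(Q1, Q2). form_over 2 R Q1 \<and> form_over 2 R Q2)"

definition G4_over :: "'a::comm_ring_1 set \<Rightarrow> 'a transf4 set" where
  "G4_over R = {(M, N). M \<in> GL R \<and> N \<in> GL R}"

definition act4 :: "'a::comm_ring_1 transf4 \<Rightarrow> 'a model4 \<Rightarrow> 'a model4" where
  "act4 = (\<lambda>(M, N) (Q1, Q2).
     (lin_subst N (Const (M $ 1 $ 1) * Q1 + Const (M $ 1 $ 2) * Q2),
      lin_subst N (Const (M $ 2 $ 1) * Q1 + Const (M $ 2 $ 2) * Q2)))"

definition det4 :: "'a::comm_ring_1 transf4 \<Rightarrow> 'a" where
  "det4 = (\<lambda>(M, N). det M * det N)"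

definition diagonal4 :: "'a::zero transf4 \<Rightarrow> bool" where
  "diagonal4 = (\<lambda>(M, N). diagonal_matrix M \<and> diagonal_matrix N)"

definition on_curve4 :: "'a::comm_ring_1 model4 \<Rightarrow> 'a^4 \<Rightarrow> bool" where
  "on_curve4 = (\<lambda>(Q1, Q2) x. x \<noteq> 0 \<and> mp_eval Q1 x = 0 \<and> mp_eval Q2 x = 0)"

definition index_pairs4 :: "(4 \<times> 4) set" where
  "index_pairs4 = {(1,1), (1,2), (1,3), (1,4), (2,2), (2,3), (2,4), (3,3), (3,4), (4,4)}"

text \<open>The coefficient of \<open>x\<^sub>r x\<^sub>s\<close> in the quadratic form with second-derivative matrix \<open>S\<close>.\<close>

definition matrix_coeff :: "'a::field_char_0^'n^'n \<Rightarrow> 'n \<Rightarrow> 'n \<Rightarrow> 'a" where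
  "matrix_coeff S r s = (if r = s then S $ r $ s / 2 else S $ r $ s)"

text \<open>\<open>T\<^sub>1 = T4 A B\<close> and \<open>T\<^sub>2 = T4 B A\<close>.\<close>

definition T4 :: "'a::field_char_0^4^4 \<Rightarrow> 'a^4^4 \<Rightarrow> (4, 'a) mpoly" where
  "T4 A B = (\<Sum>i\<in>UNIV. \<Sum>j\<in>UNIV. \<Sum>(r, s)\<in>index_pairs4.
     Const (matrix_coeff (adjugate B) r s * (A $ i $ j * A $ r $ s - A $ i $ s * A $ j $ r))
       * Var i * Var j)"

definition pf :: "(4, 'b::comm_ring_1) mpoly \<Rightarrow> 'b" where
  "pf \<Gamma> = mp_coeff \<Gamma> [1,2] * mp_coeff \<Gamma> [3,4] + mp_coeff \<Gamma> [1,3] * mp_coeff \<Gamma> [2,4]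
          + mp_coeff \<Gamma> [1,4] * mp_coeff \<Gamma> [2,3]"

text \<open>The quadratic form \<open>x Q\<^sub>1 + z Q\<^sub>2\<close> has coefficients in the polynomial ring in \<open>x\<close> and \<open>z\<close>,
  the variables \<open>Var 1\<close> and \<open>Var 2\<close>.\<close>

definition pencil :: "'a::comm_ring_1 model4 \<Rightarrow> (4, (2, 'a) mpoly) mpoly" where
  "pencil = (\<lambda>(Q1, Q2). Const (Var 1) * Poly_Mapping.map Const Q1
                       + Const (Var 2) * Poly_Mapping.map Const Q2)"

definition rd :: "(4, (2, 'a::field_char_0) mpoly) mpoly \<Rightarrow> (2, 'a) mpoly" where
  "rd \<Gamma> = Const (1 / 4) * (det (quad_matrix \<Gamma>) - (pf \<Gamma>)^2)"

definition resolvent4 :: "'a::field_char_0 model4 \<Rightarrow> 'a model2" where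
  "resolvent4 \<Phi> = (pf (pencil \<Phi>), rd (pencil \<Phi>))"

definition at_T4 :: "'a::field_char_0 model4 \<Rightarrow> (2, 'a) mpoly \<Rightarrow> (4, 'a) mpoly" where
  "at_T4 = (\<lambda>(Q1, Q2). let A = quad_matrix Q1; B = quad_matrix Q2 in
     mp_insert Const (\<lambda>i. if i = 1 then T4 A B else - T4 B A))"

definition F4 :: "'a::field_char_0 model4 \<Rightarrow> (4, 'a) mpoly" where
  "F4 \<Phi> = at_T4 \<Phi> (F2 (resolvent4 \<Phi>))"

definition G4 :: "'a::field_char_0 model4 \<Rightarrow> (4, 'a) mpoly" where
  "G4 \<Phi> = at_T4 \<Phi> (G2 (resolvent4 \<Phi>))"

end

(* In every degree F and G are, on the curve, combinations of honest covariants of the model and of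
   the coefficient b2 of the Weierstrass equation of the Jacobian: F is a covariant and
   G = C - (b2/12) F for a covariant C (for n = 2, 4 a Hessian, for n = 3 the bordered Hessian Theta).
   Covariants scale exactly by powers of det g and det N, and for g diagonal so does b2. For g integral
   b2 changes from b2 to (det g)^2 b2 + 12 rho with rho in the valuation ring, so G changes by an
   integral multiple of F, which does not affect the maximum of a non-archimedean absolute value.
   The congruence for b2 is checked on transvections and diagonal matrices, which suffices by the
   Smith normal form over a valuation ring. *)


theory Submission
  imports Defs
begin

text \<open>In residue characteristic 2 or 3 the factor 1/12 is not integral, so C alone does not
  control the maximum; the congruence for b2 modulo 12 cancels exactly this denominator. The shift
  by b2/12 is the one that completes the cube in a Weierstrass equation. With \<delta> = det g and
  \<nu> = det N, every degree ends in F' \<nu>^2 = \<delta>^k F and G' \<nu>^2 = \<delta>^(k+2) G -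
  \<rho> \<delta>^k F, where k = 2, 6, 12 for n = 2, 3, 4. In degree 2 the change of b2 is an
  explicit formula in the entries of g; transvections serve degrees 3 and 4. The obstacle in degree
  4 is that the resolvent (pf, rd) of the new pencil does not arise from the old one by substituting
  M and scaling: only pf^2 + 4 rd behaves so, while pf(Q) is multiplied by det N only up to
  multiples of 2. Hence b2 of the resolvent is written as the middle coefficient of pf^2 + 4 rd
  minus 6 pf(Q1) pf(Q2), and 6 times 2 gives the modulus 12.\<close>

section \<open>Ring homomorphisms\<close>

text \<open>Formulated for an explicit function, so that constants, evaluation at a point and
  substitution are instances of one notion and pass through sums, powers and determinants by the
  same rules.\<close>

locale ring_hom_fun =
  fixes h :: "'a::comm_ring_1 \<Rightarrow> 'b::comm_ring_1"
  assumes hom_1 [simp]: "h 1 = 1"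
    and hom_add [simp]: "h (x + y) = h x + h y"
    and hom_mult [simp]: "h (x * y) = h x * h y"
begin

lemma hom_0 [simp]: "h 0 = 0"
  using hom_add[of 0 0] by simp

lemma hom_uminus [simp]: "h (- x) = - h x"
  using hom_add[of x "- x"] by (simp add: eq_neg_iff_add_eq_0 add.commute)

lemma hom_diff [simp]: "h (x - y) = h x - h y"
  using hom_add[of x "- y"] by simp

lemma hom_power [simp]: "h (x ^ n) = h x ^ n"
  by (induction n) auto

lemma hom_of_nat [simp]: "h (of_nat n) = of_nat n"
  by (induction n) auto

lemma hom_numeral [simp]: "h (numeral n) = numeral n"
  using hom_of_nat[of "numeral n"] by simp

lemma hom_sum [simp]: "h (sum f A) = (\<Sum>a\<in>A. h (f a))"
  by (induction A rule: infinite_finite_induct) auto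

lemma hom_prod [simp]: "h (prod f A) = (\<Prod>a\<in>A. h (f a))"
  by (induction A rule: infinite_finite_induct) auto

lemma hom_of_int [simp]: "h (of_int n) = of_int n"
  by (cases n rule: int_cases2) auto

lemma hom_det: "h (det A) = det (\<chi> i j. h (A $ i $ j))"
  by (simp add: det_def)

end


section \<open>Universal property, chain rule, and coefficients as derivatives at 0\<close>

section \<open>Evaluation and differentiation of polynomials\<close>

lemma ring_hom_Const: "ring_hom_fun (Const :: 'a::comm_ring_1 \<Rightarrow> ('i, 'a) mpoly)"
  by unfold_locales (simp_all add: Const_def single_add mult_single)

lemma ring_hom_id: "ring_hom_fun (\<lambda>a. a)"
  by unfold_locales auto

interpretation Const: ring_hom_fun "Const :: 'a::comm_ring_1 \<Rightarrow> ('i, 'a) mpoly"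
  by (rule ring_hom_Const)

text \<open>Constants and variables generate the polynomial ring, so equality of homomorphisms
  (\<open>mpoly_hom_eqI\<close>) and the chain rule (\<open>mp_deriv_lin_subst\<close>) need a check
  only on these.\<close>

lemma mpoly_induct [case_names Const Var add mult]:
  fixes f :: "('i, 'a::comm_ring_1) mpoly"
  assumes Const: "\<And>a. P (Const a)" and Var: "\<And>i. P (Var i)"
    and add: "\<And>f g. P f \<Longrightarrow> P g \<Longrightarrow> P (f + g)" and mult: "\<And>f g. P f \<Longrightarrow> P g \<Longrightarrow> P (f * g)"
  shows "P f"
proof -
  have power: "P (Poly_Mapping.single (Poly_Mapping.single i n) 1)" for i n
  proof (induction n)
    case 0
    show ?case using Const[of 1] by (simp add: Const_def)
  next
    case (Suc n)
    have "Poly_Mapping.single (Poly_Mapping.single i (Suc n)) (1::'a)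
      = Var i * Poly_Mapping.single (Poly_Mapping.single i n) 1"
      by (simp add: Var_def mult_single flip: single_add)
    then show ?case using mult[OF Var[of i] Suc] by simp
  qed
  have monom: "P (Poly_Mapping.single m 1)" for m
  proof (induction m rule: Poly_Mapping.update_induct)
    case const
    show ?case using Const[of 1] by (simp add: Const_def)
  next
    case (update m i n)
    have "Poly_Mapping.update i n m = Poly_Mapping.single i n + m"
      using update(1) by (intro poly_mapping_eqI)
        (auto simp: lookup_update lookup_add lookup_single in_keys_iff)
    then have "Poly_Mapping.single (Poly_Mapping.update i n m) (1::'a)
      = Poly_Mapping.single (Poly_Mapping.single i n) 1 * Poly_Mapping.single m 1"
      by (simp add: mult_single)
    then show ?case using mult[OF power update(3)] by simp
  qed
  have single: "P (Poly_Mapping.single m a)" for m a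
    using mult[OF Const[of a] monom[of m]] by (simp add: Const_def mult_single)
  show ?thesis
  proof (induction f rule: Poly_Mapping.update_induct)
    case const
    show ?case using Const[of 0] by (simp add: Const_def)
  next
    case (update f m a)
    have "Poly_Mapping.update m a f = Poly_Mapping.single m a + f"
      using update(1) by (intro poly_mapping_eqI)
        (auto simp: lookup_update lookup_add lookup_single in_keys_iff)
    then show ?case using add[OF single update(3)] by simp
  qed
qed

lemma poly_mapping_sum_single:
  "f = (\<Sum>m\<in>Poly_Mapping.keys f. Poly_Mapping.single m (Poly_Mapping.lookup f m))"
  by (intro poly_mapping_eqI)
    (auto simp: lookup_sum lookup_single in_keys_iff when_def sum.delta)

context ring_hom_fun
begin

text \<open>Cancellation can shrink the set of keys of a sum, so the defining sums of f, g and f + g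
  are compared over a common finite superset.\<close>

lemma mp_insert_superset:
  assumes "finite S" "Poly_Mapping.keys f \<subseteq> S"
  shows "mp_insert h s f
    = (\<Sum>m\<in>S. h (Poly_Mapping.lookup f m) * (\<Prod>i\<in>UNIV. s i ^ Poly_Mapping.lookup m i))"
  unfolding mp_insert_def
  by (rule sum.mono_neutral_left) (use assms in \<open>auto simp: in_keys_iff\<close>)

lemma mp_insert_add: "mp_insert h s (f + g) = mp_insert h s f + mp_insert h s g"
proof -
  let ?S = "Poly_Mapping.keys f \<union> Poly_Mapping.keys g \<union> Poly_Mapping.keys (f + g)"
  have "finite ?S" by simp
  then show ?thesis
    by (simp add: mp_insert_superset[of ?S] lookup_add distrib_right sum.distrib Un_upper1 Un_upper2
        subset_trans[OF _ Un_upper1])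
qed

lemma mp_insert_single:
  "mp_insert h s (Poly_Mapping.single m a) = h a * (\<Prod>i\<in>UNIV. s i ^ Poly_Mapping.lookup m i)"
  by (subst mp_insert_superset[of "{m}"]) auto

lemma mp_insert_zero: "mp_insert h s 0 = 0"
  by (simp add: mp_insert_def)

lemma mp_insert_sum: "mp_insert h s (sum f A) = (\<Sum>a\<in>A. mp_insert h s (f a))"
  by (induction A rule: infinite_finite_induct) (auto simp: mp_insert_add mp_insert_zero)

lemma mp_insert_mult: "mp_insert h s (f * g) = mp_insert h s f * mp_insert h s g"
proof -
  have "f * g = (\<Sum>m\<in>Poly_Mapping.keys f. \<Sum>n\<in>Poly_Mapping.keys g.
      Poly_Mapping.single (m + n) (Poly_Mapping.lookup f m * Poly_Mapping.lookup g n))"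
    by (subst poly_mapping_sum_single[of f], subst poly_mapping_sum_single[of g])
      (simp add: sum_product mult_single)
  moreover have "mp_insert h s f * mp_insert h s g
    = (\<Sum>m\<in>Poly_Mapping.keys f. \<Sum>n\<in>Poly_Mapping.keys g.
      mp_insert h s (Poly_Mapping.single (m + n) (Poly_Mapping.lookup f m * Poly_Mapping.lookup g n)))"
    by (simp add: mp_insert_def[of h s f] mp_insert_def[of h s g] sum_product mp_insert_single
        lookup_add power_add prod.distrib mult_ac)
  ultimately show ?thesis by (simp add: mp_insert_sum)
qed

lemma mp_insert_Const [simp]: "mp_insert h s (Const a) = h a"
  by (simp add: Const_def mp_insert_single)

lemma mp_insert_Var [simp]: "mp_insert h s (Var i) = s i"
proof -
  have "(\<Prod>j\<in>UNIV. s j ^ Poly_Mapping.lookup (Poly_Mapping.single i 1) j)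
    = (\<Prod>j\<in>UNIV. if j = i then s j else 1)"
    by (rule prod.cong) (auto simp: lookup_single)
  then show ?thesis by (simp add: Var_def mp_insert_single)
qed

lemma ring_hom_mp_insert: "ring_hom_fun (mp_insert h s)"
  by unfold_locales
    (use mp_insert_Const[of s 1] in \<open>simp_all add: mp_insert_add mp_insert_mult\<close>)

end

lemma mpoly_hom_eqI:
  assumes "ring_hom_fun H" "ring_hom_fun G"
    and "\<And>a. H (Const a) = G (Const a)" "\<And>i. H (Var i) = G (Var i)"
  shows "H f = G (f :: ('i, 'a::comm_ring_1) mpoly)"
  using assms(3,4)
  by (induction f rule: mpoly_induct)
    (simp_all add: ring_hom_fun.hom_add[OF assms(1)] ring_hom_fun.hom_add[OF assms(2)]
      ring_hom_fun.hom_mult[OF assms(1)] ring_hom_fun.hom_mult[OF assms(2)])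

interpretation eval: ring_hom_fun "\<lambda>f. mp_eval f x"
  for x :: "'a::comm_ring_1^'i::finite"
  unfolding mp_eval_def by (rule ring_hom_fun.ring_hom_mp_insert[OF ring_hom_id])

lemma mp_eval_Const [simp]: "mp_eval (Const a) x = a"
  unfolding mp_eval_def by (rule ring_hom_fun.mp_insert_Const[OF ring_hom_id])

lemma mp_eval_Var [simp]: "mp_eval (Var i) x = x $ i"
  unfolding mp_eval_def by (rule ring_hom_fun.mp_insert_Var[OF ring_hom_id])

interpretation lin_subst: ring_hom_fun "lin_subst N"
  for N :: "'a::comm_ring_1^'i::finite^'i"
  unfolding lin_subst_def[abs_def] by (rule ring_hom_fun.ring_hom_mp_insert[OF ring_hom_Const])

lemma lin_subst_Const [simp]: "lin_subst N (Const a) = Const a"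
  unfolding lin_subst_def by (rule ring_hom_fun.mp_insert_Const[OF ring_hom_Const])

lemma lin_subst_Var [simp]: "lin_subst N (Var j) = (\<Sum>i\<in>UNIV. Const (N $ i $ j) * Var i)"
  unfolding lin_subst_def by (rule ring_hom_fun.mp_insert_Var[OF ring_hom_Const])

text \<open>The relation between the points P and P' in the theorem is x =
  \<open>transpose N *v x'\<close>; so the value of a transformed form at x' is the value of the
  original at x.\<close>

lemma mp_eval_lin_subst: "mp_eval (lin_subst N f) x = mp_eval f (transpose N *v x)"
  by (rule mpoly_hom_eqI[where f = f]; (unfold_locales)?)
    (simp_all add: matrix_vector_mult_def transpose_def)

text \<open>The order of the factors is kept, which is what the product case of
  \<open>matrix_induct\<close> relies on.\<close>

lemma lin_subst_mult: "lin_subst (A ** B) f = lin_subst A (lin_subst B f)"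
proof (rule mpoly_hom_eqI[where f = f]; (unfold_locales)?)
  fix j
  have "lin_subst (A ** B) (Var j) = (\<Sum>i\<in>UNIV. \<Sum>k\<in>UNIV. Const (A $ i $ k) * Const (B $ k $ j) * Var i)"
    by (simp add: matrix_matrix_mult_def sum_distrib_right)
  also have "\<dots> = lin_subst A (lin_subst B (Var j))"
    by (subst sum.swap) (simp add: sum_distrib_left mult_ac)
  finally show "lin_subst (A ** B) (Var j) = lin_subst A (lin_subst B (Var j))" .
qed simp_all

lemma lookup_mp_deriv:
  "Poly_Mapping.lookup (mp_deriv i f) m
    = of_nat (Suc (Poly_Mapping.lookup m i)) * Poly_Mapping.lookup f (m + Poly_Mapping.single i 1)"
proof -
  let ?e = "Poly_Mapping.single i (1::nat)"
  let ?t = "of_nat (Suc (Poly_Mapping.lookup m i)) * Poly_Mapping.lookup f (m + ?e)"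
  have "Poly_Mapping.lookup (Poly_Mapping.single (k - ?e)
      (of_nat (Poly_Mapping.lookup k i) * Poly_Mapping.lookup f k)) m
    = (if k = m + ?e then ?t else 0)" for k
  proof (cases "k = m + ?e")
    case True
    then show ?thesis by (simp add: lookup_add)
  next
    case False
    \<comment> \<open>Subtraction of exponents is truncated, so k - e = m can hold without k = m +
      e; then the variable is absent from k and the factor \<open>of_nat 0\<close> kills the
      term.\<close>
    have "Poly_Mapping.lookup k i = 0" if "k - ?e = m"
    proof (rule ccontr)
      assume "Poly_Mapping.lookup k i \<noteq> 0"
      then have "k = k - ?e + ?e"
        by (intro poly_mapping_eqI) (auto simp: lookup_add lookup_minus lookup_single when_def)
      with that False show False by simp
    qed
    with False show ?thesis by (auto simp: lookup_single when_def)
  qed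
  then show ?thesis
    by (auto simp: mp_deriv_def lookup_sum sum.delta in_keys_iff)
qed

lemma mp_deriv_add [simp]: "mp_deriv i (f + g) = mp_deriv i f + mp_deriv i g"
  by (intro poly_mapping_eqI) (simp add: lookup_mp_deriv lookup_add distrib_left)

lemma mp_deriv_0 [simp]: "mp_deriv i 0 = 0"
  by (simp add: mp_deriv_def)

lemma mp_deriv_sum [simp]: "mp_deriv i (sum f A) = (\<Sum>a\<in>A. mp_deriv i (f a))"
  by (induction A rule: infinite_finite_induct) auto

lemma mp_deriv_Const [simp]: "mp_deriv i (Const a) = 0"
  by (intro poly_mapping_eqI)
    (auto simp: lookup_mp_deriv Const_def lookup_single when_def poly_mapping_eq_iff fun_eq_iff
      lookup_add split: if_splits)

lemma mp_deriv_one [simp]: "mp_deriv i 1 = 0"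
  using mp_deriv_Const[of i 1] by simp

lemma mp_deriv_numeral [simp]: "mp_deriv i (numeral n) = 0"
  using mp_deriv_Const[of i "numeral n"] by simp

lemma mp_deriv_Var [simp]: "mp_deriv i (Var j) = (if i = j then 1 else 0)"
proof (intro poly_mapping_eqI)
  fix m
  show "Poly_Mapping.lookup (mp_deriv i (Var j)) m
    = Poly_Mapping.lookup (if i = j then 1 else 0 :: ('a, 'b) mpoly) m"
  proof (cases "i = j")
    case True
    then show ?thesis
      by (cases "m = 0") (auto simp: lookup_mp_deriv Var_def lookup_single lookup_one when_def)
  next
    case False
    then have "Poly_Mapping.single j 1 \<noteq> m + Poly_Mapping.single i (1::nat)"
      by (auto simp: poly_mapping_eq_iff fun_eq_iff lookup_add lookup_single when_def
          dest!: spec[of _ i])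
    with False show ?thesis by (simp add: lookup_mp_deriv Var_def lookup_single)
  qed
qed

lemma mp_deriv_single:
  "mp_deriv i (Poly_Mapping.single m a)
    = Poly_Mapping.single (m - Poly_Mapping.single i 1) (of_nat (Poly_Mapping.lookup m i) * a)"
  by (cases "a = 0") (simp_all add: mp_deriv_def)

lemma mp_deriv_mult [simp]: "mp_deriv i (f * g) = mp_deriv i f * g + f * mp_deriv i g"
proof -
  have single: "mp_deriv i (Poly_Mapping.single m a * Poly_Mapping.single n b)
    = mp_deriv i (Poly_Mapping.single m a) * Poly_Mapping.single n b
      + Poly_Mapping.single m a * mp_deriv i (Poly_Mapping.single n b)" for m n a b
  proof -
    let ?e = "Poly_Mapping.single i (1::nat)"
    \<comment> \<open>Because of truncation this fails when the variable is absent from k, but then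
      the coefficient in 1 and 2 below is 0.\<close>
    have shift: "k - ?e + l = k + l - ?e" if "Poly_Mapping.lookup k i \<noteq> 0" for k l
      using that by (intro poly_mapping_eqI)
        (auto simp: lookup_add lookup_minus lookup_single when_def)
    have 1: "Poly_Mapping.single (m - ?e + n) (of_nat (Poly_Mapping.lookup m i) * (a * b))
      = Poly_Mapping.single (m + n - ?e) (of_nat (Poly_Mapping.lookup m i) * (a * b))"
      using shift[of m n] by (cases "Poly_Mapping.lookup m i = 0") auto
    have 2: "Poly_Mapping.single (m + (n - ?e)) (of_nat (Poly_Mapping.lookup n i) * (a * b))
      = Poly_Mapping.single (m + n - ?e) (of_nat (Poly_Mapping.lookup n i) * (a * b))"
      using shift[of n m] by (cases "Poly_Mapping.lookup n i = 0") (auto simp: add.commute)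
    show ?thesis
      unfolding mult_single mp_deriv_single mult.assoc mult.left_commute[of a] 1 2
      unfolding single_add[symmetric] lookup_add of_nat_add distrib_right ..
  qed
  let ?f = "\<lambda>m. Poly_Mapping.single m (Poly_Mapping.lookup f m)"
  let ?g = "\<lambda>m. Poly_Mapping.single m (Poly_Mapping.lookup g m)"
  have f: "f = sum ?f (Poly_Mapping.keys f)" and g: "g = sum ?g (Poly_Mapping.keys g)"
    by (rule poly_mapping_sum_single)+
  have leibniz_sum: "mp_deriv i (sum ?f A * sum ?g B)
    = mp_deriv i (sum ?f A) * sum ?g B + sum ?f A * mp_deriv i (sum ?g B)" for A B
    by (simp add: sum_product single sum.distrib)
  show ?thesis
    using leibniz_sum[of "Poly_Mapping.keys f" "Poly_Mapping.keys g"]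
    by (simp only: f[symmetric] g[symmetric])
qed

lemma mp_deriv_power [simp]:
  "mp_deriv i (f ^ n) = of_nat n * f ^ (n - 1) * mp_deriv i f"
proof (induction n)
  case (Suc n)
  have "f * (of_nat n * f ^ (n - 1) * mp_deriv i f) = of_nat n * f ^ n * mp_deriv i f"
    by (cases n) (simp_all add: mult_ac)
  then show ?case by (simp add: Suc distrib_left mult_ac)
qed simp

lemma mp_deriv_commute: "mp_deriv i (mp_deriv j f) = mp_deriv j (mp_deriv i f)"
  by (intro poly_mapping_eqI)
    (auto simp: lookup_mp_deriv lookup_add lookup_single when_def add_ac mult_ac)

text \<open>The chain rule. Hessians, the bordered Hessian, b2 and pf are all expressed by
  derivatives, so their behaviour under N is computed from here.\<close>

lemma mp_deriv_lin_subst: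
  "mp_deriv i (lin_subst N f) = (\<Sum>j\<in>UNIV. Const (N $ i $ j) * lin_subst N (mp_deriv j f))"
proof (induction f rule: mpoly_induct)
  case (Var j)
  have "mp_deriv i (\<Sum>k\<in>UNIV. Const (N $ k $ j) * Var k)
    = (\<Sum>k\<in>UNIV. if i = k then Const (N $ k $ j) else 0)"
    unfolding mp_deriv_sum by (rule sum.cong) auto
  also have "\<dots> = (\<Sum>k\<in>UNIV. if k = j then Const (N $ i $ k) else 0)"
    by simp
  also have "\<dots> = (\<Sum>k\<in>UNIV. Const (N $ i $ k) * lin_subst N (mp_deriv k (Var j)))"
    by (rule sum.cong) auto
  finally show ?case by simp
next
  case (add f g)
  then show ?case by (simp add: distrib_left sum.distrib)
next
  case (mult f g)
  then show ?case
    by (simp add: distrib_left sum.distrib sum_distrib_left sum_distrib_right mult_ac)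
qed simp

text \<open>With \<open>mp_coeff_mp_deriv\<close> this turns a coefficient, up to a product of
  factorials, into the value at 0 of an iterated derivative, to which the chain rule
  applies.\<close>

lemma mp_coeff_Nil: "mp_coeff (f :: ('i::finite, 'a::comm_ring_1) mpoly) [] = mp_eval f 0"
proof -
  have "ring_hom_fun (\<lambda>f :: ('i, 'a) mpoly. mp_coeff f [])"
  proof
    have 0: "a + b = 0 \<longleftrightarrow> a = 0 \<and> b = 0" for a b :: "'i \<Rightarrow>\<^sub>0 nat"
      by (auto simp: poly_mapping_eq_iff fun_eq_iff lookup_add)
    show "mp_coeff (1 :: ('i, 'a) mpoly) [] = 1" by (simp add: mp_coeff_def)
    fix f g :: "('i, 'a) mpoly"
    show "mp_coeff (f + g) [] = mp_coeff f [] + mp_coeff g []"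
      by (simp add: mp_coeff_def lookup_add)
    have "mp_coeff (f * g) [] = (\<Sum>m\<in>Poly_Mapping.keys f. \<Sum>n\<in>Poly_Mapping.keys g.
        Poly_Mapping.lookup f m * Poly_Mapping.lookup g n when m + n = 0)"
      by (subst poly_mapping_sum_single[of f], subst poly_mapping_sum_single[of g])
        (simp add: mp_coeff_def sum_product mult_single lookup_sum lookup_single)
    also have "\<dots> = (\<Sum>m\<in>Poly_Mapping.keys f. \<Sum>n\<in>Poly_Mapping.keys g.
        (Poly_Mapping.lookup f m when m = 0) * (Poly_Mapping.lookup g n when n = 0))"
      by (intro sum.cong) (auto simp: when_def 0)
    also have "\<dots> = mp_coeff f [] * mp_coeff g []"
      by (simp add: mp_coeff_def when_def in_keys_iff flip: sum_product)
    finally show "mp_coeff (f * g) [] = mp_coeff f [] * mp_coeff g []" .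
  qed
  moreover have "mp_coeff (Const a) [] = mp_eval (Const a) (0 :: 'a^'i)" for a
    unfolding mp_eval_Const by (simp add: mp_coeff_def Const_def)
  moreover have "mp_coeff (Var i) [] = mp_eval (Var i) (0 :: 'a^'i)" for i
  proof -
    have "Poly_Mapping.single i (1::nat) \<noteq> 0"
      by (metis lookup_single_eq lookup_zero one_neq_zero)
    then show ?thesis
      unfolding mp_eval_Var by (simp add: mp_coeff_def Var_def lookup_single del: One_nat_def)
  qed
  ultimately show ?thesis
    by (rule mpoly_hom_eqI[OF _ eval.ring_hom_fun_axioms])
qed

lemma mp_coeff_mp_deriv:
  "mp_coeff (mp_deriv i f) xs = of_nat (Suc (count_list xs i)) * mp_coeff f (i # xs)"
proof -
  have "Poly_Mapping.lookup (\<Sum>j\<leftarrow>xs. Poly_Mapping.single j (1::nat)) i = count_list xs i"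
    by (induction xs) (auto simp: lookup_add lookup_single when_def)
  then show ?thesis by (simp add: mp_coeff_def lookup_mp_deriv add.commute)
qed

section \<open>Discrete valuations\<close>

locale valuation_ring =
  fixes v :: "'a::field_char_0 \<Rightarrow> int"
  assumes v_mult: "x \<noteq> 0 \<Longrightarrow> y \<noteq> 0 \<Longrightarrow> v (x * y) = v x + v y"
    and v_add: "x \<noteq> 0 \<Longrightarrow> y \<noteq> 0 \<Longrightarrow> x + y \<noteq> 0 \<Longrightarrow> min (v x) (v y) \<le> v (x + y)"
begin

abbreviation R where "R \<equiv> val_ring v"

lemma v_1 [simp]: "v 1 = 0"
  using v_mult[of 1 1] by simp

lemma v_uminus [simp]: "v (- x) = v x"
proof (cases "x = 0")
  case False
  have "2 * v (- 1) = 0"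
    using v_mult[of "- 1" "- 1"] by simp
  with False show ?thesis
    using v_mult[of "- 1" x] by simp
qed simp

lemma R_0 [simp]: "0 \<in> R" and R_1 [simp]: "1 \<in> R"
  by (auto simp: val_ring_def)

lemma R_add [intro, simp]: "x \<in> R \<Longrightarrow> y \<in> R \<Longrightarrow> x + y \<in> R"
  using v_add[of x y] by (cases "x = 0 \<or> y = 0 \<or> x + y = 0") (auto simp: val_ring_def)

lemma R_mult [intro, simp]: "x \<in> R \<Longrightarrow> y \<in> R \<Longrightarrow> x * y \<in> R"
  using v_mult[of x y] by (cases "x = 0 \<or> y = 0") (auto simp: val_ring_def)

lemma R_uminus [intro, simp]: "x \<in> R \<Longrightarrow> - x \<in> R"
  by (auto simp: val_ring_def)

lemma R_diff [intro, simp]: "x \<in> R \<Longrightarrow> y \<in> R \<Longrightarrow> x - y \<in> R"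
  using R_add[of x "- y"] by simp

lemma R_power [intro, simp]: "x \<in> R \<Longrightarrow> x ^ n \<in> R"
  by (induction n) auto

lemma R_of_nat [simp]: "of_nat n \<in> R"
  by (induction n) auto

lemma R_numeral [simp]: "numeral n \<in> R"
  using R_of_nat[of "numeral n"] by simp

lemma R_sum [intro]: "(\<And>a. a \<in> A \<Longrightarrow> f a \<in> R) \<Longrightarrow> sum f A \<in> R"
  by (induction A rule: infinite_finite_induct) auto

lemma R_prod [intro]: "(\<And>a. a \<in> A \<Longrightarrow> f a \<in> R) \<Longrightarrow> prod f A \<in> R"
  by (induction A rule: infinite_finite_induct) auto

lemma R_of_int [simp]: "of_int n \<in> R"
  by (cases n rule: int_cases2) auto

lemma R_det: "(\<And>i j. A $ i $ j \<in> R) \<Longrightarrow> det A \<in> R"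
  unfolding det_def by (intro R_sum R_mult R_prod R_of_int) auto

lemma v_divide: "x \<noteq> 0 \<Longrightarrow> y \<noteq> 0 \<Longrightarrow> v (x / y) = v x - v y"
  using v_mult[of "x / y" y] by simp

lemma divide_in_R: "y \<noteq> 0 \<Longrightarrow> (x \<noteq> 0 \<Longrightarrow> v y \<le> v x) \<Longrightarrow> x / y \<in> R"
  by (cases "x = 0") (auto simp: val_ring_def v_divide)

lemma unit_v: "x \<in> unit_set R \<longleftrightarrow> x \<noteq> 0 \<and> v x = 0"
proof
  assume "x \<in> unit_set R"
  then obtain y where "x \<in> R" "y \<in> R" "x * y = 1" by (auto simp: unit_set_def)
  moreover from this have "x \<noteq> 0" "y \<noteq> 0" by auto
  ultimately show "x \<noteq> 0 \<and> v x = 0" using v_mult[of x y] by (auto simp: val_ring_def)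
next
  assume x: "x \<noteq> 0 \<and> v x = 0"
  then have "inverse x \<in> R" using v_mult[of x "inverse x"] by (auto simp: val_ring_def)
  with x show "x \<in> unit_set R"
    by (auto simp: unit_set_def val_ring_def intro!: bexI[of _ "inverse x"])
qed

lemma GL_det_unit:
  assumes "N \<in> GL R"
  shows "det N \<in> unit_set R"
proof -
  from assms obtain N' where "\<And>i j. N $ i $ j \<in> R" "\<And>i j. N' $ i $ j \<in> R" "N ** N' = mat 1"
    by (auto simp: GL_def)
  then show ?thesis
    using det_mul[of N N'] R_det[of N] R_det[of N'] by (auto simp: unit_set_def)
qed

end


section \<open>Matrices over a valuation ring\<close>

definition transvection :: "'n \<Rightarrow> 'n \<Rightarrow> 'a \<Rightarrow> 'a::comm_ring_1^'n^'n" where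
  "transvection i j t = (\<chi> k l. (if k = l then 1 else 0) + (if k = i \<and> l = j then t else 0))"

lemma transvection_times:
  "(transvection i j t ** A) $ k $ l = A $ k $ l + (if k = i then t * A $ j $ l else 0)"
proof -
  have "(transvection i j t ** A) $ k $ l
    = (\<Sum>m\<in>UNIV. (if m = k then A $ m $ l else 0) + (if m = j then if k = i then t * A $ m $ l else 0 else 0))"
    unfolding matrix_matrix_mult_def transvection_def by (simp, rule sum.cong) (auto simp: algebra_simps)
  then show ?thesis by (simp add: sum.distrib)
qed

lemma times_transvection:
  "(A ** transvection i j t) $ k $ l = A $ k $ l + (if l = j then A $ k $ i * t else 0)"
proof -
  have "(A ** transvection i j t) $ k $ l
    = (\<Sum>m\<in>UNIV. (if m = l then A $ k $ m else 0) + (if m = i then if l = j then A $ k $ m * t else 0 else 0))"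
    unfolding matrix_matrix_mult_def transvection_def by (simp, rule sum.cong) (auto simp: algebra_simps)
  then show ?thesis by (simp add: sum.distrib)
qed

lemma det_transvection:
  assumes "i \<noteq> j"
  shows "det (transvection i j t) = 1"
proof -
  have "transvection i j t = (\<chi> k. if k = i then row i (mat 1) + t *s row j (mat 1) else row k (mat 1))"
    by (auto simp: transvection_def vec_eq_iff row_def mat_def)
  then show ?thesis using det_row_operation[OF assms, of "mat 1" t] by simp
qed

lemma transvection_inverse:
  assumes "i \<noteq> j"
  shows "transvection i j (- t) ** (transvection i j t ** A) = A"
    "(A ** transvection i j t) ** transvection i j (- t) = A"
  using assms by (auto simp: vec_eq_iff transvection_times times_transvection)

text \<open>Smith normal form by elementary operations: an entry of minimal valuation can be moved to the
  diagonal by adding a multiple of its column to another one, so no permutations are needed.\<close>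

lemma (in valuation_ring) matrix_induct:
  fixes A :: "'a^'n^'n"
  assumes A: "\<And>i j. A $ i $ j \<in> R"
    and diag: "\<And>D. diagonal_matrix D \<Longrightarrow> (\<And>i j. D $ i $ j \<in> R) \<Longrightarrow> P D"
    and transvection: "\<And>i j t. i \<noteq> j \<Longrightarrow> t \<in> R \<Longrightarrow> P (transvection i j t)"
    and mult: "\<And>A B. (\<And>i j. A $ i $ j \<in> R) \<Longrightarrow> (\<And>i j. B $ i $ j \<in> R) \<Longrightarrow> P A \<Longrightarrow> P B \<Longrightarrow> P (A ** B)"
  shows "P A"
proof -
  have transvection_R: "transvection i j t $ k $ l \<in> R" if "t \<in> R" for i j k l :: 'n and t
    using that by (auto simp: transvection_def)
  \<comment> \<open>A row operation is undone by the opposite transvection, so P for the reduced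
    matrix gives P for A; \<open>right\<close> is the same for columns.\<close>
  have left: "P A" if "P (transvection i j t ** A)" "i \<noteq> j" "t \<in> R" "\<And>k l. A $ k $ l \<in> R" for i j t A
  proof -
    have "P (transvection i j (- t) ** (transvection i j t ** A))"
      by (rule mult[OF _ _ transvection])
        (use that in \<open>auto simp: transvection_times transvection_R\<close>)
    then show ?thesis by (simp only: transvection_inverse[OF that(2)])
  qed
  have right: "P A" if "P (A ** transvection i j t)" "i \<noteq> j" "t \<in> R" "\<And>k l. A $ k $ l \<in> R" for i j t A
  proof -
    have "P ((A ** transvection i j t) ** transvection i j (- t))"
      by (rule mult[OF _ _ _ transvection])
        (use that in \<open>auto simp: times_transvection transvection_R\<close>)
    then show ?thesis by (simp only: transvection_inverse[OF that(2)])
  qed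
  \<comment> \<open>T holds the indices not yet split off: off-diagonal entries with an index
    outside T already vanish.\<close>
  have "P A" if "\<And>i j. A $ i $ j \<in> R" "\<And>i j. i \<notin> T \<or> j \<notin> T \<Longrightarrow> i \<noteq> j \<Longrightarrow> A $ i $ j = 0"
    for T :: "'n set" and A
    using finite[of T] that
  proof (induction T arbitrary: A rule: finite_psubset_induct)
    case (psubset T A)
    show ?case
    proof (cases "\<exists>i\<in>T. \<exists>j\<in>T. A $ i $ j \<noteq> 0")
      case False
      with psubset.prems(2) have "diagonal_matrix A"
        unfolding diagonal_matrix_def by blast
      with psubset.prems(1) show ?thesis by (intro diag)
    next
      case True
      \<comment> \<open>Over a valuation ring a nonzero entry of minimal valuation divides every
        entry of the block with indices in T.\<close>
      define S where "S = {(i, j). i \<in> T \<and> j \<in> T \<and> A $ i $ j \<noteq> 0}"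
      have "finite S" "S \<noteq> {}" using True by (auto simp: S_def)
      then obtain i j where ij: "(i, j) \<in> S" and min: "\<And>k l. (k, l) \<in> S \<Longrightarrow> v (A $ i $ j) \<le> v (A $ k $ l)"
        using arg_min_if_finite[of S "\<lambda>(i, j). v (A $ i $ j)"]
        by (metis (mono_tags, lifting) case_prod_conv linorder_not_less old.prod.exhaust)
      have "i \<in> T" "j \<in> T" "A $ i $ j \<noteq> 0" using ij by (auto simp: S_def)
      \<comment> \<open>The pivot is now at (i, i) and divides the block, so row i and then column i
        can be cleared, leaving T - {i} for the induction hypothesis.\<close>
      have pivot: "P B" if B: "\<And>i j. B $ i $ j \<in> R" "\<And>i j. i \<notin> T \<or> j \<notin> T \<Longrightarrow> i \<noteq> j \<Longrightarrow> B $ i $ j = 0"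
        and nz: "B $ i $ i \<noteq> 0"
        and dvd: "\<And>k l. k \<in> T \<Longrightarrow> l \<in> T \<Longrightarrow> B $ k $ l / B $ i $ i \<in> R" for B
      proof -
        \<comment> \<open>X lists the rows whose entry in column i remains to be cleared. Row i is
          already zero off the diagonal, so clearing them changes only column i.\<close>
        have col: "P B" if "finite X" "X \<subseteq> T - {i}" "\<And>i j. B $ i $ j \<in> R"
          "\<And>i j. i \<notin> T \<or> j \<notin> T \<Longrightarrow> i \<noteq> j \<Longrightarrow> B $ i $ j = 0" "B $ i $ i \<noteq> 0"
          "\<And>k l. k \<in> T \<Longrightarrow> l \<in> T \<Longrightarrow> B $ k $ l / B $ i $ i \<in> R"
          "\<And>k. k \<noteq> i \<Longrightarrow> k \<notin> X \<Longrightarrow> B $ k $ i = 0" "\<And>k. k \<noteq> i \<Longrightarrow> B $ i $ k = 0" for X B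
          using that
        proof (induction X arbitrary: B rule: finite_induct)
          case empty
          show ?case
          proof (rule psubset.IH[of "T - {i}"])
            show "T - {i} \<subset> T" using \<open>i \<in> T\<close> by auto
            show "B $ k $ l = 0" if "k \<notin> T - {i} \<or> l \<notin> T - {i}" "k \<noteq> l" for k l
              using that empty by auto
          qed (use empty in auto)
        next
          case (insert k X)
          define t where "t = - B $ k $ i / B $ i $ i"
          have "t \<in> R" using insert.prems(5)[of k i] insert.prems(1) \<open>i \<in> T\<close> R_uminus
            by (fastforce simp: t_def)
          have "k \<noteq> i" "k \<in> T" using insert.prems(1) by auto
          show ?case
          proof (rule left[of k i t], rule insert.IH)
            show "X \<subseteq> T - {i}" using insert.prems(1) by auto
            show "(transvection k i t ** B) $ l $ m \<in> R" for l m
              using insert.prems(2) \<open>t \<in> R\<close> by (auto simp: transvection_times)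
            show "(transvection k i t ** B) $ l $ m = 0" if "l \<notin> T \<or> m \<notin> T" "l \<noteq> m" for l m
              using that insert.prems(3)[of l m] insert.prems(7)[of m] \<open>k \<in> T\<close> \<open>i \<in> T\<close>
              by (cases "m = i") (auto simp: transvection_times)
            show "(transvection k i t ** B) $ i $ i \<noteq> 0"
              using insert.prems(4) \<open>k \<noteq> i\<close> by (auto simp: transvection_times)
            show "(transvection k i t ** B) $ l $ m / (transvection k i t ** B) $ i $ i \<in> R"
              if "l \<in> T" "m \<in> T" for l m
              using insert.prems(5)[OF that] insert.prems(5)[OF \<open>i \<in> T\<close> that(2)] \<open>k \<noteq> i\<close> \<open>t \<in> R\<close>
              by (auto simp: transvection_times add_divide_distrib simp flip: times_divide_eq_right)
            show "(transvection k i t ** B) $ l $ i = 0" if "l \<noteq> i" "l \<notin> X" for l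
              using that insert.prems(4,6) by (auto simp: transvection_times t_def)
            show "(transvection k i t ** B) $ i $ l = 0" if "l \<noteq> i" for l
              using that insert.prems(7) \<open>k \<noteq> i\<close> by (auto simp: transvection_times)
          qed (use \<open>k \<noteq> i\<close> \<open>t \<in> R\<close> insert.prems in auto)
        qed
        have row: "P B" if "finite X" "X \<subseteq> T - {i}" "\<And>i j. B $ i $ j \<in> R"
          "\<And>i j. i \<notin> T \<or> j \<notin> T \<Longrightarrow> i \<noteq> j \<Longrightarrow> B $ i $ j = 0" "B $ i $ i \<noteq> 0"
          "\<And>k l. k \<in> T \<Longrightarrow> l \<in> T \<Longrightarrow> B $ k $ l / B $ i $ i \<in> R"
          "\<And>k. k \<noteq> i \<Longrightarrow> k \<notin> X \<Longrightarrow> B $ i $ k = 0" for X B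
          using that
        proof (induction X arbitrary: B rule: finite_induct)
          case empty
          show ?case
            by (rule col[of "T - {i}"]) (use empty in auto)
        next
          case (insert k X)
          define t where "t = - B $ i $ k / B $ i $ i"
          have "t \<in> R" using insert.prems(5)[of i k] insert.prems(1) \<open>i \<in> T\<close> R_uminus
            by (fastforce simp: t_def)
          have "k \<noteq> i" "k \<in> T" using insert.prems(1) by auto
          show ?case
          proof (rule right[of _ i k t], rule insert.IH)
            show "X \<subseteq> T - {i}" using insert.prems(1) by auto
            show "(B ** transvection i k t) $ l $ m \<in> R" for l m
              using insert.prems(2) \<open>t \<in> R\<close> by (auto simp: times_transvection)
            show "(B ** transvection i k t) $ l $ m = 0" if "l \<notin> T \<or> m \<notin> T" "l \<noteq> m" for l m
              using that insert.prems(3)[of l m] insert.prems(3)[of l i] \<open>k \<in> T\<close> \<open>i \<in> T\<close>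
              by (cases "l = i") (auto simp: times_transvection)
            show "(B ** transvection i k t) $ i $ i \<noteq> 0"
              using insert.prems(4) \<open>k \<noteq> i\<close> by (auto simp: times_transvection)
            show "(B ** transvection i k t) $ l $ m / (B ** transvection i k t) $ i $ i \<in> R"
              if "l \<in> T" "m \<in> T" for l m
              using insert.prems(5)[OF that] insert.prems(5)[OF that(1) \<open>i \<in> T\<close>] \<open>k \<noteq> i\<close> \<open>t \<in> R\<close>
              by (auto simp: times_transvection add_divide_distrib simp flip: times_divide_eq_left)
            show "(B ** transvection i k t) $ i $ l = 0" if "l \<noteq> i" "l \<notin> X" for l
              using that insert.prems(4,6) by (auto simp: times_transvection t_def)
          qed (use \<open>k \<noteq> i\<close> \<open>t \<in> R\<close> insert.prems in auto)
        qed
        show ?thesis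
          by (rule row[of "T - {i}"]) (use B nz dvd in auto)
      qed
      have dvd: "A $ k $ l / A $ i $ j \<in> R" if "k \<in> T" "l \<in> T" for k l
        using that min[of k l] \<open>A $ i $ j \<noteq> 0\<close> by (intro divide_in_R) (auto simp: S_def)
      show ?thesis
      proof (cases "i = j")
        case True
        then show ?thesis
          using pivot[of A] psubset.prems dvd \<open>A $ i $ j \<noteq> 0\<close> by auto
      next
        case False
        \<comment> \<open>Adding t times column j to column i turns the entry (i, i) into A_ii +
          A_ij t = A_ij, the pivot itself; t is integral because A_ij divides A_ii.\<close>
        define t where "t = 1 - A $ i $ i / A $ i $ j"
        have "t \<in> R" using dvd \<open>i \<in> T\<close> by (auto simp: t_def)
        let ?B = "A ** transvection j i t"
        have ii: "?B $ i $ i = A $ i $ j"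
          using \<open>A $ i $ j \<noteq> 0\<close> by (simp add: times_transvection t_def field_simps)
        show ?thesis
        proof (rule right[of _ j i t], rule pivot)
          show "?B $ k $ l \<in> R" for k l
            using psubset.prems(1) \<open>t \<in> R\<close> by (auto simp: times_transvection)
          show "?B $ k $ l = 0" if "k \<notin> T \<or> l \<notin> T" "k \<noteq> l" for k l
            using that psubset.prems(2)[of k l] psubset.prems(2)[of k j] \<open>i \<in> T\<close> \<open>j \<in> T\<close>
            by (cases "k = j") (auto simp: times_transvection)
          show "?B $ k $ l / ?B $ i $ i \<in> R" if "k \<in> T" "l \<in> T" for k l
            unfolding ii using dvd[OF that] dvd[OF that(1) \<open>j \<in> T\<close>] \<open>t \<in> R\<close>
            by (auto simp: times_transvection add_divide_distrib simp flip: times_divide_eq_left)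
        qed (use ii False \<open>A $ i $ j \<noteq> 0\<close> \<open>t \<in> R\<close> psubset.prems in auto)
      qed
    qed
  qed
  from this[of A UNIV] A show ?thesis by auto
qed

section \<open>The ultrametric comparison of the two maxima\<close>

section \<open>Absolute values\<close>

context valuation_ring
begin

lemma val_abs_mult: "c > 0 \<Longrightarrow> val_abs c v (x * y) = val_abs c v x * val_abs c v y"
  using power_int_add[of c "- v x" "- v y"] by (auto simp: val_abs_def v_mult)

lemma val_abs_power: "c > 0 \<Longrightarrow> val_abs c v (x ^ n) = val_abs c v x ^ n"
  by (induction n) (auto simp: val_abs_mult, simp add: val_abs_def)

lemma val_abs_uminus: "val_abs c v (- x) = val_abs c v x"
  by (simp add: val_abs_def)

lemma val_abs_nonneg: "c > 0 \<Longrightarrow> 0 \<le> val_abs c v x"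
  by (simp add: val_abs_def)

lemma val_abs_add: "c > 1 \<Longrightarrow> val_abs c v (x + y) \<le> max (val_abs c v x) (val_abs c v y)"
proof (cases "x = 0 \<or> y = 0 \<or> x + y = 0")
  case False
  assume "c > 1"
  then have "c powi (- v (x + y)) \<le> c powi (max (- v x) (- v y))"
    using v_add[of x y] False by (intro power_int_increasing) auto
  with False show ?thesis by (auto simp: val_abs_def max_def split: if_splits)
qed (auto simp: val_abs_def le_max_iff_disj)

lemma val_abs_unit: "x \<in> unit_set R \<Longrightarrow> val_abs c v x = 1"
  by (auto simp: unit_v val_abs_def)

lemma val_abs_R: "c > 1 \<Longrightarrow> x \<in> R \<Longrightarrow> val_abs c v x \<le> 1"
  by (auto simp: val_ring_def val_abs_def power_int_minus inverse_le_1_iff)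

text \<open>The common end of all three degrees. Since \<delta> is a unit and |\<rho>| is at most 1,
  the right-hand side X of the relation for G' satisfies |X| <= max(|F|, |G|) and, solving for G,
  |G| <= max(|F|, |X|). So replacing G by X does not change the maximum with |F|.\<close>

lemma max_val_abs_eq:
  assumes c: "c > 1" and \<nu>: "\<nu> \<noteq> 0" and \<delta>: "\<delta> \<in> unit_set R" and \<rho>: "\<rho> \<in> R"
    and F: "F' * \<nu>\<^sup>2 = \<delta> ^ k * F" and G: "G' * \<nu>\<^sup>2 = \<delta> ^ l * G - \<rho> * \<delta> ^ k * F"
  shows "max (val_abs c v F') (val_abs c v G')
    = val_abs c v \<nu> powi (- 2) * max (val_abs c v F) (val_abs c v G)"
proof -
  let ?a = "val_abs c v"
  have c0: "c > 0" using c by simp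
  note abs = val_abs_mult[OF c0] val_abs_power[OF c0] val_abs_uminus val_abs_unit[OF \<delta>]
  have aF: "?a F' * ?a \<nu> ^ 2 = ?a F"
    using arg_cong[OF F, of ?a] by (simp add: abs)
  let ?X = "\<delta> ^ l * G - \<rho> * \<delta> ^ k * F"
  have aG: "?a G' * ?a \<nu> ^ 2 = ?a ?X"
    using arg_cong[OF G, of ?a] by (simp add: abs)
  have le: "?a (\<rho> * \<delta> ^ k * F) \<le> ?a F"
    using mult_right_mono[OF val_abs_R[OF c \<rho>] val_abs_nonneg[OF c0, of F]] by (simp add: abs)
  have "?a ?X \<le> max (?a F) (?a G)"
    using val_abs_add[OF c, of "\<delta> ^ l * G" "- (\<rho> * \<delta> ^ k * F)"] le by (simp add: abs)
  moreover have "?a G \<le> max (?a F) (?a ?X)"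
    using val_abs_add[OF c, of ?X "\<rho> * \<delta> ^ k * F"] le by (simp add: abs)
  ultimately have "max (?a F) (?a ?X) = max (?a F) (?a G)" by auto
  moreover have "?a \<nu> > 0" using \<nu> c0 by (simp add: val_abs_def)
  ultimately have "max (?a F') (?a G') * ?a \<nu> ^ 2 = max (?a F) (?a G)"
    by (simp add: aF aG max_mult_distrib_right)
  with \<open>?a \<nu> > 0\<close> show ?thesis by (simp add: power_int_minus field_simps)
qed

end

section \<open>Coefficients and Hessians under linear substitutions\<close>

lemma mp_coeff_add [simp]: "mp_coeff (f + g) is = mp_coeff f is + mp_coeff g is"
  by (simp add: mp_coeff_def lookup_add)

lemma mp_coeff_diff [simp]: "mp_coeff (f - g) is = mp_coeff f is - mp_coeff (g :: ('i, 'a::comm_ring_1) mpoly) is"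
  by (simp add: mp_coeff_def lookup_minus)

lemma lookup_Const_mult: "Poly_Mapping.lookup (Const a * f) m = a * Poly_Mapping.lookup f m"
proof -
  have "Const a * f
    = (\<Sum>m\<in>Poly_Mapping.keys f. Poly_Mapping.single m (a * Poly_Mapping.lookup f m))"
    by (subst poly_mapping_sum_single[of f]) (simp add: Const_def mult_single sum_distrib_left)
  then show ?thesis by (auto simp: lookup_sum lookup_single when_def in_keys_iff)
qed

lemma mp_coeff_Const_mult [simp]: "mp_coeff (Const a * f) is = a * mp_coeff f is"
  by (simp add: mp_coeff_def lookup_Const_mult)

lemma eval_hessian: "mp_eval (mp_deriv i (mp_deriv j f)) 0 = (if i = j then 2 else 1) * mp_coeff f [i, j]"
  by (subst mp_deriv_commute) (simp add: mp_coeff_mp_deriv flip: mp_coeff_Nil)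

lemma hessian_lin_subst:
  "hessian (lin_subst N f) = (\<chi> i j. Const (N $ i $ j)) ** (\<chi> i j. lin_subst N (hessian f $ i $ j))
    ** transpose (\<chi> i j. Const (N $ i $ j))"
proof -
  have "mp_deriv i (mp_deriv j (lin_subst N f)) = (\<Sum>l\<in>UNIV. (\<Sum>k\<in>UNIV. Const (N $ i $ k) *
      lin_subst N (mp_deriv k (mp_deriv l f))) * Const (N $ j $ l))" for i j
    by (simp add: mp_deriv_lin_subst mult.commute)
  then show ?thesis
    by (simp add: hessian_def matrix_matrix_mult_def transpose_def vec_eq_iff)
qed

text \<open>The Hessian matrix is conjugated by N, whence the square of det N. This is the weight of
  the covariant C for n = 2 and 4 and of H for n = 3.\<close>

lemma det_hessian_lin_subst:
  "det (hessian (lin_subst N f)) = Const (det N ^ 2) * lin_subst N (det (hessian f))"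
  unfolding hessian_lin_subst det_mul det_transpose Const.hom_det[symmetric]
    lin_subst.hom_det[symmetric]
  by (simp add: power2_eq_square mult_ac)

lemma hessian_Const_mult: "hessian (Const a * f) = (\<chi> i j. Const a * hessian f $ i $ j)"
  by (simp add: hessian_def vec_eq_iff)

lemma matrix_vector_mult_component: "(A *v x) $ i = (\<Sum>j\<in>UNIV. A $ i $ j * x $ j)"
  by (simp add: matrix_vector_mult_def)

lemma transpose_apply: "transpose A $ i $ j = A $ j $ i"
  by (simp add: transpose_def)

lemma matrix_mult_component: "(A ** B) $ i $ j = (\<Sum>k\<in>UNIV. A $ i $ k * B $ k $ j)"
  by (simp add: matrix_matrix_mult_def)

lemma det_4:
  "det (A::'a::comm_ring_1^4^4) =
      A$1$1 * (A$2$2 * (A$3$3 * A$4$4 - A$3$4 * A$4$3) - A$2$3 * (A$3$2 * A$4$4 - A$3$4 * A$4$2)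
        + A$2$4 * (A$3$2 * A$4$3 - A$3$3 * A$4$2))
    - A$1$2 * (A$2$1 * (A$3$3 * A$4$4 - A$3$4 * A$4$3) - A$2$3 * (A$3$1 * A$4$4 - A$3$4 * A$4$1)
        + A$2$4 * (A$3$1 * A$4$3 - A$3$3 * A$4$1))
    + A$1$3 * (A$2$1 * (A$3$2 * A$4$4 - A$3$4 * A$4$2) - A$2$2 * (A$3$1 * A$4$4 - A$3$4 * A$4$1)
        + A$2$4 * (A$3$1 * A$4$2 - A$3$2 * A$4$1))
    - A$1$4 * (A$2$1 * (A$3$2 * A$4$3 - A$3$3 * A$4$2) - A$2$2 * (A$3$1 * A$4$3 - A$3$3 * A$4$1)
        + A$2$3 * (A$3$1 * A$4$2 - A$3$2 * A$4$1))"
proof -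
  have f: "finite {2::4, 3, 4}" "1 \<notin> {2::4, 3, 4}" "finite {3::4, 4}" "2 \<notin> {3::4, 4}"
    "finite {4::4}" "3 \<notin> {4::4}"
    by auto
  show ?thesis
    unfolding det_def UNIV_4 sum_over_permutations_insert[OF f(1,2)]
      sum_over_permutations_insert[OF f(3,4)] sum_over_permutations_insert[OF f(5,6)] permutes_sing
    by (simp add: sign_swap_id permutation_swap_id sign_compose permutation_compose sign_id swap_id_eq
        transpose_def algebra_simps)
qed

section \<open>Forms over a subring\<close>

text \<open>Two instances matter: over the valuation ring \<open>form_over\<close> records integral
  coefficients, over UNIV only homogeneity. The latter serves diagonal g, whose entries may lie
  outside the ring.\<close>

definition subring_set :: "'a::comm_ring_1 set \<Rightarrow> bool" where
  "subring_set S \<longleftrightarrow> 0 \<in> S \<and> 1 \<in> S \<and> (\<forall>x\<in>S. - x \<in> S) \<and> (\<forall>x\<in>S. \<forall>y\<in>S. x + y \<in> S \<and> x * y \<in> S)"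

lemma (in valuation_ring) subring_set_R: "subring_set R"
  by (auto simp: subring_set_def)

lemma subring_set_UNIV: "subring_set UNIV"
  by (auto simp: subring_set_def)

lemma form_overI:
  assumes "\<And>m. Poly_Mapping.lookup f m \<noteq> 0
    \<Longrightarrow> (\<Sum>i\<in>UNIV. Poly_Mapping.lookup m i) = d \<and> Poly_Mapping.lookup f m \<in> S"
  shows "form_over d S f"
  using assms by (auto simp: form_over_def in_keys_iff)

context
  fixes S :: "'a::comm_ring_1 set"
  assumes S: "subring_set S"
begin

lemma S_closed [simp, intro]: "0 \<in> S" "1 \<in> S" "x \<in> S \<Longrightarrow> - x \<in> S"
  "x \<in> S \<Longrightarrow> y \<in> S \<Longrightarrow> x + y \<in> S" "x \<in> S \<Longrightarrow> y \<in> S \<Longrightarrow> x * y \<in> S"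
  using S by (auto simp: subring_set_def)

lemma form_over_lookup: "form_over d S f \<Longrightarrow> Poly_Mapping.lookup f m \<in> S"
  by (cases "Poly_Mapping.lookup f m = 0") (auto simp: form_over_def in_keys_iff)

lemma form_over_coeff: "form_over d S f \<Longrightarrow> mp_coeff f is \<in> S"
  by (simp add: mp_coeff_def form_over_lookup)

lemma form_over_zero: "form_over d S 0"
  by (simp add: form_over_def)

lemma form_over_add: "form_over d S f \<Longrightarrow> form_over d S g \<Longrightarrow> form_over d S (f + g)"
proof (rule form_overI)
  fix m
  assume fg: "form_over d S f" "form_over d S g" "Poly_Mapping.lookup (f + g) m \<noteq> 0"
  then have "m \<in> Poly_Mapping.keys f \<or> m \<in> Poly_Mapping.keys g"
    by (auto simp: lookup_add in_keys_iff)
  then show "(\<Sum>i\<in>UNIV. Poly_Mapping.lookup m i) = d \<and> Poly_Mapping.lookup (f + g) m \<in> S"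
    using fg(1,2) form_over_lookup[OF fg(1), of m] form_over_lookup[OF fg(2), of m]
    by (auto simp: form_over_def lookup_add)
qed

lemma form_over_uminus: "form_over d S f \<Longrightarrow> form_over d S (- f)"
  by (auto simp: form_over_def)

lemma form_over_diff: "form_over d S f \<Longrightarrow> form_over d S g \<Longrightarrow> form_over d S (f - g)"
  using form_over_add[of d f "- g"] form_over_uminus by auto

lemma form_over_sum: "(\<And>a. a \<in> A \<Longrightarrow> form_over d S (f a)) \<Longrightarrow> form_over d S (sum f A)"
  by (induction A rule: infinite_finite_induct) (auto intro: form_over_add form_over_zero)

lemma form_over_Const: "a \<in> S \<Longrightarrow> form_over 0 S (Const a)"
  by (auto simp: form_over_def Const_def split: if_splits)

lemma form_over_Var: "form_over 1 S (Var i)"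
  by (auto simp: form_over_def Var_def lookup_single when_def)

lemma form_over_mult:
  assumes f: "form_over d S f" and g: "form_over e S g"
  shows "form_over (d + e) S (f * g)"
proof -
  have "f * g = (\<Sum>m\<in>Poly_Mapping.keys f. \<Sum>n\<in>Poly_Mapping.keys g.
      Poly_Mapping.single (m + n) (Poly_Mapping.lookup f m * Poly_Mapping.lookup g n))"
    by (subst poly_mapping_sum_single[of f], subst poly_mapping_sum_single[of g])
      (simp add: sum_product mult_single)
  moreover have "form_over (d + e) S
      (Poly_Mapping.single (m + n) (Poly_Mapping.lookup f m * Poly_Mapping.lookup g n))"
    if "m \<in> Poly_Mapping.keys f" "n \<in> Poly_Mapping.keys g" for m n
    using that f g by (auto simp: form_over_def lookup_add sum.distrib)
  ultimately show ?thesis by (auto intro!: form_over_sum)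
qed

lemma form_over_Const_mult: "a \<in> S \<Longrightarrow> form_over d S f \<Longrightarrow> form_over d S (Const a * f)"
  using form_over_mult[OF form_over_Const, of a d f] by simp

lemma form_over_power: "form_over d S f \<Longrightarrow> form_over (n * d) S (f ^ n)"
proof (induction n)
  case 0
  show ?case using form_over_Const[of 1] by simp
qed (auto intro: form_over_mult)

lemma form_over_prod:
  "(\<And>a. a \<in> A \<Longrightarrow> form_over (d a) S (f a)) \<Longrightarrow> form_over (sum d A) S (prod f A)"
proof (induction A rule: infinite_finite_induct)
  case (infinite A)
  then show ?case using form_over_Const[of 1] by simp
next
  case empty
  then show ?case using form_over_Const[of 1] by simp
qed (auto intro: form_over_mult)

lemma form_over_lin_subst:
  assumes N: "\<And>i j. N $ i $ j \<in> S" and f: "form_over d S f"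
  shows "form_over d S (lin_subst N f)"
  unfolding lin_subst_def mp_insert_def
proof (rule form_over_sum)
  fix m assume m: "m \<in> Poly_Mapping.keys f"
  have "form_over (\<Sum>j\<in>UNIV. Poly_Mapping.lookup m j * 1) S
      (\<Prod>j\<in>UNIV. (\<Sum>i\<in>UNIV. Const (N $ i $ j) * Var i) ^ Poly_Mapping.lookup m j)"
    by (intro form_over_prod form_over_power form_over_sum form_over_Const_mult N form_over_Var)
  then show "form_over d S (Const (Poly_Mapping.lookup f m) *
      (\<Prod>j\<in>UNIV. (\<Sum>i\<in>UNIV. Const (N $ i $ j) * Var i) ^ Poly_Mapping.lookup m j))"
    using m f by (intro form_over_Const_mult) (auto simp: form_over_def)
qed

lemma shift_forms:
  fixes p q :: "(2, 'a) mpoly"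
  assumes "form_over 2 S p" "form_over 4 S q" "\<mu> \<in> S" "r0 \<in> S" "r1 \<in> S" "r2 \<in> S"
    and r: "r = Const r0 * Var 1 ^ 2 + Const r1 * Var 1 * Var 2 + Const r2 * Var 2 ^ 2"
  shows "form_over 2 S (Const \<mu> * (p + 2 * r))" "form_over 4 S (Const (\<mu>^2) * (q - p * r - r^2))"
proof -
  have "form_over (1 + 1) S (Const r1 * (Var 1 * Var (2::2)))"
    "form_over (2 * 1) S (Const r0 * Var (1::2) ^ 2)" "form_over (2 * 1) S (Const r2 * Var (2::2) ^ 2)"
    by (intro form_over_Const_mult form_over_mult form_over_power form_over_Var assms)+
  then have fr: "form_over 2 S r"
    unfolding r by (intro form_over_add) (auto simp: mult.assoc numeral_2_eq_2)
  have 2: "2 * r = r + r" by simp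
  show "form_over 2 S (Const \<mu> * (p + 2 * r))"
    unfolding 2 by (intro form_over_Const_mult form_over_add assms fr)
  have "form_over 4 S (p * r)" "form_over 4 S (r ^ 2)"
    using form_over_mult[OF assms(1) fr] form_over_power[OF fr, of 2] by simp_all
  then show "form_over 4 S (Const (\<mu>^2) * (q - p * r - r^2))"
    by (intro form_over_Const_mult form_over_diff assms) (auto simp: power2_eq_square assms)
qed

end

section \<open>Pairs (p, q): the Hessian of p^2 + 4q and b2 modulo 12\<close>

section \<open>Degree 2\<close>

lemma Var_power: "Var i ^ n = Poly_Mapping.single (Poly_Mapping.single i n) 1"
  by (induction n) (auto simp: Var_def mult_single simp flip: single_add)

text \<open>Writing a form out in its coefficients turns identities between covariants into
  polynomial identities in finitely many unknowns, which \<open>algebra\<close> decides.\<close>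

lemma binary_form_eq:
  fixes f :: "(2, 'a::comm_ring_1) mpoly"
  assumes "form_over d S f"
  shows "f = (\<Sum>k\<le>d. Const (mp_coeff f (replicate (d - k) 1 @ replicate k 2)) * Var 1 ^ (d - k) * Var 2 ^ k)"
proof (rule poly_mapping_eqI)
  fix m :: "2 \<Rightarrow>\<^sub>0 nat"
  let ?m = "\<lambda>k. Poly_Mapping.single 1 (d - k) + Poly_Mapping.single 2 k :: 2 \<Rightarrow>\<^sub>0 nat"
  have sum_replicate: "sum_list (replicate n (Poly_Mapping.single j (1::nat))) = Poly_Mapping.single j n"
    for n and j :: 2
    by (induction n) (simp_all flip: single_add)
  have eq: "Const (mp_coeff f (replicate (d - k) 1 @ replicate k 2)) * Var 1 ^ (d - k) * Var 2 ^ k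
    = Poly_Mapping.single (?m k) (Poly_Mapping.lookup f (?m k))" for k
    by (simp add: Var_power Const_def mult_single mp_coeff_def sum_replicate del: One_nat_def)
  have m_iff: "?m k = m \<longleftrightarrow> k = Poly_Mapping.lookup m 2 \<and> d - k = Poly_Mapping.lookup m 1" for k
    by (auto simp: poly_mapping_eq_iff fun_eq_iff forall_2 lookup_add lookup_single)
  have "(\<Sum>k\<le>d. Poly_Mapping.lookup (Poly_Mapping.single (?m k) (Poly_Mapping.lookup f (?m k))) m)
    = (\<Sum>k\<le>d. if k = Poly_Mapping.lookup m 2 \<and> d - k = Poly_Mapping.lookup m 1
        then Poly_Mapping.lookup f m else 0)"
    unfolding m_iff[symmetric] by (rule sum.cong) (auto simp: lookup_single when_def)
  also have "\<dots> = Poly_Mapping.lookup f m"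
  proof (cases "Poly_Mapping.lookup f m = 0")
    case True
    show ?thesis by (simp only: True if_cancel sum.neutral_const)
  next
    case False
    then have "Poly_Mapping.lookup m 1 + Poly_Mapping.lookup m 2 = d"
      using assms by (auto simp: form_over_def in_keys_iff sum_2)
    then have "k = Poly_Mapping.lookup m 2 \<and> d - k = Poly_Mapping.lookup m 1
      \<longleftrightarrow> k = Poly_Mapping.lookup m 2" for k
      by auto
    with \<open>_ = d\<close> show ?thesis by (auto simp: sum.delta)
  qed
  finally show "Poly_Mapping.lookup f m = Poly_Mapping.lookup (\<Sum>k\<le>d. Const (mp_coeff f
      (replicate (d - k) 1 @ replicate k 2)) * Var 1 ^ (d - k) * Var 2 ^ k) m"
    by (simp add: eq lookup_sum)
qed

lemma binary_quadratic_eq: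
  fixes f :: "(2, 'a::comm_ring_1) mpoly"
  assumes "form_over 2 S f"
  shows "f = Const (mp_coeff f [1,1]) * Var 1 ^ 2 + Const (mp_coeff f [1,2]) * Var 1 * Var 2
    + Const (mp_coeff f [2,2]) * Var 2 ^ 2"
  by (subst binary_form_eq[OF assms]) (simp add: eval_nat_numeral)

lemma binary_quartic_eq:
  fixes f :: "(2, 'a::comm_ring_1) mpoly"
  assumes "form_over 4 S f"
  shows "f = Const (mp_coeff f [1,1,1,1]) * Var 1 ^ 4 + Const (mp_coeff f [1,1,1,2]) * Var 1 ^ 3 * Var 2
    + Const (mp_coeff f [1,1,2,2]) * Var 1 ^ 2 * Var 2 ^ 2
    + Const (mp_coeff f [1,2,2,2]) * Var 1 * Var 2 ^ 3 + Const (mp_coeff f [2,2,2,2]) * Var 2 ^ 4"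
  by (subst binary_form_eq[OF assms]) (simp add: eval_nat_numeral)

text \<open>The invariant \<open>b\<^sub>2\<close> of the Weierstrass equation of the Jacobian.\<close>

definition b2_2 :: "'a::comm_ring_1 model2 \<Rightarrow> 'a" where
  "b2_2 = (\<lambda>(p, q). mp_coeff p [1,2] ^ 2 - 4 * mp_coeff p [1,1] * mp_coeff p [2,2] + 4 * mp_coeff q [1,1,2,2])"

text \<open>Here C is the Hessian determinant of F divided by -144. The constants can be read off
  the x1^4 terms for p = 0: the Hessian contributes b^2 - 8ac/3, and b2 F / 12 contributes 4ac/3,
  which together make b^2 - 4ac.\<close>

lemma mp_eval_G2:
  fixes p q :: "(2, 'a::field_char_0) mpoly"
  assumes p: "form_over 2 S p" and q: "form_over 4 S q"
  shows "mp_eval (G2 (p, q)) x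
    = - mp_eval (det (hessian (F2 (p, q)))) x / 144 - b2_2 (p, q) / 12 * mp_eval (F2 (p, q)) x"
proof -
  define l m n where lmn: "l = mp_coeff p [1,1]" "m = mp_coeff p [1,2]" "n = mp_coeff p [2,2]"
  define a b c d e where abcde: "a = mp_coeff q [1,1,1,1]" "b = mp_coeff q [1,1,1,2]"
    "c = mp_coeff q [1,1,2,2]" "d = mp_coeff q [1,2,2,2]" "e = mp_coeff q [2,2,2,2]"
  have F: "F2 (p, q) = (Const l * Var 1 ^ 2 + Const m * Var 1 * Var 2 + Const n * Var 2 ^ 2)\<^sup>2
    + 4 * (Const a * Var 1 ^ 4 + Const b * Var 1 ^ 3 * Var 2 + Const c * Var 1 ^ 2 * Var 2 ^ 2
      + Const d * Var 1 * Var 2 ^ 3 + Const e * Var 2 ^ 4)"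
    unfolding F2_def prod.case lmn abcde
    by (subst binary_quadratic_eq[OF p], subst binary_quartic_eq[OF q]) (rule refl)
  have "144 * mp_eval (G2 (p, q)) x
    = - mp_eval (det (hessian (F2 (p, q)))) x - 12 * b2_2 (p, q) * mp_eval (F2 (p, q)) x"
    unfolding F det_2 hessian_def
    unfolding G2_def b2_2_def Let_def prod.case lmn[symmetric] abcde[symmetric]
    apply (simp add: power2_eq_square)
    apply algebra
    done
  then show ?thesis by (simp add: field_simps)
qed

text \<open>Completing the square: the shift by r drops out, because (p + 2r)^2 - 4pr - 4r^2 =
  p^2.\<close>

lemma F2_act2: "F2 (act2 (\<mu>, r, N) (p, q)) = Const (\<mu> ^ 2) * lin_subst N (F2 (p, q))"
proof (cases r)
  case (fields r0 r1 r2)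
  show ?thesis
    by (simp add: fields act2_def F2_def Let_def power2_eq_square algebra_simps)
qed

lemma mp_coeff_1122: "4 * mp_coeff f [1,1,2,2]
    = mp_eval (mp_deriv 1 (mp_deriv 1 (mp_deriv 2 (mp_deriv 2 f)))) (0 :: 'a::comm_ring_1^2)"
proof -
  have "mp_eval (mp_deriv 1 (mp_deriv 1 (mp_deriv 2 (mp_deriv 2 f)))) (0 :: 'a^2)
    = mp_coeff (mp_deriv 2 (mp_deriv 2 (mp_deriv 1 (mp_deriv 1 f)))) []"
    by (simp add: mp_coeff_Nil mp_deriv_commute[of 2 1])
  then show ?thesis by (simp add: mp_coeff_mp_deriv)
qed

text \<open>The discriminant of p is multiplied by det N^2 exactly. In four times the middle
  coefficient of q the binomial coefficients 6 and 3 make the contributions of a, b, d, e multiples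
  of 12, and c is multiplied by n11^2 n22^2 + 4 n11 n12 n21 n22 + n12^2 n21^2 = det N^2 + 6 n11 n12
  n21 n22.\<close>

lemma b2_2_lin_subst:
  fixes p q :: "(2, 'a::field_char_0) mpoly"
  assumes p: "form_over 2 S p" and q: "form_over 4 S q"
  shows "b2_2 (lin_subst N p, lin_subst N q) = det N ^ 2 * b2_2 (p, q)
    + 12 * (2 * mp_coeff q [1,1,1,1] * (N $ 1 $ 1)\<^sup>2 * (N $ 2 $ 1)\<^sup>2
      + mp_coeff q [1,1,1,2] * N $ 1 $ 1 * N $ 2 $ 1 * (N $ 1 $ 1 * N $ 2 $ 2 + N $ 2 $ 1 * N $ 1 $ 2)
      + 2 * mp_coeff q [1,1,2,2] * N $ 1 $ 1 * N $ 1 $ 2 * N $ 2 $ 1 * N $ 2 $ 2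
      + mp_coeff q [1,2,2,2] * N $ 1 $ 2 * N $ 2 $ 2 * (N $ 1 $ 1 * N $ 2 $ 2 + N $ 2 $ 1 * N $ 1 $ 2)
      + 2 * mp_coeff q [2,2,2,2] * (N $ 1 $ 2)\<^sup>2 * (N $ 2 $ 2)\<^sup>2)"
proof -
  define l m n where lmn: "l = mp_coeff p [1,1]" "m = mp_coeff p [1,2]" "n = mp_coeff p [2,2]"
  define a b c d e where abcde: "a = mp_coeff q [1,1,1,1]" "b = mp_coeff q [1,1,1,2]"
    "c = mp_coeff q [1,1,2,2]" "d = mp_coeff q [1,2,2,2]" "e = mp_coeff q [2,2,2,2]"
  have p_eq: "p = Const l * Var 1 ^ 2 + Const m * Var 1 * Var 2 + Const n * Var 2 ^ 2"
    unfolding lmn by (rule binary_quadratic_eq[OF p])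
  have q_eq: "q = Const a * Var 1 ^ 4 + Const b * Var 1 ^ 3 * Var 2 + Const c * Var 1 ^ 2 * Var 2 ^ 2
      + Const d * Var 1 * Var 2 ^ 3 + Const e * Var 2 ^ 4"
    unfolding abcde by (rule binary_quartic_eq[OF q])
  have main: "b2_2 (lin_subst N p, lin_subst N q)
    = mp_eval (mp_deriv 1 (mp_deriv 2 (lin_subst N p))) 0 ^ 2
    - mp_eval (mp_deriv 1 (mp_deriv 1 (lin_subst N p))) 0 * mp_eval (mp_deriv 2 (mp_deriv 2 (lin_subst N p))) 0
    + mp_eval (mp_deriv 1 (mp_deriv 1 (mp_deriv 2 (mp_deriv 2 (lin_subst N q))))) 0"
    unfolding b2_2_def prod.case mp_coeff_1122 eval_hessian by simp
  show ?thesis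
    unfolding main unfolding b2_2_def prod.case lmn[symmetric] abcde[symmetric]
    by (simp add: p_eq q_eq mp_deriv_lin_subst sum_2 mp_eval_lin_subst det_2) algebra
qed

text \<open>The terms in r1 cancel. The discriminant of p and the coefficient of q contribute 8 + 4
  copies of l r2 and of n r0, and 16 + 8 copies of r0 r2, which is where 12 comes from.\<close>

lemma b2_2_shift:
  fixes p q :: "(2, 'a::field_char_0) mpoly"
  assumes p: "form_over 2 S p"
    and r: "r = Const r0 * Var 1 ^ 2 + Const r1 * Var 1 * Var 2 + Const r2 * Var 2 ^ 2"
  shows "b2_2 (Const \<mu> * (p + 2 * r), Const (\<mu>^2) * (q - p * r - r^2)) = \<mu>^2 * b2_2 (p, q)
    - 12 * (\<mu>^2 * (mp_coeff p [1,1] * r2 + mp_coeff p [2,2] * r0 + 2 * r0 * r2))"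
proof -
  define l m n where lmn: "l = mp_coeff p [1,1]" "m = mp_coeff p [1,2]" "n = mp_coeff p [2,2]"
  have p_eq: "p = Const l * Var 1 ^ 2 + Const m * Var 1 * Var 2 + Const n * Var 2 ^ 2"
    unfolding lmn by (rule binary_quadratic_eq[OF p])
  have coeff_r: "mp_coeff r [1,2] = r1" "mp_coeff r [1,1] = r0" "mp_coeff r [2,2] = r2"
  proof -
    have "mp_eval (mp_deriv 1 (mp_deriv 2 r)) 0 = r1" "mp_eval (mp_deriv 1 (mp_deriv 1 r)) 0 = 2 * r0"
      "mp_eval (mp_deriv 2 (mp_deriv 2 r)) 0 = 2 * r2"
      by (simp_all add: r)
    then show "mp_coeff r [1,2] = r1" "mp_coeff r [1,1] = r0" "mp_coeff r [2,2] = r2"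
      unfolding eval_hessian by simp_all
  qed
  have pr: "mp_coeff (p * r) [1,1,2,2] = l * r2 + m * r1 + n * r0"
  proof -
    have "4 * mp_coeff (p * r) [1,1,2,2] = 4 * (l * r2 + m * r1 + n * r0)"
      unfolding mp_coeff_1122 p_eq r by simp
    then show ?thesis by (metis mult_left_cancel zero_neq_numeral)
  qed
  have rr: "mp_coeff (r^2) [1,1,2,2] = r1^2 + 2 * r0 * r2"
  proof -
    have "4 * mp_coeff (r^2) [1,1,2,2] = 4 * (r1^2 + 2 * r0 * r2)"
      unfolding mp_coeff_1122 r by (simp add: power2_eq_square)
    then show ?thesis by (metis mult_left_cancel zero_neq_numeral)
  qed
  have 2: "2 * r = Const 2 * r" by simp
  show ?thesis
    unfolding b2_2_def prod.case 2 lmn[symmetric] mp_coeff_add mp_coeff_diff mp_coeff_Const_mult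
      mp_coeff_diff pr rr coeff_r
    by algebra
qed

context valuation_ring
begin

lemma b2_2_act2:
  assumes \<Phi>: "model2_over R \<Phi>"
    and g: "(\<mu>, r, N) \<in> G2_over R \<or> diagonal2 (\<mu>, r, N)"
  shows "\<exists>\<rho>\<in>R. b2_2 (act2 (\<mu>, r, N) \<Phi>) = (\<mu> * det N) ^ 2 * b2_2 \<Phi> + 12 * \<rho>"
proof -
  obtain p q where \<Phi>_eq: "\<Phi> = (p, q)" and p: "form_over 2 R p" and q: "form_over 4 R q"
    using \<Phi> by (cases \<Phi>) (auto simp: model2_over_def)
  obtain r0 r1 r2 where r: "r = (r0, r1, r2)" by (cases r)
  define s where s: "s = Const r0 * Var 1 ^ 2 + Const r1 * Var 1 * Var 2 + Const r2 * Var (2::2) ^ 2"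
  let ?p = "Const \<mu> * (p + 2 * s)" and ?q = "Const (\<mu>^2) * (q - p * s - s^2)"
  let ?A = "N $ 1 $ 1" and ?B = "N $ 2 $ 1" and ?C = "N $ 1 $ 2" and ?D = "N $ 2 $ 2"
  let ?\<rho> = "2 * mp_coeff ?q [1,1,1,1] * ?A\<^sup>2 * ?B\<^sup>2 + mp_coeff ?q [1,1,1,2] * ?A * ?B * (?A * ?D + ?B * ?C)
      + 2 * mp_coeff ?q [1,1,2,2] * ?A * ?C * ?B * ?D
      + mp_coeff ?q [1,2,2,2] * ?C * ?D * (?A * ?D + ?B * ?C) + 2 * mp_coeff ?q [2,2,2,2] * ?C\<^sup>2 * ?D\<^sup>2"
  let ?\<sigma> = "\<mu>^2 * (mp_coeff p [1,1] * r2 + mp_coeff p [2,2] * r0 + 2 * r0 * r2)"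
  have act: "act2 (\<mu>, r, N) \<Phi> = (lin_subst N ?p, lin_subst N ?q)"
    by (simp only: act2_def \<Phi>_eq r prod.case Let_def s)
  \<comment> \<open>For diagonal g neither \<mu> nor N need be integral, so the formulas for b2 are
    used over the whole field and integrality is asked only of the correction term.\<close>
  have UNIV_forms: "form_over 2 UNIV p" "form_over 4 UNIV q"
    using p q by (auto simp: form_over_def)
  note forms = shift_forms[OF subring_set_UNIV UNIV_forms UNIV_I UNIV_I UNIV_I UNIV_I s]
  have eq: "b2_2 (act2 (\<mu>, r, N) \<Phi>)
    = (\<mu> * det N) ^ 2 * b2_2 \<Phi> + 12 * (?\<rho> - det N ^ 2 * ?\<sigma>)"
    unfolding act unfolding b2_2_lin_subst[OF forms] unfolding b2_2_shift[OF p s] \<Phi>_eq by algebra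
  have "?\<rho> - det N ^ 2 * ?\<sigma> \<in> R"
    using g
  proof
    assume g: "(\<mu>, r, N) \<in> G2_over R"
    then have in_R: "\<mu> \<in> R" "r0 \<in> R" "r1 \<in> R" "r2 \<in> R" and N: "\<And>i j. N $ i $ j \<in> R"
      by (auto simp: G2_over_def r GL_def unit_set_def)
    note coeffs = form_over_coeff[OF subring_set_R p]
      form_over_coeff[OF subring_set_R shift_forms(2)[OF subring_set_R p q in_R s]]
    show ?thesis
      by (intro R_add R_mult R_diff R_power R_det coeffs N in_R R_numeral)
  next
    \<comment> \<open>Each summand of the correction contains an off-diagonal entry of N, or r0 or
      r2, so the correction is 0.\<close>
    assume "diagonal2 (\<mu>, r, N)"
    then have "?C = 0" "?B = 0" "r0 = 0" "r2 = 0"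
      by (auto simp: diagonal2_def diagonal_matrix_def r)
    then show ?thesis by simp
  qed
  with eq show ?thesis by blast
qed

lemma max_val_abs_degree2:
  assumes c: "c > 1" and \<Phi>: "model2_over R \<Phi>" and \<Phi>': "model2_over R (act2 (\<mu>, r, N) \<Phi>)"
    and g: "(\<mu>, r, N) \<in> G2_over R \<or> det2 (\<mu>, r, N) \<in> unit_set R \<and> diagonal2 (\<mu>, r, N)"
    and x: "x = transpose N *v x'"
  shows "max (val_abs c v (mp_eval (F2 (act2 (\<mu>, r, N) \<Phi>)) x')) (val_abs c v (mp_eval (G2 (act2 (\<mu>, r, N) \<Phi>)) x'))
    = val_abs c v (det N) powi (- 2) * max (val_abs c v (mp_eval (F2 \<Phi>) x)) (val_abs c v (mp_eval (G2 \<Phi>) x))"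
proof -
  obtain p q where \<Phi>_eq: "\<Phi> = (p, q)" and p: "form_over 2 R p" and q: "form_over 4 R q"
    using \<Phi> by (cases \<Phi>) (auto simp: model2_over_def)
  obtain p' q' where \<Phi>'_eq: "act2 (\<mu>, r, N) \<Phi> = (p', q')" and p': "form_over 2 R p'" and q': "form_over 4 R q'"
    using \<Phi>' by (cases "act2 (\<mu>, r, N) \<Phi>") (auto simp: model2_over_def)
  have unit: "\<mu> * det N \<in> unit_set R"
    using g
  proof
    assume "(\<mu>, r, N) \<in> G2_over R"
    then have "\<mu> \<in> unit_set R" "det N \<in> unit_set R"
      using GL_det_unit by (auto simp: G2_over_def)
    then show ?thesis by (auto simp: unit_v v_mult)
  qed (simp add: det2_def)
  obtain \<rho> where \<rho>: "\<rho> \<in> R" "b2_2 (p', q') = (\<mu> * det N) ^ 2 * b2_2 (p, q) + 12 * \<rho>"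
    using b2_2_act2[OF \<Phi>, of \<mu> r N] g unfolding \<Phi>'_eq unfolding \<Phi>_eq by blast
  have F_eq: "F2 (p', q') = Const (\<mu> ^ 2) * lin_subst N (F2 (p, q))"
    using F2_act2[of \<mu> r N p q] \<Phi>'_eq \<Phi>_eq by simp
  have F: "mp_eval (F2 (p', q')) x' = \<mu>^2 * mp_eval (F2 (p, q)) x"
    by (simp add: F_eq mp_eval_lin_subst x)
  have hess: "mp_eval (det (hessian (F2 (p', q')))) x' = \<mu>^4 * det N ^ 2 * mp_eval (det (hessian (F2 (p, q)))) x"
  proof -
    have "det (hessian (Const (\<mu> ^ 2) * lin_subst N (F2 (p, q))))
      = Const (\<mu> ^ 4) * det (hessian (lin_subst N (F2 (p, q))))"
      by (simp add: hessian_Const_mult det_2 algebra_simps eval_nat_numeral)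
    then show ?thesis
      by (simp add: F_eq det_hessian_lin_subst mp_eval_lin_subst x)
  qed
  \<comment> \<open>The weights: F is multiplied by \<mu>^2 and the Hessian by \<mu>^4 det N^2. The
    extra det N^2 completes them to powers 2 and 4 of det g, and 12 \<rho> / 12 leaves the multiple
    of F.\<close>
  have G: "mp_eval (G2 (p', q')) x' * (det N)\<^sup>2 = (\<mu> * det N) ^ 4 * mp_eval (G2 (p, q)) x
      - \<rho> * (\<mu> * det N) ^ 2 * mp_eval (F2 (p, q)) x"
    unfolding mp_eval_G2[OF p' q'] mp_eval_G2[OF p q] F hess \<rho>(2)
    by (simp add: field_simps eval_nat_numeral)
  show ?thesis
    unfolding \<Phi>'_eq unfolding \<Phi>_eq
    by (rule max_val_abs_eq[OF c _ unit \<rho>(1) _ G]) (use unit in \<open>auto simp: F power_mult_distrib unit_v\<close>)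
qed

end

section \<open>Ternary cubics: b2 modulo 12 by transvections\<close>

section \<open>Degree 3\<close>

text \<open>On the symmetric tensor of third derivatives a substitution acts index by index, without
  the multinomial factors that coefficients carry.\<close>

abbreviation deriv3 :: "('i::finite, 'a::comm_ring_1) mpoly \<Rightarrow> 'i \<Rightarrow> 'i \<Rightarrow> 'i \<Rightarrow> 'a" where
  "deriv3 f i j k \<equiv> mp_eval (mp_deriv i (mp_deriv j (mp_deriv k f))) 0"

lemma deriv3_perm: "deriv3 f j i k = deriv3 f i j k" "deriv3 f i k j = deriv3 f i j k"
  by (simp_all add: mp_deriv_commute)

text \<open>The expression is symmetric in the three variables. With arbitrary distinct i, j, k, one
  computation covers all six positions of a transvection.\<close>

lemma b2_3_eq:
  fixes U :: "(3, 'a::field_char_0) mpoly"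
  assumes "i \<noteq> j" "j \<noteq> k" "i \<noteq> k"
  shows "b2_3 U = (deriv3 U i j k)\<^sup>2 - deriv3 U i i k * deriv3 U j j k
    - deriv3 U i j j * deriv3 U i k k - deriv3 U i i j * deriv3 U j k k"
proof -
  have sorted: "deriv3 U 2 1 k = deriv3 U 1 2 k" "deriv3 U 3 1 k = deriv3 U 1 3 k"
    "deriv3 U 3 2 k = deriv3 U 2 3 k" "deriv3 U k 2 1 = deriv3 U k 1 2"
    "deriv3 U k 3 1 = deriv3 U k 1 3" "deriv3 U k 3 2 = deriv3 U k 2 3" for k
    by (simp_all add: mp_deriv_commute)
  have "deriv3 U 3 2 1 = mp_coeff U [1,2,3]" "deriv3 U 3 2 2 = 2 * mp_coeff U [2,2,3]"
    "deriv3 U 1 3 3 = 2 * mp_coeff U [3,3,1]" "deriv3 U 2 1 1 = 2 * mp_coeff U [1,1,2]"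
    "deriv3 U 3 3 2 = 2 * mp_coeff U [2,3,3]" "deriv3 U 1 1 3 = 2 * mp_coeff U [3,1,1]"
    "deriv3 U 2 2 1 = 2 * mp_coeff U [1,2,2]"
    by (simp_all add: mp_coeff_mp_deriv flip: mp_coeff_Nil)
  then have b2: "b2_3 U = (deriv3 U 1 2 3)\<^sup>2 - deriv3 U 1 1 3 * deriv3 U 2 2 3
    - deriv3 U 1 2 2 * deriv3 U 1 3 3 - deriv3 U 1 1 2 * deriv3 U 2 3 3"
    by (simp add: b2_3_def Let_def sorted algebra_simps)
  have "i = 1 \<and> j = 2 \<and> k = 3 \<or> i = 1 \<and> j = 3 \<and> k = 2 \<or> i = 2 \<and> j = 1 \<and> k = 3
    \<or> i = 2 \<and> j = 3 \<and> k = 1 \<or> i = 3 \<and> j = 1 \<and> k = 2 \<or> i = 3 \<and> j = 2 \<and> k = 1"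
    using assms exhaust_3[of i] exhaust_3[of j] exhaust_3[of k] by auto
  moreover define D where "D = deriv3 U"
  ultimately show ?thesis
    using sorted unfolding b2 D_def[symmetric] by (elim disjE conjE) (simp_all add: mult_ac diff_right_commute)
qed

lemma mp_deriv_lin_subst_transvection:
  "mp_deriv a (lin_subst (transvection i j t) f)
    = lin_subst (transvection i j t) (mp_deriv a f)
      + (if a = i then Const t * lin_subst (transvection i j t) (mp_deriv j f) else 0)"
proof -
  define g where "g l = lin_subst (transvection i j t) (mp_deriv l f)" for l
  have "(\<Sum>l\<in>UNIV. Const (transvection i j t $ a $ l) * g l)
    = (\<Sum>l\<in>UNIV. (if l = a then g l else 0) + (if l = j then if a = i then Const t * g l else 0 else 0))"
    by (rule sum.cong) (auto simp: transvection_def distrib_right)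
  then show ?thesis by (simp add: mp_deriv_lin_subst sum.distrib g_def)
qed

lemma mp_deriv_lin_subst_diagonal:
  assumes "diagonal_matrix N"
  shows "mp_deriv a (lin_subst N f) = Const (N $ a $ a) * lin_subst N (mp_deriv a f)"
proof -
  define g where "g l = lin_subst N (mp_deriv l f)" for l
  have "(\<Sum>l\<in>UNIV. Const (N $ a $ l) * g l) = (\<Sum>l\<in>UNIV. if l = a then Const (N $ a $ l) * g l else 0)"
    by (rule sum.cong) (use assms in \<open>auto simp: diagonal_matrix_def\<close>)
  then show ?thesis by (simp add: mp_deriv_lin_subst g_def)
qed

text \<open>Every product in b2 contains each of the three indices exactly twice, so the diagonal
  entries collect to det N^2.\<close>

lemma b2_3_diagonal:
  fixes U :: "(3, 'a::field_char_0) mpoly"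
  assumes "diagonal_matrix N"
  shows "b2_3 (lin_subst N U) = det N ^ 2 * b2_3 U"
proof -
  have *: "b2_3 V = (deriv3 V 1 2 3)\<^sup>2 - deriv3 V 1 1 3 * deriv3 V 2 2 3
    - deriv3 V 1 2 2 * deriv3 V 1 3 3 - deriv3 V 1 1 2 * deriv3 V 2 3 3" for V :: "(3, 'a) mpoly"
    by (rule b2_3_eq) auto
  have deriv3: "deriv3 (lin_subst N U) i j k = N $ i $ i * N $ j $ j * N $ k $ k * deriv3 U i j k" for i j k
    by (simp add: mp_deriv_lin_subst_diagonal[OF assms] mp_eval_lin_subst)
  have det: "det N = N $ 1 $ 1 * N $ 2 $ 2 * N $ 3 $ 3"
    using assms by (simp add: det_3 diagonal_matrix_def)
  show ?thesis
    unfolding * deriv3 det by algebra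
qed

text \<open>The derivative in direction i becomes the one in i plus t times the one in j, and the
  others stay. The new terms from the first two products cancel. What survives is divisible by 12
  over the ring, since D_ijj, D_jkk, D_ikk are twice a coefficient and D_jjj is six times
  one.\<close>

lemma b2_3_transvection:
  fixes U :: "(3, 'a::field_char_0) mpoly"
  assumes "i \<noteq> j" "j \<noteq> k" "i \<noteq> k"
  shows "b2_3 (lin_subst (transvection i j t) U) = b2_3 U
    - 3 * t * deriv3 U i j j * deriv3 U j k k - t * deriv3 U i k k * deriv3 U j j j
    - 2 * t\<^sup>2 * deriv3 U j k k * deriv3 U j j j"
proof -
  have *: "deriv3 (lin_subst (transvection i j t) U) i j k = deriv3 U i j k + t * deriv3 U j j k"
    "deriv3 (lin_subst (transvection i j t) U) i i k
      = deriv3 U i i k + 2 * t * deriv3 U i j k + t\<^sup>2 * deriv3 U j j k"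
    "deriv3 (lin_subst (transvection i j t) U) j j k = deriv3 U j j k"
    "deriv3 (lin_subst (transvection i j t) U) i j j = deriv3 U i j j + t * deriv3 U j j j"
    "deriv3 (lin_subst (transvection i j t) U) i k k = deriv3 U i k k + t * deriv3 U j k k"
    "deriv3 (lin_subst (transvection i j t) U) i i j
      = deriv3 U i i j + 2 * t * deriv3 U i j j + t\<^sup>2 * deriv3 U j j j"
    "deriv3 (lin_subst (transvection i j t) U) j k k = deriv3 U j k k"
    using assms deriv3_perm(1)[of j i _ U]
    by (simp_all add: mp_deriv_lin_subst_transvection mp_eval_lin_subst power2_eq_square distrib_left)
  show ?thesis
    unfolding b2_3_eq[OF assms] unfolding * by algebra
qed

lemma (in valuation_ring) b2_3_lin_subst:
  assumes N: "\<And>i j. N $ i $ j \<in> R" and U: "form_over 3 R U"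
  shows "\<exists>\<rho>\<in>R. b2_3 (lin_subst N U) = det N ^ 2 * b2_3 U + 12 * \<rho>"
proof -
  \<comment> \<open>All U are quantified over because the product case applies the statement for A
    to \<open>lin_subst B U\<close>. N need not be invertible here.\<close>
  define P where "P N \<longleftrightarrow> (\<forall>U. form_over 3 R U
    \<longrightarrow> (\<exists>\<rho>\<in>R. b2_3 (lin_subst N U) = det N ^ 2 * b2_3 U + 12 * \<rho>))" for N :: "'a^3^3"
  have "P N"
  proof (rule matrix_induct[where P = P, OF N])
    fix D :: "'a^3^3"
    assume "diagonal_matrix D"
    then show "P D" by (auto simp: P_def b2_3_diagonal intro!: bexI[of _ 0])
  next
    fix i j :: 3 and t
    assume ij: "i \<noteq> j" and t: "t \<in> R"
    have "\<exists>k. j \<noteq> k \<and> i \<noteq> k"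
    proof -
      have "card {i, j} < CARD(3)" using card_insert_le_m1[of 2 "{j}" i] by simp
      then have "{i, j} \<noteq> UNIV" by (metis less_irrefl)
      then show ?thesis by auto
    qed
    then obtain k where k: "j \<noteq> k" "i \<noteq> k" by blast
    show "P (transvection i j t)"
      unfolding P_def
    proof (intro allI impI)
      fix U :: "(3, 'a) mpoly"
      assume U: "form_over 3 R U"
      note coeff = form_over_coeff[OF subring_set_R U]
      have d: "deriv3 U i j j = 2 * mp_coeff U [j,j,i]" "deriv3 U j k k = 2 * mp_coeff U [k,k,j]"
        "deriv3 U i k k = 2 * mp_coeff U [k,k,i]" "deriv3 U j j j = 6 * mp_coeff U [j,j,j]"
        using ij k by (simp_all add: mp_coeff_mp_deriv flip: mp_coeff_Nil)
      let ?\<rho> = "- (t * mp_coeff U [j,j,i] * mp_coeff U [k,k,j] + t * mp_coeff U [k,k,i] * mp_coeff U [j,j,j]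
        + 2 * t\<^sup>2 * mp_coeff U [k,k,j] * mp_coeff U [j,j,j])"
      have "?\<rho> \<in> R"
        by (intro R_uminus R_add R_mult R_power t coeff R_numeral)
      moreover have "b2_3 (lin_subst (transvection i j t) U) = det (transvection i j t) ^ 2 * b2_3 U + 12 * ?\<rho>"
        unfolding b2_3_transvection[OF ij k] det_transvection[OF ij] d power_one mult_1 by algebra
      ultimately show "\<exists>\<rho>\<in>R. b2_3 (lin_subst (transvection i j t) U)
        = det (transvection i j t) ^ 2 * b2_3 U + 12 * \<rho>" by blast
    qed
  next
    fix A B :: "'a^3^3"
    assume R: "\<And>i j. A $ i $ j \<in> R" "\<And>i j. B $ i $ j \<in> R" and P: "P A" "P B"
    show "P (A ** B)"
      unfolding P_def
    proof (intro allI impI)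
      fix U :: "(3, 'a) mpoly"
      assume U: "form_over 3 R U"
      obtain \<rho> where \<rho>: "\<rho> \<in> R" "b2_3 (lin_subst B U) = det B ^ 2 * b2_3 U + 12 * \<rho>"
        using P(2) U unfolding P_def by blast
      obtain \<sigma> where \<sigma>: "\<sigma> \<in> R"
        "b2_3 (lin_subst A (lin_subst B U)) = det A ^ 2 * b2_3 (lin_subst B U) + 12 * \<sigma>"
        using P(1) form_over_lin_subst[OF subring_set_R R(2) U] unfolding P_def by blast
      have "b2_3 (lin_subst (A ** B) U) = det (A ** B) ^ 2 * b2_3 U + 12 * (det A ^ 2 * \<rho> + \<sigma>)"
        unfolding lin_subst_mult \<sigma> \<rho> det_mul by algebra
      moreover have "det A ^ 2 * \<rho> + \<sigma> \<in> R" using R_det[OF R(1)] \<rho> \<sigma> by auto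
      ultimately show "\<exists>\<rho>\<in>R. b2_3 (lin_subst (A ** B) U) = det (A ** B) ^ 2 * b2_3 U + 12 * \<rho>"
        by blast
    qed
  qed
  with U show ?thesis by (auto simp: P_def)
qed

section \<open>Weights of the Hessian and the bordered Hessian of a cubic\<close>

lemma H3_act3: "H3 (act3 (\<mu>, N) U) = Const (\<mu>^3 * det N ^ 2) * lin_subst N (H3 U)"
proof -
  have "det (hessian (Const \<mu> * lin_subst N U)) = Const \<mu> ^ 3 * det (hessian (lin_subst N U))"
    by (simp add: hessian_Const_mult det_3 algebra_simps eval_nat_numeral)
  then show ?thesis
    by (simp add: H3_def act3_def det_hessian_lin_subst mult_ac)
qed

definition bordered :: "'a::comm_ring_1^3^3 \<Rightarrow> 'a^3 \<Rightarrow> 'a^4^4" where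
  "bordered A h = vector [vector [A $ 1 $ 1, A $ 1 $ 2, A $ 1 $ 3, h $ 1],
    vector [A $ 2 $ 1, A $ 2 $ 2, A $ 2 $ 3, h $ 2], vector [A $ 3 $ 1, A $ 3 $ 2, A $ 3 $ 3, h $ 3],
    vector [h $ 1, h $ 2, h $ 3, 0]]"

lemma vector_4 [simp]:
  "(vector [w, x, y, z] :: ('a::zero)^4) $ 1 = w" "(vector [w, x, y, z] :: ('a::zero)^4) $ 2 = x"
  "(vector [w, x, y, z] :: ('a::zero)^4) $ 3 = y" "(vector [w, x, y, z] :: ('a::zero)^4) $ 4 = z"
  unfolding vector_def by simp_all

text \<open>The new matrix is the old one multiplied on the left by the block matrix of \<mu> N and
  s, and on the right by that of the transpose of N and s/\<mu>. The unequal corners give both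
  copies of h the same factor s.\<close>

lemma det_bordered:
  fixes A N :: "'a::field^3^3"
  assumes "\<mu> \<noteq> 0"
  shows "det (bordered (\<chi> i j. \<mu> * (N ** A ** transpose N) $ i $ j) (\<chi> i. s * (N *v h) $ i))
    = (\<mu> * s * det N) ^ 2 * det (bordered A h)"
proof -
  define block :: "'a^3^3 \<Rightarrow> 'a \<Rightarrow> 'a^4^4" where
    "block X t = vector [vector [X $ 1 $ 1, X $ 1 $ 2, X $ 1 $ 3, 0], vector [X $ 2 $ 1, X $ 2 $ 2, X $ 2 $ 3, 0],
      vector [X $ 3 $ 1, X $ 3 $ 2, X $ 3 $ 3, 0], vector [0, 0, 0, t]]" for X t
  have det_block: "det (block X t) = t * det X" for X t
    by (simp add: det_4 det_3 block_def algebra_simps)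
  have "bordered (\<chi> i j. \<mu> * (N ** A ** transpose N) $ i $ j) (\<chi> i. s * (N *v h) $ i)
    = block (\<chi> i j. \<mu> * N $ i $ j) s ** bordered A h ** block (transpose N) (s / \<mu>)"
    using assms
    by (simp add: vec_eq_iff forall_4 matrix_mult_component matrix_vector_mult_component sum_3 sum_4
        block_def bordered_def transpose_apply algebra_simps)
  moreover have "det (\<chi> i j. \<mu> * N $ i $ j) = \<mu> ^ 3 * det N"
    by (simp add: det_3 algebra_simps eval_nat_numeral)
  ultimately show ?thesis
    using assms by (simp add: det_mul det_block power_mult_distrib eval_nat_numeral)
qed

lemma mp_eval_Theta3:
  "mp_eval (Theta3 U) x = 1 / 3 * det (bordered (\<chi> i j. mp_eval (hessian U $ i $ j) x)
    (\<chi> i. mp_eval (mp_deriv i (H3 U)) x))"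
  unfolding Theta3_def Let_def eval.hom_mult mp_eval_Const eval.hom_det
  by (rule arg_cong[of _ _ "\<lambda>A. 1 / 3 * det A"]) (simp add: vec_eq_iff forall_4 bordered_def)

text \<open>By \<open>H3_act3\<close> the gradient of H comes with s = \<mu>^3 det N^2, so the
  factor in \<open>det_bordered\<close> is the square of \<mu>^4 det N^3.\<close>

lemma mp_eval_Theta3_act3:
  assumes "\<mu> \<noteq> 0"
  shows "mp_eval (Theta3 (act3 (\<mu>, N) U)) x' = \<mu>^8 * det N ^ 6 * mp_eval (Theta3 U) (transpose N *v x')"
proof -
  let ?x = "transpose N *v x'"
  have U: "(\<chi> i j. mp_eval (hessian (act3 (\<mu>, N) U) $ i $ j) x')
    = (\<chi> i j. \<mu> * (N ** (\<chi> i j. mp_eval (hessian U $ i $ j) ?x) ** transpose N) $ i $ j)"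
    by (simp add: act3_def hessian_Const_mult hessian_lin_subst vec_eq_iff matrix_mult_component
        transpose_apply mp_eval_lin_subst)
  have H: "(\<chi> i. mp_eval (mp_deriv i (H3 (act3 (\<mu>, N) U))) x')
    = (\<chi> i. (\<mu>^3 * det N ^ 2) * (N *v (\<chi> i. mp_eval (mp_deriv i (H3 U)) ?x)) $ i)"
    by (simp add: H3_act3 vec_eq_iff matrix_vector_mult_component mp_deriv_lin_subst mp_eval_lin_subst)
  show ?thesis
    unfolding mp_eval_Theta3 U H det_bordered[OF assms] by (simp add: eval_nat_numeral mult_ac)
qed

lemma mp_eval_F3: "mp_eval U x = 0 \<Longrightarrow> mp_eval (F3 U) x = (mp_eval (H3 U) x)\<^sup>2 / 16"
  by (simp add: F3_def Z3_def power2_eq_square)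

text \<open>On the curve the terms containing U vanish, and 16/192 = 1/12 gives the decomposition
  with C = Theta / 192. Off the curve Z involves b2 U, which is not covariant.\<close>

lemma mp_eval_G3: "mp_eval U x = 0 \<Longrightarrow> mp_eval (G3 U) x = mp_eval (Theta3 U) x / 192 - b2_3 U / 12 * mp_eval (F3 U) x"
  by (simp add: G3_def F3_def Z3_def field_simps)

context valuation_ring
begin

lemma max_val_abs_degree3:
  assumes c: "c > 1" and U: "model3_over R U"
    and g: "(\<mu>, N) \<in> G3_over R \<or> det3 (\<mu>, N) \<in> unit_set R \<and> diagonal3 (\<mu>, N)"
    and x: "x = transpose N *v x'" and Ux: "mp_eval U x = 0"
  shows "max (val_abs c v (mp_eval (F3 (act3 (\<mu>, N) U)) x')) (val_abs c v (mp_eval (G3 (act3 (\<mu>, N) U)) x'))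
    = val_abs c v (det N) powi (- 2) * max (val_abs c v (mp_eval (F3 U) x)) (val_abs c v (mp_eval (G3 U) x))"
proof -
  let ?U' = "act3 (\<mu>, N) U"
  have U: "form_over 3 R U" using U by (simp add: model3_over_def)
  have Ux': "mp_eval ?U' x' = 0" using Ux by (simp add: act3_def mp_eval_lin_subst x)
  have unit: "\<mu> * det N \<in> unit_set R"
    using g
  proof
    assume "(\<mu>, N) \<in> G3_over R"
    then have "\<mu> \<in> unit_set R" "det N \<in> unit_set R"
      using GL_det_unit by (auto simp: G3_over_def)
    then show ?thesis by (auto simp: unit_v v_mult)
  qed (simp add: det3_def)
  then have nz: "\<mu> \<noteq> 0" "det N \<noteq> 0" by (auto simp: unit_v)
  have scale: "b2_3 ?U' = \<mu>^2 * b2_3 (lin_subst N U)"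
    by (simp add: act3_def b2_3_def Let_def algebra_simps power2_eq_square)
  have "\<exists>\<rho>\<in>R. b2_3 ?U' = (\<mu> * det N) ^ 2 * b2_3 U + 12 * \<rho>"
    using g
  proof
    assume "(\<mu>, N) \<in> G3_over R"
    then have \<mu>: "\<mu> \<in> R" and N: "\<And>i j. N $ i $ j \<in> R"
      by (auto simp: G3_over_def GL_def unit_set_def)
    obtain \<rho> where "\<rho> \<in> R" "b2_3 (lin_subst N U) = det N ^ 2 * b2_3 U + 12 * \<rho>"
      using b2_3_lin_subst[OF N U] by blast
    then show ?thesis
      using \<mu> by (intro bexI[of _ "\<mu>^2 * \<rho>"]) (auto simp: scale algebra_simps)
  next
    assume "det3 (\<mu>, N) \<in> unit_set R \<and> diagonal3 (\<mu>, N)"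
    then have "diagonal_matrix N" by (simp add: diagonal3_def)
    then show ?thesis
      by (intro bexI[of _ 0]) (auto simp: scale b2_3_diagonal power_mult_distrib)
  qed
  then obtain \<rho> where \<rho>: "\<rho> \<in> R" "b2_3 ?U' = (\<mu> * det N) ^ 2 * b2_3 U + 12 * \<rho>" by blast
  have F: "mp_eval (F3 ?U') x' = \<mu>^6 * det N ^ 4 * mp_eval (F3 U) x"
    unfolding mp_eval_F3[OF Ux'] mp_eval_F3[OF Ux] H3_act3
    by (simp add: mp_eval_lin_subst x power_mult_distrib flip: power_mult)
  \<comment> \<open>After multiplication by det N^2 the weights \<mu>^6 det N^4 of F and \<mu>^8 det
    N^6 of Theta become powers 6 and 8 of det g.\<close>
  have G: "mp_eval (G3 ?U') x' * (det N)\<^sup>2 = (\<mu> * det N) ^ 8 * mp_eval (G3 U) x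
      - \<rho> * (\<mu> * det N) ^ 6 * mp_eval (F3 U) x"
    unfolding mp_eval_G3[OF Ux'] mp_eval_G3[OF Ux] F \<rho>(2) mp_eval_Theta3_act3[OF nz(1)]
    unfolding x by (simp add: field_simps eval_nat_numeral)
  show ?thesis
    by (rule max_val_abs_eq[OF c nz(2) unit \<rho>(1) _ G]) (simp add: F power_mult_distrib flip: power_add)
qed

end

section \<open>Cramer's rule and the adjugate of a pencil of symmetric matrices\<close>

section \<open>Adjugates\<close>

lemma matrix_vector_mult_row_sum: "(A :: 'a::comm_ring_1^'n^'m) *v x = (\<Sum>m\<in>UNIV. x $ m *s row m (transpose A))"
  by (simp add: vec_eq_iff matrix_vector_mult_def row_def transpose_def mult.commute)

text \<open>Two forms of the cofactor at (i, j): column j replaced by a unit vector, or row i. In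
  the Leibniz sum a permutation contributes only if it sends i to j, and then the products
  agree.\<close>

lemma det_replace_row_col:
  fixes A :: "'a::comm_ring_1^'n::finite^'n"
  shows "det (\<chi> k l. if l = j then if k = i then 1 else 0 else A $ k $ l)
    = det (\<chi> k. if k = i then axis j 1 else A $ k)"
  unfolding det_def
proof (rule sum.cong)
  fix p assume "p \<in> {p. p permutes (UNIV :: 'n set)}"
  then have p: "p permutes UNIV" by simp
  have "(\<Prod>k\<in>UNIV. if p k = j then if k = i then 1 else 0 else A $ k $ p k)
    = (\<Prod>k\<in>UNIV. if k = i then if p k = j then 1 else 0 else A $ k $ p k)"
  proof (cases "p i = j")
    case True
    then have "p k = j \<longleftrightarrow> k = i" for k using permutes_inj[OF p] by (auto dest: injD)
    then show ?thesis by (intro prod.cong) auto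
  next
    case False
    obtain k where "p k = j" using permutes_surj[OF p] by (metis surjD)
    with False have "(\<Prod>k\<in>UNIV. if p k = j then if k = i then 1 else 0 else A $ k $ p k) = 0"
      by (intro prod_zero) auto
    moreover have "(\<Prod>k\<in>UNIV. if k = i then if p k = j then 1 else 0 else A $ k $ p k) = 0"
      using False by (intro prod_zero) auto
    ultimately show ?thesis by simp
  qed
  moreover have "(if k = i then axis j 1 else A $ k) $ l = (if k = i then if l = j then 1 else 0 else A $ k $ l)"
    for k l
    by (simp add: axis_def)
  ultimately show "of_int (sign p) * (\<Prod>k\<in>UNIV. (\<chi> k l. if l = j then if k = i then 1 else 0 else A $ k $ l) $ k $ p k)
    = of_int (sign p) * (\<Prod>k\<in>UNIV. (\<chi> k. if k = i then axis j 1 else A $ k) $ k $ p k)"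
    by simp
qed simp

lemma adjugate_transpose: "adjugate (transpose A) = transpose (adjugate A)"
proof -
  have "det (\<chi> k. if k = j then axis i 1 else transpose A $ k)
    = det (\<chi> k. if k = i then axis j 1 else A $ k)" for i j
  proof -
    have "transpose (\<chi> k. if k = j then axis i 1 else transpose A $ k)
      = (\<chi> k l. if l = j then if k = i then 1 else 0 else A $ k $ l)"
      by (simp add: vec_eq_iff transpose_def axis_def)
    then have "det (\<chi> k. if k = j then axis i 1 else transpose A $ k)
      = det (\<chi> k l. if l = j then if k = i then 1 else 0 else A $ k $ l)"
      using det_transpose[of "\<chi> k. if k = j then axis i 1 else transpose A $ k"] by simp
    also note det_replace_row_col
    finally show ?thesis .
  qed
  then show ?thesis
    unfolding vec_eq_iff transpose_apply unfolding adjugate_def vec_lambda_beta by simp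
qed

text \<open>Cramer's rule without division: expand b in unit vectors and use linearity of the
  determinant in one row. Columns of A appear as rows of the transpose.\<close>

lemma adjugate_mult_vec:
  fixes A :: "'a::comm_ring_1^'n::finite^'n"
  shows "(adjugate A *v b) $ i = det (\<chi> l. if l = i then b else transpose A $ l)"
proof -
  have b: "b = (\<Sum>j\<in>UNIV. b $ j *s axis j 1)"
    by (simp add: vec_eq_iff axis_def if_distrib cong: if_cong)
  have "det (\<chi> l. if l = i then b else transpose A $ l)
    = det (\<chi> l. if l = i then \<Sum>j\<in>UNIV. b $ j *s axis j 1 else transpose A $ l)"
    by (rule arg_cong[OF b])
  also have "\<dots> = (\<Sum>j\<in>UNIV. b $ j * det (\<chi> l. if l = i then axis j 1 else transpose A $ l))"
    unfolding det_linear_row_sum[OF finite_class.finite_UNIV, of _ "\<lambda>l j. b $ j *s axis j 1"] det_row_mul ..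
  also have "\<dots> = (\<Sum>j\<in>UNIV. b $ j * adjugate (transpose A) $ j $ i)"
    by (simp add: adjugate_def)
  finally show ?thesis
    by (simp add: adjugate_transpose transpose_apply matrix_vector_mult_def mult.commute)
qed

lemma adjugate_mult_mult_vec:
  fixes A :: "'a::field^'n::finite^'n"
  shows "adjugate A *v (A *v x) = det A *s x"
proof -
  have row: "row l (transpose A) = transpose A $ l" for l
    by (simp add: row_def)
  have "(adjugate A *v (A *v x)) $ k = x $ k * det A" for k
    unfolding adjugate_mult_vec
    using cramer_lemma_transpose[of k x "transpose A"]
    unfolding row det_transpose unfolding matrix_vector_mult_row_sum[of A x] row .
  then show ?thesis by (simp add: vec_eq_iff mult.commute)
qed

text \<open>In Cramer's form: replacing a column of NC by N b gives N times the matrix C with that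
  column replaced by b. So N may be singular.\<close>

lemma adjugate_mult_left:
  fixes N C :: "'a::comm_ring_1^'n::finite^'n"
  shows "adjugate (N ** C) *v (N *v b) = det N *s (adjugate C *v b)"
proof -
  have "(\<chi> l. if l = i then N *v b else transpose (N ** C) $ l)
    = (\<chi> l. if l = i then b else transpose C $ l) ** transpose N" for i
    by (auto simp: vec_eq_iff matrix_matrix_mult_def matrix_vector_mult_def transpose_def mult.commute)
  then have "(adjugate (N ** C) *v (N *v b)) $ i = (det N *s (adjugate C *v b)) $ i" for i
    by (simp add: adjugate_mult_vec det_mul mult.commute)
  then show ?thesis by (simp add: vec_eq_iff)
qed

lemma scalar_product_mult_vec: "scalar_product u (X *v w) = scalar_product (transpose X *v u) w"
  for X :: "'a::comm_ring_1^'n::finite^'n"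
proof -
  have "scalar_product u (X *v w) = (\<Sum>i\<in>UNIV. \<Sum>j\<in>UNIV. u $ i * X $ i $ j * w $ j)"
    by (simp add: scalar_product_def matrix_vector_mult_def sum_distrib_left mult.assoc)
  also have "\<dots> = scalar_product (transpose X *v u) w"
    by (subst sum.swap)
      (simp add: scalar_product_def matrix_vector_mult_def transpose_def sum_distrib_left
        sum_distrib_right mult_ac)
  finally show ?thesis .
qed

lemma scalar_product_commute: "scalar_product u w = scalar_product w (u :: 'a::comm_ring_1^'n::finite)"
  by (simp add: scalar_product_def mult.commute)

lemma scalar_product_linear [simp]:
  fixes u :: "'a::comm_ring_1^'n::finite"
  shows "scalar_product u (a *s w) = a * scalar_product u w"
    "scalar_product (a *s u) w = a * scalar_product u w"
    "scalar_product u (w + z) = scalar_product u w + scalar_product u z"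
    "scalar_product (u + z) w = scalar_product u w + scalar_product z w"
  by (simp_all add: scalar_product_def sum_distrib_left algebra_simps sum.distrib)

text \<open>\<open>adjugate_mult_left\<close> strips N from the right argument; after moving the
  adjugate to the left argument by transposition, it strips the other N.\<close>

lemma adjugate_quadratic_conj:
  fixes N B :: "'a::comm_ring_1^'n::finite^'n"
  shows "scalar_product (N *v u) (adjugate (N ** B ** transpose N) *v (N *v w))
    = det N ^ 2 * scalar_product u (adjugate B *v w)"
proof -
  have t: "transpose (B ** transpose N) = N ** transpose B"
    by (simp add: matrix_transpose_mul)
  have "scalar_product (N *v u) (adjugate (N ** B ** transpose N) *v (N *v w))
    = det N * scalar_product (N *v u) (adjugate (B ** transpose N) *v w)"
    by (simp add: adjugate_mult_left flip: matrix_mul_assoc)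
  also have "\<dots> = det N * scalar_product (adjugate (N ** transpose B) *v (N *v u)) w"
    by (simp only: scalar_product_mult_vec adjugate_transpose[symmetric] t)
  also have "\<dots> = det N ^ 2 * scalar_product (transpose (adjugate B) *v u) w"
    by (simp add: adjugate_mult_left adjugate_transpose power2_eq_square)
  finally show ?thesis by (simp add: scalar_product_mult_vec)
qed

text \<open>The identity behind the transformation behaviour of \<open>T\<^sub>1\<close> and \<open>T\<^sub>2\<close>: the bilinear form
  \<open>adj(\<lambda>A + \<mu>B)\<close> on the span of \<open>u = Ax\<close> and \<open>w = Bx\<close> has \<open>\<lambda>u + \<mu>w\<close> in its kernel, hence is
  a multiple of the square of one linear form, and the factor is linear in \<open>\<lambda>, \<mu>\<close> because the
  adjugate is cubic.\<close>

lemma adjugate_pencil: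
  fixes A B :: "'a::field_char_0^4^4" and \<alpha> \<beta> s t :: 'a
  assumes sym: "transpose A = A" "transpose B = B"
    and x: "scalar_product x (A *v x) = 0" "scalar_product x (B *v x) = 0"
    and nz: "s \<noteq> 0 \<or> t \<noteq> 0"
  defines "u \<equiv> A *v x" and "w \<equiv> B *v x"
  defines "y \<equiv> \<alpha> *s u + \<beta> *s w"
  shows "scalar_product y (adjugate (\<chi> i j. s * A $ i $ j + t * B $ i $ j) *v y)
    = (\<alpha> * t - \<beta> * s) ^ 2
      * (s * scalar_product w (adjugate A *v w) + t * scalar_product u (adjugate B *v u))"
proof -
  define C where "C l m = (\<chi> i j. l * A $ i $ j + m * B $ i $ j)" for l m
  define b where "b l m y z = scalar_product y (adjugate (C l m) *v z)" for l m y z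
  define L :: "(2, 'a) mpoly^4^4" where "L = (\<chi> i j. Const (A $ i $ j) * Var 1 + Const (B $ i $ j) * Var 2)"
  \<comment> \<open>Entries of the adjugate are 3 by 3 minors of a matrix of linear forms: row j is
    replaced by a constant vector and the other three rows have degree 1. Hence b is a binary cubic
    in l and m.\<close>
  have cubic: "\<exists>c0 c1 c2 c3. \<forall>l m. b l m y z = c0 * l^3 + c1 * l^2 * m + c2 * l * m^2 + c3 * m^3" for y z
  proof -
    define F where "F = (\<Sum>i\<in>UNIV. \<Sum>j\<in>UNIV. Const (y $ i * z $ j) * adjugate L $ i $ j)"
    have entry: "form_over (if k = j then 0 else 1) UNIV ((if k = j then axis i 1 else L $ k) $ l)" for i j k l
      using form_over_Const[OF subring_set_UNIV, of 1] form_over_zero[OF subring_set_UNIV, of 0]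
      by (auto simp: axis_def L_def simp del: One_nat_def intro!: form_over_add form_over_Const_mult form_over_Var subring_set_UNIV)
    have three: "(\<Sum>k\<in>UNIV. if k = j then 0 else 1) = (3 :: nat)" for j :: 4
      using exhaust_4[of j] by (auto simp: sum_4)
    have "form_over 3 UNIV (adjugate L $ i $ j)" for i j
    proof -
      have "form_over (\<Sum>k\<in>UNIV. if k = j then 0 else 1) UNIV
          (\<Prod>k\<in>UNIV. (if k = j then axis i 1 else L $ k) $ p k)" for p
        by (intro form_over_prod subring_set_UNIV entry)
      then have prod: "form_over 3 UNIV (\<Prod>k\<in>UNIV. (if k = j then axis i 1 else L $ k) $ p k)" for p
        unfolding three .
      have "form_over 3 UNIV (Const (of_int (sign p)) * (\<Prod>k\<in>UNIV. (if k = j then axis i 1 else L $ k) $ p k))"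
        for p
        by (intro form_over_Const_mult prod subring_set_UNIV UNIV_I)
      then have "form_over 3 UNIV (\<Sum>p | p permutes UNIV. Const (of_int (sign p)) *
          (\<Prod>k\<in>UNIV. (if k = j then axis i 1 else L $ k) $ p k))"
        by (intro form_over_sum subring_set_UNIV)
      then show ?thesis
        by (simp add: adjugate_def det_def)
    qed
    then have "form_over 3 UNIV F"
      unfolding F_def by (intro form_over_sum form_over_Const_mult subring_set_UNIV) auto
    from binary_form_eq[OF this] obtain c0 c1 c2 c3 where
      F: "F = Const c0 * Var 1 ^ 3 + Const c1 * Var 1 ^ 2 * Var 2 + Const c2 * Var 1 * Var 2 ^ 2 + Const c3 * Var 2 ^ 3"
      by (simp add: eval_nat_numeral)
    have "b l m y z = mp_eval F (vector [l, m])" for l m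
    proof -
      have "mp_eval (adjugate L $ i $ j) (vector [l, m]) = adjugate (C l m) $ i $ j" for i j
      proof -
        have "(\<chi> k l'. mp_eval ((if k = j then axis i 1 else L $ k) $ l') (vector [l, m]))
          = (\<chi> k. if k = j then axis i 1 else C l m $ k)"
          by (simp add: vec_eq_iff L_def C_def axis_def mult.commute)
        then show ?thesis by (simp add: adjugate_def eval.hom_det)
      qed
      then show ?thesis
        by (simp add: b_def F_def scalar_product_def matrix_vector_mult_def sum_distrib_left mult_ac)
    qed
    then show ?thesis by (auto simp: F)
  qed
  have C_sym: "transpose (C l m) = C l m" for l m
  proof -
    have "A $ i $ j = A $ j $ i" "B $ i $ j = B $ j $ i" for i j
      using sym by (metis transpose_apply)+
    then show ?thesis by (simp add: vec_eq_iff transpose_def C_def)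
  qed
  have b_sym: "b l m y z = b l m z y" for l m y z
    unfolding b_def
    by (subst scalar_product_mult_vec) (simp only: adjugate_transpose[symmetric] C_sym scalar_product_commute)
  have b_lin: "b l m y (a *s z + a' *s z') = a * b l m y z + a' * b l m y z'" for l m y z z' a a'
    by (simp add: b_def matrix_vector_right_distrib matrix_vector_mult_scaleR vector_scalar_commute)
  \<comment> \<open>Here l u + m w is C x, and the adjugate of C sends it to det C times x, which is
    orthogonal to y.\<close>
  have kernel: "l * b l m y u + m * b l m y w = 0" if "scalar_product y x = 0" for l m y
  proof -
    have "l *s u + m *s w = C l m *v x"
      by (simp add: vec_eq_iff u_def w_def C_def matrix_vector_mult_def sum_distrib_left sum.distrib algebra_simps)
    then have "b l m y (l *s u + m *s w) = det (C l m) * scalar_product y x"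
      by (simp add: b_def adjugate_mult_mult_vec)
    with that show ?thesis by (simp add: b_lin)
  qed
  have ux: "scalar_product u x = 0" "scalar_product w x = 0"
    using x by (auto simp: u_def w_def scalar_product_commute)
  have uu: "l * b l m u u + m * b l m u w = 0" and uw: "l * b l m u w + m * b l m w w = 0" for l m
    using kernel[OF ux(1)] kernel[OF ux(2)] b_sym by metis+
  obtain f0 f1 f2 f3 where f: "\<And>l m. b l m w w = f0 * l^3 + f1 * l^2 * m + f2 * l * m^2 + f3 * m^3"
    using cubic by blast
  obtain g0 g1 g2 g3 where g: "\<And>l m. b l m u u = g0 * l^3 + g1 * l^2 * m + g2 * l * m^2 + g3 * m^3"
    using cubic by blast
  \<comment> \<open>Eliminating b(u, w) from \<open>uu\<close> and \<open>uw\<close> at l = 1 gives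
    b(u, u) = m^2 b(w, w) for every m. Comparing coefficients leaves only the common linear factor
    f0 l + f1 m.\<close>
  have "poly [:g0, g1, g2 - f0, g3 - f1, - f2, - f3:] m = 0" for m
  proof -
    have "b 1 m u u = m^2 * b 1 m w w"
      using uu[of 1 m] uw[of 1 m] by algebra
    then show ?thesis unfolding f g by (simp add: algebra_simps eval_nat_numeral)
  qed
  then have "[:g0, g1, g2 - f0, g3 - f1, - f2, - f3:] = 0"
    using poly_all_0_iff_0 by blast
  then have coeffs: "g0 = 0" "g1 = 0" "g2 = f0" "g3 = f1" "f2 = 0" "f3 = 0"
    by (auto split: if_splits)
  have f': "b l m w w = l^2 * (f0 * l + f1 * m)" and g': "b l m u u = m^2 * (f0 * l + f1 * m)" for l m
    unfolding f g coeffs by algebra+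
  have C10: "C 1 0 = A" and C01: "C 0 1 = B" by (simp_all add: C_def vec_eq_iff)
  have f0: "f0 = scalar_product w (adjugate A *v w)" and f1: "f1 = scalar_product u (adjugate B *v u)"
    using f'[of 1 0] g'[of 0 1] by (simp_all add: b_def C10 C01)
  \<comment> \<open>\<open>uw\<close> determines this value after division by s; if s = 0 then t is
    nonzero and \<open>uu\<close> shows that it is 0.\<close>
  have h: "b s t u w = - s * t * (f0 * s + f1 * t)"
  proof (cases "s = 0")
    case True
    with nz show ?thesis using uu[of s t] by simp
  next
    case False
    have "s * b s t u w = s * (- s * t * (f0 * s + f1 * t))"
      using uw[of s t] unfolding f' by algebra
    then show ?thesis by (simp only: mult_left_cancel[OF False])
  qed
  have bil_y: "b s t z y = \<alpha> * b s t z u + \<beta> * b s t z w" for z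
    by (simp only: y_def b_lin)
  have "b s t y y = \<alpha>^2 * b s t u u + 2 * \<alpha> * \<beta> * b s t u w + \<beta>^2 * b s t w w"
    using bil_y[of y] bil_y[of u] bil_y[of w] b_sym[of s t y u] b_sym[of s t y w] b_sym[of s t w u] by algebra
  also have "\<dots> = (\<alpha> * t - \<beta> * s) ^ 2 * (s * f0 + t * f1)"
    unfolding f' g' h by algebra
  finally show ?thesis by (simp add: b_def C_def f0 f1)
qed

section \<open>Quadratic forms\<close>

lemma quad_matrix_component: "quad_matrix f $ i $ j = (if i = j then 2 else 1) * mp_coeff f [i, j]"
  by (simp add: quad_matrix_def hessian_def mp_coeff_Nil eval_hessian)

lemma quad_matrix_transpose: "transpose (quad_matrix f) = quad_matrix f"
  by (simp add: quad_matrix_def hessian_def vec_eq_iff transpose_def mp_deriv_commute)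

lemma quad_matrix_linear:
  "quad_matrix (Const a * f + Const b * g) = (\<chi> i j. a * quad_matrix f $ i $ j + b * quad_matrix g $ i $ j)"
  by (simp add: vec_eq_iff quad_matrix_component)

lemma quad_matrix_lin_subst: "quad_matrix (lin_subst N f) = N ** quad_matrix f ** transpose N"
  by (simp add: quad_matrix_def hessian_lin_subst vec_eq_iff matrix_mult_component transpose_apply
      mp_coeff_Nil mp_eval_lin_subst)

lemma Euler_identity:
  fixes f :: "('i::finite, 'a::comm_ring_1) mpoly"
  assumes "form_over d S f"
  shows "(\<Sum>i\<in>UNIV. Var i * mp_deriv i f) = of_nat d * f"
proof -
  let ?f = "\<lambda>m. Poly_Mapping.single m (Poly_Mapping.lookup f m)"
  have single: "Var i * mp_deriv i (Poly_Mapping.single m a)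
    = Poly_Mapping.single m (of_nat (Poly_Mapping.lookup m i) * a)" for i m and a :: 'a
  proof (cases "Poly_Mapping.lookup m i = 0")
    case False
    then have "Poly_Mapping.single i 1 + (m - Poly_Mapping.single i 1) = m"
      by (intro poly_mapping_eqI) (auto simp: lookup_add lookup_minus lookup_single when_def)
    then show ?thesis by (simp add: mp_deriv_single Var_def mult_single)
  qed (simp add: mp_deriv_single)
  have "(\<Sum>i\<in>UNIV. Var i * mp_deriv i (?f m)) = of_nat d * ?f m" if "m \<in> Poly_Mapping.keys f" for m
  proof -
    have "(\<Sum>i\<in>UNIV. Var i * mp_deriv i (?f m))
      = Poly_Mapping.single m (of_nat (\<Sum>i\<in>UNIV. Poly_Mapping.lookup m i) * Poly_Mapping.lookup f m)"
      by (intro poly_mapping_eqI)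
        (simp add: single lookup_sum lookup_single when_def sum_distrib_right)
    also have "\<dots> = of_nat d * ?f m"
      using that assms by (simp add: form_over_def mult_single flip: single_of_nat)
    finally show ?thesis .
  qed
  then have "(\<Sum>m\<in>Poly_Mapping.keys f. \<Sum>i\<in>UNIV. Var i * mp_deriv i (?f m))
    = (\<Sum>m\<in>Poly_Mapping.keys f. of_nat d * ?f m)"
    by (rule sum.cong[OF refl])
  then have "(\<Sum>i\<in>UNIV. Var i * mp_deriv i (sum ?f (Poly_Mapping.keys f))) = of_nat d * sum ?f (Poly_Mapping.keys f)"
    by (subst (asm) sum.swap) (simp add: sum_distrib_left)
  then show ?thesis
    by (simp only: poly_mapping_sum_single[symmetric])
qed

lemma form_over_mp_deriv: "form_over (Suc d) UNIV f \<Longrightarrow> form_over d UNIV (mp_deriv i f)"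
proof (rule form_overI)
  fix m assume f: "form_over (Suc d) UNIV f" and "Poly_Mapping.lookup (mp_deriv i f) m \<noteq> 0"
  then have "m + Poly_Mapping.single i 1 \<in> Poly_Mapping.keys f"
    by (auto simp: lookup_mp_deriv in_keys_iff)
  then have "(\<Sum>j\<in>UNIV. Poly_Mapping.lookup (m + Poly_Mapping.single i 1) j) = Suc d"
    using f unfolding form_over_def by blast
  then show "(\<Sum>j\<in>UNIV. Poly_Mapping.lookup m j) = d \<and> Poly_Mapping.lookup (mp_deriv i f) m \<in> UNIV"
    by (simp add: lookup_add lookup_single when_def sum.distrib)
qed

lemma form_over_0_eval:
  assumes "form_over 0 UNIV f"
  shows "mp_eval f x = mp_coeff f []"
proof -
  have "Poly_Mapping.lookup f m = 0" if "m \<noteq> 0" for m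
  proof (rule ccontr)
    assume "Poly_Mapping.lookup f m \<noteq> 0"
    then have "\<forall>i. Poly_Mapping.lookup m i = 0"
      using assms by (auto simp: form_over_def in_keys_iff)
    with that show False by (auto simp: poly_mapping_eq_iff fun_eq_iff)
  qed
  then have "f = Const (Poly_Mapping.lookup f 0)"
    by (intro poly_mapping_eqI) (auto simp: Const_def lookup_single when_def)
  then have "mp_eval f x = Poly_Mapping.lookup f 0"
    by (metis mp_eval_Const)
  then show ?thesis by (simp add: mp_coeff_def)
qed

text \<open>Euler's identity for Q and for its derivatives. Through it the equations of the curve
  make x isotropic for both matrices in degree 4.\<close>

lemma quad_matrix_scalar_product:
  assumes "form_over 2 S Q"
  shows "scalar_product x (quad_matrix Q *v x) = 2 * mp_eval Q x"
proof -
  have Q: "form_over (Suc (Suc 0)) UNIV Q"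
    using assms by (auto simp: form_over_def numeral_2_eq_2)
  have "(quad_matrix Q *v x) $ i = mp_eval (mp_deriv i Q) x" for i
  proof -
    have "mp_eval (mp_deriv j (mp_deriv i Q)) x = quad_matrix Q $ i $ j" for j
      using form_over_0_eval[OF form_over_mp_deriv[OF form_over_mp_deriv[OF Q]]]
      by (simp add: quad_matrix_def hessian_def mp_deriv_commute)
    then show ?thesis
      using arg_cong[OF Euler_identity[OF form_over_mp_deriv[OF Q, of i]], of "\<lambda>f. mp_eval f x"]
      by (simp add: matrix_vector_mult_def mult.commute)
  qed
  then show ?thesis
    using arg_cong[OF Euler_identity[OF Q], of "\<lambda>f. mp_eval f x"]
    by (simp add: scalar_product_def)
qed

section \<open>The point of the pencil attached to a point of the curve\<close>

section \<open>Degree 4\<close>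

text \<open>The summand with A_ij A_rs carries the factor x A x = 0, and the other leaves -(Ax)_r
  (Ax)_s. Weighting these by the coefficients of the quadric with second-derivative matrix adj B
  gives its value at Ax, which is half of the bilinear expression.\<close>

lemma mp_eval_T4:
  fixes A B :: "'a::field_char_0^4^4"
  assumes sym: "transpose A = A" "transpose B = B" and x: "scalar_product x (A *v x) = 0"
  shows "mp_eval (T4 A B) x = - scalar_product (A *v x) (adjugate B *v (A *v x)) / 2"
proof -
  define u S where u: "u = A *v x" and S_def: "S = adjugate B"
  have A: "A $ i $ j = A $ j $ i" for i j using sym(1) by (metis transpose_apply)
  have "transpose S = S" using sym(2) by (simp add: S_def flip: adjugate_transpose)
  then have S: "S $ i $ j = S $ j $ i" for i j by (metis transpose_apply)
  have col: "(\<Sum>i\<in>UNIV. A $ i $ s * x $ i) = u $ s" for s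
    unfolding u matrix_vector_mult_component by (intro sum.cong refl) (simp only: A[of s])
  have inner: "(\<Sum>i\<in>UNIV. \<Sum>j\<in>UNIV. c * (A $ i $ j * A $ r $ s - A $ i $ s * A $ j $ r) * x $ i * x $ j)
    = - c * u $ r * u $ s" for c r s
  proof -
    have "(\<Sum>i\<in>UNIV. \<Sum>j\<in>UNIV. c * (A $ i $ j * A $ r $ s - A $ i $ s * A $ j $ r) * x $ i * x $ j)
      = (\<Sum>i\<in>UNIV. \<Sum>j\<in>UNIV. c * A $ r $ s * (x $ i * (A $ i $ j * x $ j)))
        - (\<Sum>i\<in>UNIV. \<Sum>j\<in>UNIV. c * ((A $ i $ s * x $ i) * (A $ j $ r * x $ j)))"
      unfolding sum_subtractf[symmetric] by (intro sum.cong refl) algebra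
    also have "(\<Sum>i\<in>UNIV. \<Sum>j\<in>UNIV. c * A $ r $ s * (x $ i * (A $ i $ j * x $ j)))
      = c * A $ r $ s * scalar_product x (A *v x)"
      by (simp add: scalar_product_def matrix_vector_mult_def sum_distrib_left)
    also have "(\<Sum>i\<in>UNIV. \<Sum>j\<in>UNIV. c * ((A $ i $ s * x $ i) * (A $ j $ r * x $ j)))
      = c * ((\<Sum>i\<in>UNIV. A $ i $ s * x $ i) * (\<Sum>j\<in>UNIV. A $ j $ r * x $ j))"
      by (subst sum_product) (simp only: sum_distrib_left)
    finally show ?thesis
      unfolding x col by simp
  qed
  have "mp_eval (T4 A B) x = (\<Sum>i\<in>UNIV. \<Sum>j\<in>UNIV. \<Sum>q\<in>index_pairs4. matrix_coeff S (fst q) (snd q)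
      * (A $ i $ j * A $ fst q $ snd q - A $ i $ snd q * A $ j $ fst q) * x $ i * x $ j)"
    by (simp add: T4_def S_def split_beta)
  also have "\<dots> = (\<Sum>i\<in>UNIV. \<Sum>q\<in>index_pairs4. \<Sum>j\<in>UNIV. matrix_coeff S (fst q) (snd q)
      * (A $ i $ j * A $ fst q $ snd q - A $ i $ snd q * A $ j $ fst q) * x $ i * x $ j)"
    by (rule sum.cong[OF refl], rule sum.swap)
  also have "\<dots> = (\<Sum>q\<in>index_pairs4. \<Sum>i\<in>UNIV. \<Sum>j\<in>UNIV. matrix_coeff S (fst q) (snd q)
      * (A $ i $ j * A $ fst q $ snd q - A $ i $ snd q * A $ j $ fst q) * x $ i * x $ j)"
    by (rule sum.swap)
  also have "\<dots> = (\<Sum>q\<in>index_pairs4. - matrix_coeff S (fst q) (snd q) * u $ fst q * u $ snd q)"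
    by (simp only: inner)
  also have "\<dots> = - scalar_product u (S *v u) / 2"
    by (simp add: index_pairs4_def matrix_coeff_def scalar_product_def matrix_vector_mult_component sum_4
        S[of 2 1] S[of 3 1] S[of 4 1] S[of 3 2] S[of 4 2] S[of 4 3] field_simps)
  finally show ?thesis unfolding u S_def .
qed

lemma mp_eval_at_T4:
  "mp_eval (at_T4 (Q1, Q2) f) x = mp_eval f (\<chi> i. if i = 1 then mp_eval (T4 (quad_matrix Q1) (quad_matrix Q2)) x
     else - mp_eval (T4 (quad_matrix Q2) (quad_matrix Q1)) x)"
proof -
  let ?s = "\<lambda>i. if i = 1 then T4 (quad_matrix Q1) (quad_matrix Q2) else - T4 (quad_matrix Q2) (quad_matrix Q1)"
  interpret at_T4: ring_hom_fun "mp_insert Const ?s"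
    by (rule ring_hom_fun.ring_hom_mp_insert[OF ring_hom_Const])
  have "mp_eval (mp_insert Const ?s f) x = mp_eval f (\<chi> i. mp_eval (?s i) x)"
    by (rule mpoly_hom_eqI[where f = f]; (unfold_locales)?)
      (simp_all add: ring_hom_fun.mp_insert_Const[OF ring_hom_Const] ring_hom_fun.mp_insert_Var[OF ring_hom_Const])
  moreover have "(\<chi> i::2. mp_eval (?s i) x)
    = (\<chi> i::2. if i = 1 then mp_eval (T4 (quad_matrix Q1) (quad_matrix Q2)) x
        else - mp_eval (T4 (quad_matrix Q2) (quad_matrix Q1)) x)"
    by (simp add: vec_eq_iff)
  ultimately show ?thesis
    by (simp only: at_T4_def Let_def prod.case)
qed

text \<open>The point (T1, -T2) at which the forms of the resolvent are evaluated; through it degree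
  4 is reduced to binary forms.\<close>

definition pencil_point :: "'a::field_char_0 model4 \<Rightarrow> 'a^4 \<Rightarrow> 'a^2" where
  "pencil_point = (\<lambda>(Q1, Q2) x. \<chi> i. if i = 1 then mp_eval (T4 (quad_matrix Q1) (quad_matrix Q2)) x
     else - mp_eval (T4 (quad_matrix Q2) (quad_matrix Q1)) x)"

lemma mp_eval_F4: "mp_eval (F4 \<Phi>) x = mp_eval (F2 (resolvent4 \<Phi>)) (pencil_point \<Phi> x)"
  and mp_eval_G4: "mp_eval (G4 \<Phi>) x = mp_eval (G2 (resolvent4 \<Phi>)) (pencil_point \<Phi> x)"
  by (cases \<Phi>; simp add: F4_def G4_def mp_eval_at_T4 pencil_point_def)+

text \<open>Up to a scalar the point transforms under M as P does under N.
  \<open>adjugate_pencil\<close>, with one row of M as \<alpha>, \<beta> and the other as s, t,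
  yields det M^2 times a linear form in f0, f1; conjugation by N yields det N^2.\<close>

lemma pencil_point_act4:
  assumes Q: "form_over 2 S Q1" "form_over 2 S Q2" and x: "x = transpose N *v x'"
    and on: "mp_eval Q1 x = 0" "mp_eval Q2 x = 0" and M: "det M \<noteq> 0"
  shows "transpose M *v pencil_point (act4 (M, N) (Q1, Q2)) x' = (det M ^ 3 * det N ^ 2) *s pencil_point (Q1, Q2) x"
proof -
  define A B where AB: "A = quad_matrix Q1" "B = quad_matrix Q2"
  define C where "C i = (\<chi> k l. M $ i $ 1 * A $ k $ l + M $ i $ 2 * B $ k $ l)" for i
  have sym: "transpose A = A" "transpose B = B" by (simp_all add: AB quad_matrix_transpose)
  have zero: "scalar_product x (A *v x) = 0" "scalar_product x (B *v x) = 0"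
    using quad_matrix_scalar_product[OF Q(1)] quad_matrix_scalar_product[OF Q(2)] on by (simp_all add: AB)
  have C: "quad_matrix (lin_subst N (Const (M $ i $ 1) * Q1 + Const (M $ i $ 2) * Q2)) = N ** C i ** transpose N" for i
    unfolding quad_matrix_lin_subst quad_matrix_linear C_def AB ..
  have Csym: "transpose (N ** C i ** transpose N) = N ** C i ** transpose N" for i
    unfolding C[symmetric] by (rule quad_matrix_transpose)
  have Cx: "C i *v x = M $ i $ 1 *s (A *v x) + M $ i $ 2 *s (B *v x)" for i
    by (simp add: vec_eq_iff C_def matrix_vector_mult_def sum_distrib_left sum.distrib algebra_simps)
  have Nx: "(N ** C i ** transpose N) *v x' = N *v (C i *v x)" for i
    unfolding x matrix_vector_mul_assoc matrix_mul_assoc ..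
  have zero': "scalar_product x' ((N ** C i ** transpose N) *v x') = 0" for i
    unfolding Nx scalar_product_mult_vec[of x' N] x[symmetric] unfolding Cx by (simp add: zero)
  define f0 f1 where f: "f0 = scalar_product (B *v x) (adjugate A *v (B *v x))"
    "f1 = scalar_product (A *v x) (adjugate B *v (A *v x))"
  have T: "mp_eval (T4 A B) x = - f1 / 2" "mp_eval (T4 B A) x = - f0 / 2"
    by (simp_all add: mp_eval_T4 sym zero f)
  have row_nz: "M $ i $ 1 \<noteq> 0 \<or> M $ i $ 2 \<noteq> 0" for i
    using M exhaust_2[of i] by (auto simp: det_2)
  have T': "mp_eval (T4 (N ** C i ** transpose N) (N ** C j ** transpose N)) x'
    = - (det N ^ 2 * ((M $ i $ 1 * M $ j $ 2 - M $ i $ 2 * M $ j $ 1) ^ 2 * (M $ j $ 1 * f0 + M $ j $ 2 * f1))) / 2" for i j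
    unfolding mp_eval_T4[OF Csym Csym zero'] Nx adjugate_quadratic_conj
    unfolding Cx unfolding C_def adjugate_pencil[OF sym zero row_nz] f by simp
  have act: "pencil_point (act4 (M, N) (Q1, Q2)) x' $ 1 = - (det N ^ 2 * (det M ^ 2 * (M $ 2 $ 1 * f0 + M $ 2 $ 2 * f1))) / 2"
    "pencil_point (act4 (M, N) (Q1, Q2)) x' $ 2 = det N ^ 2 * (det M ^ 2 * (M $ 1 $ 1 * f0 + M $ 1 $ 2 * f1)) / 2"
  proof -
    have sq: "(M $ 1 $ 1 * M $ 2 $ 2 - M $ 1 $ 2 * M $ 2 $ 1) ^ 2 = det M ^ 2"
      "(M $ 2 $ 1 * M $ 1 $ 2 - M $ 2 $ 2 * M $ 1 $ 1) ^ 2 = det M ^ 2"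
      unfolding det_2 by algebra+
    have "pencil_point (act4 (M, N) (Q1, Q2)) x' $ 1 = mp_eval (T4 (N ** C 1 ** transpose N) (N ** C 2 ** transpose N)) x'"
      "pencil_point (act4 (M, N) (Q1, Q2)) x' $ 2 = - mp_eval (T4 (N ** C 2 ** transpose N) (N ** C 1 ** transpose N)) x'"
      unfolding pencil_point_def act4_def prod.case C by simp_all
    then show "pencil_point (act4 (M, N) (Q1, Q2)) x' $ 1 = - (det N ^ 2 * (det M ^ 2 * (M $ 2 $ 1 * f0 + M $ 2 $ 2 * f1))) / 2"
      "pencil_point (act4 (M, N) (Q1, Q2)) x' $ 2 = det N ^ 2 * (det M ^ 2 * (M $ 1 $ 1 * f0 + M $ 1 $ 2 * f1)) / 2"
      unfolding T' sq by simp_all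
  qed
  have pt: "pencil_point (Q1, Q2) x $ 1 = - f1 / 2" "pencil_point (Q1, Q2) x $ 2 = f0 / 2"
    by (simp_all add: pencil_point_def T AB[symmetric])
  \<comment> \<open>The sign in (T1, -T2) makes these combinations 2 by 2 minors of M, which supply
    the third factor det M.\<close>
  have "M $ 1 $ j * (- (det N ^ 2 * (det M ^ 2 * (M $ 2 $ 1 * f0 + M $ 2 $ 2 * f1))) / 2)
      + M $ 2 $ j * (det N ^ 2 * (det M ^ 2 * (M $ 1 $ 1 * f0 + M $ 1 $ 2 * f1)) / 2)
    = (det M ^ 3 * det N ^ 2) * (if j = 1 then - f1 / 2 else f0 / 2)" for j
    using exhaust_2[of j] by (auto simp: det_2 field_simps eval_nat_numeral)
  then have "(transpose M *v pencil_point (act4 (M, N) (Q1, Q2)) x') $ j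
    = (det M ^ 3 * det N ^ 2) * (if j = 1 then - f1 / 2 else f0 / 2)" for j
    by (simp only: matrix_vector_mult_component sum_2 transpose_apply act)
  moreover have "((det M ^ 3 * det N ^ 2) *s pencil_point (Q1, Q2) x) $ j
    = (det M ^ 3 * det N ^ 2) * (if j = 1 then - f1 / 2 else f0 / 2)" for j
    using exhaust_2[of j] by (auto simp: pt)
  ultimately show ?thesis by (simp only: vec_eq_iff simp_thms)
qed

section \<open>The resolvent of a pencil of quadrics and its integrality\<close>

lemma mp_coeff_pencil:
  "mp_coeff (pencil (Q1, Q2)) is = Const (mp_coeff Q1 is) * Var 1 + Const (mp_coeff Q2 is) * Var 2"
proof -
  have map: "mp_coeff (Poly_Mapping.map Const Q) is = Const (mp_coeff Q is)" for Q :: "(4, 'a) mpoly"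
    by (auto simp: mp_coeff_def map.rep_eq when_def)
  show ?thesis
    unfolding pencil_def prod.case mp_coeff_add mp_coeff_Const_mult map by (simp only: mult.commute)
qed

lemma quad_matrix_pencil:
  "quad_matrix (pencil (Q1, Q2)) $ i $ j = Const (quad_matrix Q1 $ i $ j) * Var 1 + Const (quad_matrix Q2 $ i $ j) * Var 2"
  by (simp add: quad_matrix_component mp_coeff_pencil distrib_left mult.assoc)

lemma Const_quarter: "Const (1 / 4) * (4 * f) = (f :: ('i, 'a::field_char_0) mpoly)"
proof -
  have "Const (1 / 4) * (4 * f) = Const (1 / 4) * Const 4 * f"
    by (simp add: mult.assoc)
  also have "\<dots> = Const (1 / 4 * 4) * f"
    by (simp only: Const.hom_mult)
  finally show ?thesis by simp
qed

text \<open>The two squares of pf cancel, leaving the determinant form of the pencil, for which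
  exact covariance is visible although pf and rd separately lack it.\<close>

lemma F2_resolvent4: "F2 (resolvent4 \<Phi>) = det (quad_matrix (pencil \<Phi>))"
  unfolding F2_def resolvent4_def rd_def prod.case mult.left_commute[of 4] Const_quarter by simp

text \<open>M recombines the quadrics, which is a substitution in the pencil variables; N conjugates
  the matrix of the pencil.\<close>

lemma F2_resolvent4_act4:
  "F2 (resolvent4 (act4 (M, N) \<Phi>)) = Const (det N ^ 2) * lin_subst M (F2 (resolvent4 \<Phi>))"
proof (cases \<Phi>)
  case (Pair Q1 Q2)
  define X where "X r = (\<chi> i j. M $ r $ 1 * quad_matrix Q1 $ i $ j + M $ r $ 2 * quad_matrix Q2 $ i $ j)" for r
  have X: "quad_matrix (lin_subst N (Const (M $ r $ 1) * Q1 + Const (M $ r $ 2) * Q2)) = N ** X r ** transpose N" for r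
    unfolding quad_matrix_lin_subst quad_matrix_linear X_def ..
  have subst: "lin_subst M (quad_matrix (pencil (Q1, Q2)) $ i $ j) = Const (X 1 $ i $ j) * Var 1 + Const (X 2 $ i $ j) * Var 2" for i j
    by (simp add: quad_matrix_pencil sum_2 X_def algebra_simps)
  have conj: "Const ((N ** Y ** transpose N) $ i $ j) * V = (\<Sum>k\<in>UNIV. (\<Sum>l\<in>UNIV. Const (N $ i $ l) *
      (Const (Y $ l $ k) * V)) * Const (N $ j $ k))" for Y i j and V :: "(2, 'a) mpoly"
    by (simp add: matrix_mult_component transpose_apply sum_distrib_left sum_distrib_right mult_ac)
  have entry: "quad_matrix (pencil (act4 (M, N) (Q1, Q2))) $ i $ j
    = Const ((N ** X 1 ** transpose N) $ i $ j) * Var 1 + Const ((N ** X 2 ** transpose N) $ i $ j) * Var 2" for i j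
    unfolding act4_def prod.case quad_matrix_pencil X ..
  have "quad_matrix (pencil (act4 (M, N) (Q1, Q2)))
    = (\<chi> i j. Const (N $ i $ j)) ** (\<chi> i j. lin_subst M (quad_matrix (pencil (Q1, Q2)) $ i $ j))
      ** transpose (\<chi> i j. Const (N $ i $ j))"
    unfolding vec_eq_iff entry conj
    unfolding matrix_mult_component transpose_apply vec_lambda_beta subst
    by (simp only: distrib_left distrib_right sum.distrib simp_thms)
  then show ?thesis
    unfolding F2_resolvent4 Pair
    by (simp only: det_mul det_transpose Const.hom_det[symmetric] lin_subst.hom_det[symmetric])
      (simp add: power2_eq_square mult_ac)
qed

lemma mp_coeff_pf_pencil:
  fixes Q1 Q2 :: "(4, 'a::field_char_0) mpoly"
  shows "mp_coeff (pf (pencil (Q1, Q2))) [1,1] = pf Q1" "mp_coeff (pf (pencil (Q1, Q2))) [2,2] = pf Q2"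
proof -
  have "mp_eval (mp_deriv 1 (mp_deriv 1 (pf (pencil (Q1, Q2))))) 0 = 2 * pf Q1"
    "mp_eval (mp_deriv 2 (mp_deriv 2 (pf (pencil (Q1, Q2))))) 0 = 2 * pf Q2"
    by (simp_all add: pf_def mp_coeff_pencil algebra_simps)
  then show "mp_coeff (pf (pencil (Q1, Q2))) [1,1] = pf Q1" "mp_coeff (pf (pencil (Q1, Q2))) [2,2] = pf Q2"
    unfolding eval_hessian by simp_all
qed

lemma pf_pencil_lin_subst:
  "lin_subst M (pf (pencil (Q1, Q2)))
    = pf (pencil (Const (M $ 1 $ 1) * Q1 + Const (M $ 1 $ 2) * Q2, Const (M $ 2 $ 1) * Q1 + Const (M $ 2 $ 2) * Q2))"
proof -
  have "lin_subst M (mp_coeff (pencil (Q1, Q2)) is) = mp_coeff (pencil (Const (M $ 1 $ 1) * Q1 + Const (M $ 1 $ 2) * Q2,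
      Const (M $ 2 $ 1) * Q1 + Const (M $ 2 $ 2) * Q2)) is" for "is"
    unfolding mp_coeff_pencil mp_coeff_add mp_coeff_Const_mult by (simp add: sum_2 algebra_simps)
  then show ?thesis by (simp add: pf_def)
qed

text \<open>The middle coefficient of p^2 is m^2 + 2ln. Since F2 of the resolvent is covariant, only
  the product of the outer coefficients of p, pf(Q1) pf(Q2), remains to be followed, and modulo 2
  suffices because of the factor 6.\<close>

lemma b2_2_eq:
  fixes p q :: "(2, 'a::field_char_0) mpoly"
  assumes p: "form_over 2 S p"
  shows "b2_2 (p, q) = mp_coeff (F2 (p, q)) [1,1,2,2] - 6 * mp_coeff p [1,1] * mp_coeff p [2,2]"
proof -
  define l m n where lmn: "l = mp_coeff p [1,1]" "m = mp_coeff p [1,2]" "n = mp_coeff p [2,2]"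
  have p_eq: "p = Const l * Var 1 ^ 2 + Const m * Var 1 * Var 2 + Const n * Var 2 ^ 2"
    unfolding lmn by (rule binary_quadratic_eq[OF p])
  have "4 * mp_coeff (p^2) [1,1,2,2] = 4 * (m^2 + 2 * l * n)"
    unfolding mp_coeff_1122 p_eq by (simp add: power2_eq_square algebra_simps)
  then have pp: "mp_coeff (p^2) [1,1,2,2] = m^2 + 2 * l * n" by (metis mult_left_cancel zero_neq_numeral)
  have 4: "4 * q = Const 4 * q" by simp
  show ?thesis
    unfolding b2_2_def F2_def prod.case lmn[symmetric] 4 mp_coeff_add mp_coeff_Const_mult pp by algebra
qed

text \<open>Modulo 2 such a matrix is alternating with Pfaffian bg + cf + de, so its determinant is
  the square of that. The expansion shows that the difference is even divisible by 4.\<close>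

lemma det_sym_4:
  fixes a1 a2 a3 a4 b c d e f g :: "'a::comm_ring_1" and A :: "'a^4^4"
  assumes "A $ 1 $ 1 = 2 * a1" "A $ 2 $ 2 = 2 * a2" "A $ 3 $ 3 = 2 * a3" "A $ 4 $ 4 = 2 * a4"
    "A $ 1 $ 2 = b" "A $ 2 $ 1 = b" "A $ 1 $ 3 = c" "A $ 3 $ 1 = c" "A $ 1 $ 4 = d" "A $ 4 $ 1 = d"
    "A $ 2 $ 3 = e" "A $ 3 $ 2 = e" "A $ 2 $ 4 = f" "A $ 4 $ 2 = f" "A $ 3 $ 4 = g" "A $ 4 $ 3 = g"
  shows "det A = (b * g + c * f + d * e)\<^sup>2 + 4 * (4 * (a1 * a2 * a3 * a4)
    - (a1 * a2 * g\<^sup>2 + a1 * a3 * f\<^sup>2 + a1 * a4 * e\<^sup>2 + a2 * a3 * d\<^sup>2 + a2 * a4 * c\<^sup>2 + a3 * a4 * b\<^sup>2)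
    + (a1 * e * g * f + a2 * c * g * d + a3 * b * f * d + a4 * b * e * c)
    - (b * g * c * f + b * g * d * e + c * f * d * e))"
  unfolding det_4 assms by (simp add: power2_eq_square algebra_simps)

context valuation_ring
begin

lemma model4_coeff:
  assumes "model4_over R (Q1, Q2)"
  shows "form_over 1 R (mp_coeff (pencil (Q1, Q2)) is)"
  using assms unfolding mp_coeff_pencil
  by (intro form_over_add form_over_Const_mult form_over_Var subring_set_R)
    (auto simp: model4_over_def intro: form_over_coeff[OF subring_set_R])

lemma form_over_pf_pencil:
  assumes "model4_over R (Q1, Q2)"
  shows "form_over 2 R (pf (pencil (Q1, Q2)))"
proof -
  note c = model4_coeff[OF assms]
  have "form_over (1 + 1) R (pf (pencil (Q1, Q2)))"
    unfolding pf_def by (intro form_over_add form_over_mult subring_set_R c)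
  then show ?thesis by (simp add: numeral_2_eq_2)
qed

text \<open>The division by 4 in \<open>rd\<close> is exact: \<open>?w\<close> is the quotient from
  \<open>det_sym_4\<close>, an integer polynomial of degree 4 in the coefficients of the pencil,
  which are linear forms.\<close>

lemma form_over_rd_pencil:
  assumes "model4_over R (Q1, Q2)"
  shows "form_over 4 R (rd (pencil (Q1, Q2)))"
proof -
  let ?c = "\<lambda>i j. mp_coeff (pencil (Q1, Q2)) [i, j]"
  let ?w = "Const 4 * (?c 1 1 * ?c 2 2 * ?c 3 3 * ?c 4 4)
    - (?c 1 1 * ?c 2 2 * (?c 3 4)\<^sup>2 + ?c 1 1 * ?c 3 3 * (?c 2 4)\<^sup>2 + ?c 1 1 * ?c 4 4 * (?c 2 3)\<^sup>2
      + ?c 2 2 * ?c 3 3 * (?c 1 4)\<^sup>2 + ?c 2 2 * ?c 4 4 * (?c 1 3)\<^sup>2 + ?c 3 3 * ?c 4 4 * (?c 1 2)\<^sup>2)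
    + (?c 1 1 * ?c 2 3 * ?c 3 4 * ?c 2 4 + ?c 2 2 * ?c 1 3 * ?c 3 4 * ?c 1 4
      + ?c 3 3 * ?c 1 2 * ?c 2 4 * ?c 1 4 + ?c 4 4 * ?c 1 2 * ?c 2 3 * ?c 1 3)
    - (?c 1 2 * ?c 3 4 * ?c 1 3 * ?c 2 4 + ?c 1 2 * ?c 3 4 * ?c 1 4 * ?c 2 3 + ?c 1 3 * ?c 2 4 * ?c 1 4 * ?c 2 3)"
  note c = model4_coeff[OF assms]
  have 4: "1 + 1 + 1 + 1 = (4 :: nat)" by simp
  have quartic: "form_over 4 R (?c i j * ?c k l * ?c i' j' * ?c k' l')" for i j k l i' j' k' l'
    unfolding 4[symmetric] by (intro form_over_mult subring_set_R c)
  have quartic2: "form_over 4 R (?c i j * ?c k l * (?c i' j')\<^sup>2)" for i j k l i' j'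
    using quartic[of i j k l i' j' i' j'] by (simp add: power2_eq_square mult.assoc)
  have sym: "mp_coeff f [i, j] = mp_coeff f [j, i]" for f :: "(4, (2, 'a) mpoly) mpoly" and i j
    by (simp add: mp_coeff_def add.commute)
  have "det (quad_matrix (pencil (Q1, Q2))) = (pf (pencil (Q1, Q2)))\<^sup>2 + 4 * ?w"
    unfolding pf_def Const.hom_numeral
    by (rule det_sym_4) (simp_all add: quad_matrix_component sym)
  then have "rd (pencil (Q1, Q2)) = ?w"
    by (simp only: rd_def add_diff_cancel_left' Const_quarter)
  moreover have "form_over 4 R ?w"
    by (intro form_over_add form_over_diff form_over_Const_mult subring_set_R quartic quartic2 R_numeral)
  ultimately show ?thesis by simp
qed

end

text \<open>pf runs over the three splittings of four indices into pairs, so it is symmetric in the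
  indices and one computation covers all transvections.\<close>

lemma pf_eq:
  fixes Q :: "(4, 'a::comm_ring_1) mpoly"
  assumes "i \<noteq> j" "i \<noteq> k" "i \<noteq> l" "j \<noteq> k" "j \<noteq> l" "k \<noteq> l"
  shows "pf Q = quad_matrix Q $ i $ j * quad_matrix Q $ k $ l + quad_matrix Q $ i $ k * quad_matrix Q $ j $ l
    + quad_matrix Q $ i $ l * quad_matrix Q $ j $ k"
proof -
  define c where "c i j = mp_coeff Q [i, j]" for i j
  have c: "quad_matrix Q $ a $ b = c a b" if "a \<noteq> b" for a b
    using that by (simp add: quad_matrix_component c_def)
  have sym: "c 2 1 = c 1 2" "c 3 1 = c 1 3" "c 4 1 = c 1 4" "c 3 2 = c 2 3" "c 4 2 = c 2 4" "c 4 3 = c 3 4"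
    by (simp_all add: c_def mp_coeff_def add.commute)
  have pf: "pf Q = c 1 2 * c 3 4 + c 1 3 * c 2 4 + c 1 4 * c 2 3"
    by (simp add: pf_def c_def)
  have ij: "i = 1 \<or> i = 2 \<or> i = 3 \<or> i = 4" "j = 1 \<or> j = 2 \<or> j = 3 \<or> j = 4"
    "k = 1 \<or> k = 2 \<or> k = 3 \<or> k = 4" "l = 1 \<or> l = 2 \<or> l = 3 \<or> l = 4"
    using exhaust_4 by auto
  show ?thesis
    unfolding pf c[OF assms(1)] c[OF assms(2)] c[OF assms(3)] c[OF assms(4)] c[OF assms(5)] c[OF assms(6)]
    using ij(1)
  proof (elim disjE)
    assume "i = 1"
    with assms ij(2-4) show "c 1 2 * c 3 4 + c 1 3 * c 2 4 + c 1 4 * c 2 3 = c i j * c k l + c i k * c j l + c i l * c j k"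
      by (elim disjE) (simp_all add: sym add_ac mult_ac)
  next
    assume "i = 2"
    with assms ij(2-4) show "c 1 2 * c 3 4 + c 1 3 * c 2 4 + c 1 4 * c 2 3 = c i j * c k l + c i k * c j l + c i l * c j k"
      by (elim disjE) (simp_all add: sym add_ac mult_ac)
  next
    assume "i = 3"
    with assms ij(2-4) show "c 1 2 * c 3 4 + c 1 3 * c 2 4 + c 1 4 * c 2 3 = c i j * c k l + c i k * c j l + c i l * c j k"
      by (elim disjE) (simp_all add: sym add_ac mult_ac)
  next
    assume "i = 4"
    with assms ij(2-4) show "c 1 2 * c 3 4 + c 1 3 * c 2 4 + c 1 4 * c 2 3 = c i j * c k l + c i k * c j l + c i l * c j k"
      by (elim disjE) (simp_all add: sym add_ac mult_ac)
  qed
qed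

text \<open>Each of the three products contains every index once.\<close>

lemma pf_diagonal:
  assumes "diagonal_matrix N"
  shows "pf (lin_subst N Q) = det N * pf Q"
proof -
  have det: "det N = N $ 1 $ 1 * N $ 2 $ 2 * N $ 3 $ 3 * N $ 4 $ 4"
    using assms by (simp add: det_4 diagonal_matrix_def)
  have scale: "mp_eval (mp_deriv i (mp_deriv j (lin_subst N Q))) 0 = N $ i $ i * N $ j $ j * mp_eval (mp_deriv i (mp_deriv j Q)) 0" for i j
    by (simp add: mp_deriv_lin_subst_diagonal[OF assms] mp_eval_lin_subst)
  have "mp_coeff (lin_subst N Q) [i, j] = N $ i $ i * N $ j $ j * mp_coeff Q [i, j]" if "i \<noteq> j" for i j
    using scale[of i j] that by (simp add: eval_hessian)
  then show ?thesis by (simp add: pf_def det algebra_simps)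
qed

lemma transpose_transvection: "transpose (transvection i j t) = transvection j i t"
  by (auto simp: transvection_def transpose_def vec_eq_iff)

lemma mp_eval_form_scale:
  assumes "form_over d S f"
  shows "mp_eval f (s *s x) = s ^ d * mp_eval f x"
proof -
  have "(\<Prod>i\<in>UNIV. (s * x $ i) ^ Poly_Mapping.lookup m i) = s ^ d * (\<Prod>i\<in>UNIV. x $ i ^ Poly_Mapping.lookup m i)"
    if "m \<in> Poly_Mapping.keys f" for m
  proof -
    have "(\<Sum>i\<in>UNIV. Poly_Mapping.lookup m i) = d" using assms that by (simp add: form_over_def)
    then show ?thesis by (auto simp: power_mult_distrib prod.distrib simp flip: power_sum)
  qed
  then show ?thesis
    by (simp add: mp_eval_def mp_insert_def sum_distrib_left mult.left_commute)
qed

lemma form_over_F2: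
  assumes p: "form_over 2 UNIV p" and q: "form_over 4 UNIV q"
  shows "form_over 4 UNIV (F2 (p, q))"
proof -
  have "form_over 4 UNIV (p\<^sup>2)" "form_over 4 UNIV (Const 4 * q)"
    using form_over_power[OF subring_set_UNIV p, of 2] form_over_Const_mult[OF subring_set_UNIV UNIV_I q, of 4]
    by simp_all
  then show ?thesis
    using form_over_add[OF subring_set_UNIV] by (fastforce simp: F2_def)
qed

lemma form_over_det_hessian:
  fixes f :: "(2, 'a::comm_ring_1) mpoly"
  assumes "form_over 4 UNIV f"
  shows "form_over 4 UNIV (det (hessian f))"
proof -
  have "form_over (Suc (Suc 2)) UNIV f" using assms by simp
  then have "form_over 2 UNIV (hessian f $ i $ j)" for i j
    by (simp add: hessian_def form_over_mp_deriv)
  then have "form_over (2 + 2) UNIV (det (hessian f))"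
    unfolding det_2 by (intro form_over_diff form_over_mult subring_set_UNIV)
  then show ?thesis by simp
qed

section \<open>The Pfaffian modulo 2 and b2 of the resolvent\<close>

context valuation_ring
begin

lemma pf_R:
  assumes "form_over 2 R Q"
  shows "pf Q \<in> R"
  unfolding pf_def by (intro R_add R_mult form_over_coeff[OF subring_set_R assms])

text \<open>Modulo 2 the second-derivative matrix is alternating and pf is its Pfaffian, which
  conjugation by N multiplies by det N.\<close>

lemma pf_lin_subst:
  assumes N: "\<And>i j. N $ i $ j \<in> R" and Q: "form_over 2 R Q"
  shows "\<exists>\<rho>\<in>R. pf (lin_subst N Q) = det N * pf Q + 2 * \<rho>"
proof -
  define P where "P N \<longleftrightarrow> (\<forall>Q. form_over 2 R Q
    \<longrightarrow> (\<exists>\<rho>\<in>R. pf (lin_subst N Q) = det N * pf Q + 2 * \<rho>))" for N :: "'a^4^4"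
  have "P N"
  proof (rule matrix_induct[where P = P, OF N])
    fix D :: "'a^4^4"
    assume "diagonal_matrix D"
    then show "P D" by (auto simp: P_def pf_diagonal intro!: bexI[of _ 0])
  next
    fix i j :: 4 and t
    assume ij: "i \<noteq> j" and t: "t \<in> R"
    have fresh: "card X < CARD(4) \<Longrightarrow> \<exists>k. k \<notin> X" for X :: "4 set"
      by (metis UNIV_eq_I less_irrefl)
    from fresh[of "{i, j}"] obtain k where k: "k \<noteq> i" "k \<noteq> j"
      using card_length[of "[i, j]"] by auto
    from fresh[of "{i, j, k}"] obtain l where l: "l \<noteq> i" "l \<noteq> j" "l \<noteq> k"
      using card_length[of "[i, j, k]"] by auto
    note distinct = ij k[symmetric] l[symmetric]
    show "P (transvection i j t)"
      unfolding P_def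
    proof (intro allI impI)
      fix Q :: "(4, 'a) mpoly"
      assume Q: "form_over 2 R Q"
      define A where "A = quad_matrix Q"
      \<comment> \<open>The transvection adds t A_jj A_kl + 2 t A_jk A_jl to pf, and A_jj is twice a
        coefficient of Q.\<close>
      let ?\<rho> = "t * (mp_coeff Q [j,j] * mp_coeff Q [k,l] + mp_coeff Q [j,k] * mp_coeff Q [j,l])"
      have A: "A $ j $ j = 2 * mp_coeff Q [j,j]" "A $ k $ l = mp_coeff Q [k,l]"
        "A $ j $ k = mp_coeff Q [j,k]" "A $ j $ l = mp_coeff Q [j,l]"
        using distinct by (simp_all add: A_def quad_matrix_component)
      have entry: "quad_matrix (lin_subst (transvection i j t) Q) $ a $ b
        = A $ a $ b + (if a = i then t * A $ j $ b else 0)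
          + (if b = i then (A $ a $ j + (if a = i then t * A $ j $ j else 0)) * t else 0)" for a b
        unfolding quad_matrix_lin_subst transpose_transvection times_transvection transvection_times A_def ..
      have "pf (lin_subst (transvection i j t) Q) = (A $ i $ j + t * A $ j $ j) * A $ k $ l
        + (A $ i $ k + t * A $ j $ k) * A $ j $ l + (A $ i $ l + t * A $ j $ l) * A $ j $ k"
        using distinct by (subst pf_eq[of i j k l]) (simp_all add: entry)
      also have "\<dots> = pf Q + 2 * ?\<rho>"
        unfolding pf_eq[OF distinct(1,2,4,3,5,6), of Q] A_def[symmetric] A by algebra
      finally have "pf (lin_subst (transvection i j t) Q) = det (transvection i j t) * pf Q + 2 * ?\<rho>"
        by (simp add: det_transvection[OF ij])
      moreover have "?\<rho> \<in> R"
        by (intro R_add R_mult t form_over_coeff[OF subring_set_R Q])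
      ultimately show "\<exists>\<rho>\<in>R. pf (lin_subst (transvection i j t) Q)
        = det (transvection i j t) * pf Q + 2 * \<rho>" by blast
    qed
  next
    fix A B :: "'a^4^4"
    assume R: "\<And>i j. A $ i $ j \<in> R" "\<And>i j. B $ i $ j \<in> R" and P: "P A" "P B"
    show "P (A ** B)"
      unfolding P_def
    proof (intro allI impI)
      fix Q :: "(4, 'a) mpoly"
      assume Q: "form_over 2 R Q"
      obtain \<rho> where \<rho>: "\<rho> \<in> R" "pf (lin_subst B Q) = det B * pf Q + 2 * \<rho>"
        using P(2) Q unfolding P_def by blast
      obtain \<sigma> where \<sigma>: "\<sigma> \<in> R" "pf (lin_subst A (lin_subst B Q)) = det A * pf (lin_subst B Q) + 2 * \<sigma>"
        using P(1) form_over_lin_subst[OF subring_set_R R(2) Q] unfolding P_def by blast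
      have "pf (lin_subst (A ** B) Q) = det (A ** B) * pf Q + 2 * (det A * \<rho> + \<sigma>)"
        unfolding lin_subst_mult \<sigma> \<rho> det_mul by algebra
      moreover have "det A * \<rho> + \<sigma> \<in> R" using R_det[OF R(1)] \<rho> \<sigma> by auto
      ultimately show "\<exists>\<rho>\<in>R. pf (lin_subst (A ** B) Q) = det (A ** B) * pf Q + 2 * \<rho>"
        by blast
    qed
  qed
  with Q show ?thesis by (auto simp: P_def)
qed

lemma resolvent4_forms:
  assumes "model4_over R \<Phi>"
  obtains p q where "resolvent4 \<Phi> = (p, q)" "p = pf (pencil \<Phi>)" "form_over 2 R p" "form_over 4 R q"
  using assms form_over_pf_pencil form_over_rd_pencil by (cases \<Phi>) (auto simp: resolvent4_def)

lemma form_over_UNIV: "form_over d R f \<Longrightarrow> form_over d UNIV f"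
  by (auto simp: form_over_def)

text \<open>The action is split: M is a substitution in the resolvent, covered by degree 2. Then N
  multiplies the middle coefficient of F2 by det N^2 and each pf by det N up to 2 \<rho>, so the
  error is a multiple of 6 times 2.\<close>

lemma b2_2_resolvent4:
  assumes \<Phi>: "model4_over R \<Phi>" and \<Phi>': "model4_over R (act4 (M, N) \<Phi>)"
    and g: "(M, N) \<in> G4_over R \<or> diagonal4 (M, N)"
  shows "\<exists>\<rho>\<in>R. b2_2 (resolvent4 (act4 (M, N) \<Phi>)) = (det M * det N) ^ 2 * b2_2 (resolvent4 \<Phi>) + 12 * \<rho>"
proof -
  obtain Q1 Q2 where \<Phi>_eq: "\<Phi> = (Q1, Q2)" by (cases \<Phi>)
  obtain p q where pq: "resolvent4 \<Phi> = (p, q)" "p = pf (pencil \<Phi>)" "form_over 2 R p" "form_over 4 R q"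
    using \<Phi> by (rule resolvent4_forms)
  obtain p' q' where pq': "resolvent4 (act4 (M, N) \<Phi>) = (p', q')" "p' = pf (pencil (act4 (M, N) \<Phi>))"
    "form_over 2 R p'" "form_over 4 R q'"
    using \<Phi>' by (rule resolvent4_forms)
  define P where "P i = Const (M $ i $ 1) * Q1 + Const (M $ i $ 2) * Q2" for i
  have act: "act4 (M, N) \<Phi> = (lin_subst N (P 1), lin_subst N (P 2))"
    by (simp only: act4_def \<Phi>_eq prod.case P_def)
  have F2': "F2 (p', q') = Const (det N ^ 2) * lin_subst M (F2 (p, q))"
    using F2_resolvent4_act4[of M N \<Phi>] unfolding pq(1) pq'(1) .
  have b2': "b2_2 (p', q') = det N ^ 2 * mp_coeff (lin_subst M (F2 (p, q))) [1,1,2,2]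
    - 6 * pf (lin_subst N (P 1)) * pf (lin_subst N (P 2))"
    unfolding b2_2_eq[OF pq'(3)] F2' mp_coeff_Const_mult
    unfolding pq'(2) act mp_coeff_pf_pencil ..
  have Mp: "lin_subst M p = pf (pencil (P 1, P 2))"
    unfolding pq(2) \<Phi>_eq P_def by (rule pf_pencil_lin_subst)
  have F2_subst: "F2 (lin_subst M p, lin_subst M q) = lin_subst M (F2 (p, q))"
    by (simp add: F2_def)
  have b2M: "b2_2 (lin_subst M p, lin_subst M q) = mp_coeff (lin_subst M (F2 (p, q))) [1,1,2,2] - 6 * pf (P 1) * pf (P 2)"
    unfolding b2_2_eq[OF form_over_lin_subst[OF subring_set_UNIV UNIV_I form_over_UNIV[OF pq(3)]]] F2_subst
    unfolding Mp mp_coeff_pf_pencil ..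
  have eq: "b2_2 (p', q') = (det M * det N) ^ 2 * b2_2 (p, q)
    + 12 * (det N ^ 2 * \<sigma> - (det N * (pf (P 1) * \<rho> 2 + pf (P 2) * \<rho> 1) + 2 * \<rho> 1 * \<rho> 2))"
    if \<rho>: "\<And>i. pf (lin_subst N (P i)) = det N * pf (P i) + 2 * \<rho> i"
      and \<sigma>: "b2_2 (lin_subst M p, lin_subst M q) = det M ^ 2 * b2_2 (p, q) + 12 * \<sigma>" for \<rho> \<sigma>
    unfolding b2' \<rho> using b2M \<sigma> by algebra
  have "\<exists>\<rho>\<in>R. b2_2 (p', q') = (det M * det N) ^ 2 * b2_2 (p, q) + 12 * \<rho>"
    using g
  proof
    assume "(M, N) \<in> G4_over R"
    then have M: "\<And>i j. M $ i $ j \<in> R" and N: "\<And>i j. N $ i $ j \<in> R"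
      by (auto simp: G4_over_def GL_def)
    have P: "form_over 2 R (P i)" for i
      using \<Phi> unfolding P_def \<Phi>_eq model4_over_def
      by (auto intro!: form_over_add form_over_Const_mult subring_set_R M)
    have "\<forall>i. \<exists>\<rho>\<in>R. pf (lin_subst N (P i)) = det N * pf (P i) + 2 * \<rho>"
      using pf_lin_subst[OF N P] by blast
    then obtain \<rho> where \<rho>: "\<And>i. \<rho> i \<in> R" "\<And>i. pf (lin_subst N (P i)) = det N * pf (P i) + 2 * \<rho> i"
      by metis
    show ?thesis
      by (rule bexI, rule eq[OF \<rho>(2) b2_2_lin_subst[OF pq(3,4)]])
        (intro R_add R_mult R_diff R_power R_det pf_R P \<rho>(1) N M R_numeral
          form_over_coeff[OF subring_set_R pq(4)])
  next
    assume "diagonal4 (M, N)"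
    then have M: "M $ 1 $ 2 = 0" "M $ 2 $ 1 = 0" and N: "diagonal_matrix N"
      by (auto simp: diagonal4_def diagonal_matrix_def)
    have "b2_2 (lin_subst M p, lin_subst M q) = det M ^ 2 * b2_2 (p, q) + 12 * 0"
      unfolding b2_2_lin_subst[OF pq(3,4)] by (simp add: M)
    from eq[OF _ this, of "\<lambda>_. 0"] show ?thesis
      by (intro bexI[of _ 0]) (simp_all add: pf_diagonal[OF N])
  qed
  then show ?thesis unfolding pq(1) pq'(1) .
qed

lemma max_val_abs_degree4:
  assumes c: "c > 1" and \<Phi>: "model4_over R \<Phi>" and \<Phi>': "model4_over R (act4 (M, N) \<Phi>)"
    and g: "(M, N) \<in> G4_over R \<or> det4 (M, N) \<in> unit_set R \<and> diagonal4 (M, N)"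
    and x: "x = transpose N *v x'" and on: "on_curve4 \<Phi> x"
  shows "max (val_abs c v (mp_eval (F4 (act4 (M, N) \<Phi>)) x')) (val_abs c v (mp_eval (G4 (act4 (M, N) \<Phi>)) x'))
    = val_abs c v (det N) powi (- 2) * max (val_abs c v (mp_eval (F4 \<Phi>) x)) (val_abs c v (mp_eval (G4 \<Phi>) x))"
proof -
  obtain Q1 Q2 where \<Phi>_eq: "\<Phi> = (Q1, Q2)" by (cases \<Phi>)
  obtain p q where pq: "resolvent4 \<Phi> = (p, q)" "form_over 2 R p" "form_over 4 R q"
    using \<Phi> by (rule resolvent4_forms)
  obtain p' q' where pq': "resolvent4 (act4 (M, N) \<Phi>) = (p', q')" "form_over 2 R p'" "form_over 4 R q'"
    using \<Phi>' by (rule resolvent4_forms)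
  have unit: "det M * det N \<in> unit_set R"
    using g
  proof
    assume "(M, N) \<in> G4_over R"
    then have "det M \<in> unit_set R" "det N \<in> unit_set R"
      using GL_det_unit by (auto simp: G4_over_def)
    then show ?thesis by (auto simp: unit_v v_mult)
  qed (simp add: det4_def)
  then have nz: "det M \<noteq> 0" "det N \<noteq> 0" by (auto simp: unit_v)
  obtain \<rho> where \<rho>: "\<rho> \<in> R" "b2_2 (p', q') = (det M * det N) ^ 2 * b2_2 (p, q) + 12 * \<rho>"
    using b2_2_resolvent4[OF \<Phi> \<Phi>'] g unfolding pq(1) pq'(1) by blast
  define s where "s = det M ^ 3 * det N ^ 2"
  let ?\<tau> = "pencil_point \<Phi> x" and ?\<tau>' = "pencil_point (act4 (M, N) \<Phi>) x'"
  have \<tau>: "transpose M *v ?\<tau>' = s *s ?\<tau>"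
  proof -
    have Q: "form_over 2 R Q1" "form_over 2 R Q2" "mp_eval Q1 x = 0" "mp_eval Q2 x = 0"
      using \<Phi> on by (simp_all add: model4_over_def on_curve4_def \<Phi>_eq)
    show ?thesis
      unfolding \<Phi>_eq s_def by (rule pencil_point_act4[OF Q(1,2) x Q(3,4) nz(1)])
  qed
  have F2': "F2 (p', q') = Const (det N ^ 2) * lin_subst M (F2 (p, q))"
    using F2_resolvent4_act4[of M N \<Phi>] unfolding pq(1) pq'(1) .
  \<comment> \<open>F2 and its Hessian determinant both have degree 4, so the scalar s between the
    pencil points enters as s^4.\<close>
  have quartic: "form_over 4 UNIV (F2 (p, q))"
    by (intro form_over_F2 form_over_UNIV pq)
  have F: "mp_eval (F2 (p', q')) ?\<tau>' = det N ^ 2 * s ^ 4 * mp_eval (F2 (p, q)) ?\<tau>"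
    unfolding F2' eval.hom_mult mp_eval_Const mp_eval_lin_subst \<tau> mp_eval_form_scale[OF quartic] by simp
  have hess: "mp_eval (det (hessian (F2 (p', q')))) ?\<tau>'
    = det N ^ 4 * det M ^ 2 * s ^ 4 * mp_eval (det (hessian (F2 (p, q)))) ?\<tau>"
  proof -
    have "det (hessian (F2 (p', q'))) = Const (det N ^ 4) * det (hessian (lin_subst M (F2 (p, q))))"
      unfolding F2' by (simp add: hessian_Const_mult det_2 algebra_simps eval_nat_numeral)
    then show ?thesis
      unfolding det_hessian_lin_subst
      by (simp only: eval.hom_mult mp_eval_Const mp_eval_lin_subst \<tau> mult.assoc
          mp_eval_form_scale[OF form_over_det_hessian[OF quartic]])
  qed
  \<comment> \<open>With s^4 = det M^12 det N^8, the weights become powers 12 for F and 14 for the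
    Hessian once det N^2 is multiplied in.\<close>
  have G: "mp_eval (G4 (act4 (M, N) \<Phi>)) x' * (det N)\<^sup>2 = (det M * det N) ^ 14 * mp_eval (G4 \<Phi>) x
      - \<rho> * (det M * det N) ^ 12 * mp_eval (F4 \<Phi>) x"
    unfolding mp_eval_G4 mp_eval_F4 pq(1) pq'(1) mp_eval_G2[OF pq'(2,3)] mp_eval_G2[OF pq(2,3)] F hess \<rho>(2) s_def
    by (simp add: field_simps eval_nat_numeral)
  have F: "mp_eval (F4 (act4 (M, N) \<Phi>)) x' * (det N)\<^sup>2 = (det M * det N) ^ 12 * mp_eval (F4 \<Phi>) x"
    unfolding mp_eval_F4 pq(1) pq'(1) F s_def by (simp add: power_mult_distrib flip: power_add power_mult)
  show ?thesis
    by (rule max_val_abs_eq[OF c nz(2) unit \<rho>(1) F G])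
qed

end

theorem theorem4p4:
  fixes p :: nat and Qp :: "'a::field_char_0 set" and w :: "'a \<Rightarrow> real"
    and v :: "'a \<Rightarrow> int" and c :: real
  assumes Qp: "padic_numbers p Qp w"
    and K: "finite_over Qp"
    and v: "normalised_valuation p Qp w v"
    and c: "c > 1"
  shows
    "(\<forall>\<Phi> \<Phi>' \<mu> r N x y x' y'.
        model2_over (val_ring v) \<Phi> \<longrightarrow> model2_over (val_ring v) \<Phi>' \<longrightarrow>
        (\<mu>, r, N) \<in> G2_over UNIV \<longrightarrow> \<Phi>' = act2 (\<mu>, r, N) \<Phi> \<longrightarrow>
        on_curve2 \<Phi> (x, y) \<longrightarrow> on_curve2 \<Phi>' (x', y') \<longrightarrow>
        (\<forall>j. x $ j = (\<Sum>i\<in>UNIV. N $ i $ j * x' $ i)) \<longrightarrow>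
        (\<mu>, r, N) \<in> G2_over (val_ring v) \<or>
          det2 (\<mu>, r, N) \<in> unit_set (val_ring v) \<and> diagonal2 (\<mu>, r, N) \<longrightarrow>
        max (val_abs c v (mp_eval (F2 \<Phi>') x')) (val_abs c v (mp_eval (G2 \<Phi>') x'))
          = val_abs c v (det N) powi (- 2)
            * max (val_abs c v (mp_eval (F2 \<Phi>) x)) (val_abs c v (mp_eval (G2 \<Phi>) x))) \<and>
     (\<forall>\<Phi> \<Phi>' \<mu> N x x'.
        model3_over (val_ring v) \<Phi> \<longrightarrow> model3_over (val_ring v) \<Phi>' \<longrightarrow>
        (\<mu>, N) \<in> G3_over UNIV \<longrightarrow> \<Phi>' = act3 (\<mu>, N) \<Phi> \<longrightarrow>
        on_curve3 \<Phi> x \<longrightarrow> on_curve3 \<Phi>' x' \<longrightarrow>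
        (\<forall>j. x $ j = (\<Sum>i\<in>UNIV. N $ i $ j * x' $ i)) \<longrightarrow>
        (\<mu>, N) \<in> G3_over (val_ring v) \<or>
          det3 (\<mu>, N) \<in> unit_set (val_ring v) \<and> diagonal3 (\<mu>, N) \<longrightarrow>
        max (val_abs c v (mp_eval (F3 \<Phi>') x')) (val_abs c v (mp_eval (G3 \<Phi>') x'))
          = val_abs c v (det N) powi (- 2)
            * max (val_abs c v (mp_eval (F3 \<Phi>) x)) (val_abs c v (mp_eval (G3 \<Phi>) x))) \<and>
     (\<forall>\<Phi> \<Phi>' M N x x'.
        model4_over (val_ring v) \<Phi> \<longrightarrow> model4_over (val_ring v) \<Phi>' \<longrightarrow>
        (M, N) \<in> G4_over UNIV \<longrightarrow> \<Phi>' = act4 (M, N) \<Phi> \<longrightarrow>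
        on_curve4 \<Phi> x \<longrightarrow> on_curve4 \<Phi>' x' \<longrightarrow>
        (\<forall>j. x $ j = (\<Sum>i\<in>UNIV. N $ i $ j * x' $ i)) \<longrightarrow>
        (M, N) \<in> G4_over (val_ring v) \<or>
          det4 (M, N) \<in> unit_set (val_ring v) \<and> diagonal4 (M, N) \<longrightarrow>
        max (val_abs c v (mp_eval (F4 \<Phi>') x')) (val_abs c v (mp_eval (G4 \<Phi>') x'))
          = val_abs c v (det N) powi (- 2)
            * max (val_abs c v (mp_eval (F4 \<Phi>) x)) (val_abs c v (mp_eval (G4 \<Phi>) x)))"
proof (intro conjI allI impI)
  interpret valuation_ring v
    using v by unfold_locales (auto simp: normalised_valuation_def)
  have x_eq: "x = transpose N *v x'" if "\<forall>j. x $ j = (\<Sum>i\<in>UNIV. N $ i $ j * x' $ i)"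
    for x x' :: "'a^'n" and N :: "'a^'n^'n"
    unfolding vec_eq_iff matrix_vector_mult_component transpose_apply by (rule that)
  {
    fix \<Phi> \<Phi>' \<mu> r N x y x' y'
    assume "model2_over R \<Phi>" "model2_over R \<Phi>'" "\<Phi>' = act2 (\<mu>, r, N) \<Phi>"
      "\<forall>j. x $ j = (\<Sum>i\<in>UNIV. N $ i $ j * x' $ i)"
      "(\<mu>, r, N) \<in> G2_over R \<or> det2 (\<mu>, r, N) \<in> unit_set R \<and> diagonal2 (\<mu>, r, N)"
    then show "max (val_abs c v (mp_eval (F2 \<Phi>') x')) (val_abs c v (mp_eval (G2 \<Phi>') x'))
      = val_abs c v (det N) powi (- 2) * max (val_abs c v (mp_eval (F2 \<Phi>) x)) (val_abs c v (mp_eval (G2 \<Phi>) x))"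
      using max_val_abs_degree2[OF c] x_eq by blast
  next
    fix \<Phi> \<Phi>' \<mu> N x x'
    assume "model3_over R \<Phi>" "\<Phi>' = act3 (\<mu>, N) \<Phi>" "on_curve3 \<Phi> x"
      "\<forall>j. x $ j = (\<Sum>i\<in>UNIV. N $ i $ j * x' $ i)"
      "(\<mu>, N) \<in> G3_over R \<or> det3 (\<mu>, N) \<in> unit_set R \<and> diagonal3 (\<mu>, N)"
    then show "max (val_abs c v (mp_eval (F3 \<Phi>') x')) (val_abs c v (mp_eval (G3 \<Phi>') x'))
      = val_abs c v (det N) powi (- 2) * max (val_abs c v (mp_eval (F3 \<Phi>) x)) (val_abs c v (mp_eval (G3 \<Phi>) x))"
      using max_val_abs_degree3[OF c] x_eq unfolding on_curve3_def by blast
  next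
    fix \<Phi> \<Phi>' M N x x'
    assume "model4_over R \<Phi>" "model4_over R \<Phi>'" "\<Phi>' = act4 (M, N) \<Phi>" "on_curve4 \<Phi> x"
      "\<forall>j. x $ j = (\<Sum>i\<in>UNIV. N $ i $ j * x' $ i)"
      "(M, N) \<in> G4_over R \<or> det4 (M, N) \<in> unit_set R \<and> diagonal4 (M, N)"
    then show "max (val_abs c v (mp_eval (F4 \<Phi>') x')) (val_abs c v (mp_eval (G4 \<Phi>') x'))
      = val_abs c v (det N) powi (- 2) * max (val_abs c v (mp_eval (F4 \<Phi>) x)) (val_abs c v (mp_eval (G4 \<Phi>) x))"
      using max_val_abs_degree4[OF c] x_eq by blast
  }
qed

end
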